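(* Let $P$ be a random homogeneous polynomial of degree $d$ in three complex variables distributed according to $\mu_d$, and let $Z(P)\subset \mathbb{C}P^2$ be its zero locus equipped with the restriction $g_{FS|Z(P)}$ of the Fubini-Study metric. Then $$\mu_d\left[\operatorname{syst}(Z(P),g_{FS|Z(P)})\ \geq\ d^{-4}\right]\ \longrightarrow\ 1\qquad\text{as } d\to\infty .$$
   Context: $\mathbb{C}_d^{hom}[X_0,X_1,X_2]$ is the space of complex homogeneous polynomials of degree $d$ in three variables and $N_d$ is its complex dimension. The random polynomial is $$P=\sum_{i+j+k=d} a_{i,j,k}\sqrt{\frac{(d+2)!}{2\, i!j!k!}}\,X_0^iX_1^jX_2^k,$$ where the coefficient vector $(a_{i,j,k})_{i+j+k=d}$ is chosen uniformly on $\mathbb{C}P^{N_d-1}$ for the Fubini-Study measure (equivalently, uniformly on the unit sphere $\mathbb{S}^{2N_d-1}\subset\mathbb{C}^{N_d}$); $\mu_d$ denotes the resulting probability measure. Almost surely $Z(P)=\{P=0\}\subset\mathbb{C}P^2$ is a smooth connected compact Riemann surface of genus $\frac12(d-1)(d-2)$. $g_{FS}$ is the Fubini-Study metric on $\mathbb{C}P^2$, i.e. the Kähler metric associated with the curvature form of the standard metric on $\mathcal{O}(1)$ (so that a complex line has area $1$). The systole $\operatorname{syst}(M,g)$ of a compact Riemannian manifold is the infimum of the lengths of its non-contractible smooth closed curves ($+\infty$ if $M$ is simply connected). *)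

theory Defs
  imports "HOL-Probability.Probability"
begin

section \<open>The complex projective plane\<close>

definition proportional :: "complex ^ 3 \<Rightarrow> complex ^ 3 \<Rightarrow> bool" where
  "proportional z w \<longleftrightarrow> z \<noteq> 0 \<and> w \<noteq> 0 \<and> (\<exists>c. w = c *s z)"

lemma part_equivp_proportional: "part_equivp proportional"
proof (rule part_equivpI)
  show "\<exists>z. proportional z z"
    by (rule exI[of _ 1]) (auto simp: proportional_def intro: exI[of _ 1])
  show "symp proportional"
  proof (rule sympI)
    fix z w assume "proportional z w"
    then obtain c where c: "z \<noteq> 0" "w \<noteq> 0" "w = c *s z" by (auto simp: proportional_def)
    then have "z = (1 / c) *s w" by (auto simp: vec_eq_iff)
    with c show "proportional w z" unfolding proportional_def by blast
  qed
  show "transp proportional"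
    by (rule transpI) (auto simp: proportional_def)
qed

quotient_type cp2 = "complex ^ 3" / partial: proportional
  by (rule part_equivp_proportional)

text \<open>The map \<open>abs_cp2\<close> is the projection sending a nonzero \<open>z\<close> to \<open>[z]\<close>; its value
  at \<open>0\<close> is meaningless, hence the guards \<open>z \<noteq> 0\<close> below.  The topology is the
  quotient topology.\<close>

instantiation cp2 :: topological_space
begin

definition open_cp2 :: "cp2 set \<Rightarrow> bool" where
  "open_cp2 U \<longleftrightarrow> open {z. z \<noteq> 0 \<and> abs_cp2 z \<in> U}"

instance
proof
  have "{z :: complex ^ 3. z \<noteq> 0} = - {0}" by auto
  then show "open (UNIV :: cp2 set)" by (simp add: open_cp2_def open_Compl)
next
  fix S T :: "cp2 set" assume "open S" "open T"
  moreover have "{z. z \<noteq> 0 \<and> abs_cp2 z \<in> S \<inter> T} =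
    {z. z \<noteq> 0 \<and> abs_cp2 z \<in> S} \<inter> {z. z \<noteq> 0 \<and> abs_cp2 z \<in> T}" by auto
  ultimately show "open (S \<inter> T)" by (simp add: open_cp2_def open_Int)
next
  fix K :: "cp2 set set" assume "\<forall>S\<in>K. open S"
  moreover have "{z. z \<noteq> 0 \<and> abs_cp2 z \<in> \<Union>K} = (\<Union>S\<in>K. {z. z \<noteq> 0 \<and> abs_cp2 z \<in> S})" by auto
  ultimately show "open (\<Union>K)" by (simp add: open_cp2_def open_UN)
qed

end

text \<open>\<open>affine_rep k p\<close> is the representative of \<open>p\<close> whose \<open>k\<close>-th homogeneous coordinate is \<open>1\<close>;
  on \<open>in_chart k\<close> its other two components are the affine coordinates of \<open>p\<close>.\<close>

lift_definition in_chart :: "3 \<Rightarrow> cp2 \<Rightarrow> bool" is "\<lambda>k z. z $ k \<noteq> 0"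
  by (auto simp: proportional_def)

lift_definition affine_rep :: "3 \<Rightarrow> cp2 \<Rightarrow> complex ^ 3" is "\<lambda>k z. (1 / z $ k) *s z"
  by (auto simp: proportional_def vec_eq_iff)


section \<open>The Fubini-Study metric and lengths of smooth curves\<close>

definition hermitian :: "complex ^ 3 \<Rightarrow> complex ^ 3 \<Rightarrow> complex" where
  "hermitian v w = (\<Sum>i\<in>UNIV. v $ i * cnj (w $ i))"

text \<open>\<open>fubini_study z v w\<close> is the pullback of the metric to \<open>\<complex>\<^sup>3 - {0}\<close>: the value of \<open>g_FS\<close>
  at \<open>[z]\<close> on the images of \<open>v\<close> and \<open>w\<close> under the differential of the projection.  The Kaehler form is
  \<open>(i / 2\<pi>) \<partial> \<partial>bar log |z|^2\<close>, the curvature form of \<open>O(1)\<close>.  In an affine coordinate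
  \<open>x + iy\<close> of a complex line the metric is \<open>(dx^2 + dy^2) / (\<pi> (1 + x^2 + y^2)^2)\<close>, whose
  total area is 1.\<close>

definition fubini_study :: "complex ^ 3 \<Rightarrow> complex ^ 3 \<Rightarrow> complex ^ 3 \<Rightarrow> real" where
  "fubini_study z v w =
     Re ((hermitian v w * hermitian z z - hermitian v z * hermitian z w) / (hermitian z z)\<^sup>2) / pi"

definition C_infinity_on :: "(real \<Rightarrow> 'a :: real_normed_vector) \<Rightarrow> real set \<Rightarrow> bool" where
  "C_infinity_on f S \<longleftrightarrow>
     (\<exists>F. F 0 = f \<and> (\<forall>n. \<forall>t\<in>S. (F n has_vector_derivative F (Suc n) t) (at t)))"

definition smooth_curve :: "(real \<Rightarrow> cp2) \<Rightarrow> bool" where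
  "smooth_curve \<gamma> \<longleftrightarrow> continuous_on UNIV \<gamma> \<and>
     (\<forall>k. C_infinity_on (affine_rep k \<circ> \<gamma>) {t. in_chart k (\<gamma> t)})"

text \<open>Closed curves are smooth maps on the circle \<open>\<real> / \<int>\<close>.\<close>

definition smooth_closed_curve :: "(real \<Rightarrow> cp2) \<Rightarrow> bool" where
  "smooth_closed_curve \<gamma> \<longleftrightarrow> smooth_curve \<gamma> \<and> (\<forall>t. \<gamma> (t + 1) = \<gamma> t)"

text \<open>The Fubini-Study norm of the velocity, computed in the affine chart \<open>k\<close>.\<close>

definition chart_speed :: "3 \<Rightarrow> (real \<Rightarrow> cp2) \<Rightarrow> real \<Rightarrow> real" where
  "chart_speed k \<gamma> t =
     (let z = affine_rep k (\<gamma> t); v = vector_derivative (affine_rep k \<circ> \<gamma>) (at t)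
      in sqrt (fubini_study z v v))"

text \<open>The choice of the chart is irrelevant, see \<open>fs_speed_eq\<close> below.\<close>

definition fs_speed :: "(real \<Rightarrow> cp2) \<Rightarrow> real \<Rightarrow> real" where
  "fs_speed \<gamma> t = chart_speed (SOME k. in_chart k (\<gamma> t)) \<gamma> t"

lemma in_chart_abs: "z \<noteq> 0 \<Longrightarrow> in_chart k (abs_cp2 z) \<longleftrightarrow> z $ k \<noteq> 0"
  by (rule in_chart.abs_eq, unfold proportional_def, rule conjI, assumption, rule conjI, assumption,
      rule exI[of _ 1], simp)

lemma open_in_chart: "open {p. in_chart k p}"
proof -
  have "{z. z \<noteq> 0 \<and> abs_cp2 z \<in> {p. in_chart k p}} = {z. z $ k \<noteq> 0}"
    using in_chart_abs by (metis (lifting) mem_Collect_eq zero_index)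
  also have "open \<dots>"
    by (intro open_Collect_neq continuous_intros)
  finally show ?thesis by (simp add: open_cp2_def)
qed

lemma affine_rep_nth: "in_chart k p \<Longrightarrow> affine_rep k p $ k = 1"
  by transfer (simp add: vector_scalar_mult_def)

lemma affine_rep_nth_nonzero: "in_chart k p \<Longrightarrow> in_chart l p \<Longrightarrow> affine_rep k p $ l \<noteq> 0"
  by transfer (simp add: vector_scalar_mult_def)

lemma affine_rep_change:
  "in_chart k p \<Longrightarrow> in_chart l p \<Longrightarrow> affine_rep l p = (1 / affine_rep k p $ l) *s affine_rep k p"
  by transfer (simp add: vector_scalar_mult_def)

lemma ex_in_chart: "\<exists>k. in_chart k p"
  by transfer (simp add: proportional_def vec_eq_iff)

lemma fubini_study_change_rep:
  assumes "z \<noteq> 0" "c \<noteq> 0"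
  shows "fubini_study (c *s z) (b *s z + c *s v) (b *s z + c *s v) = fubini_study z v v"
proof -
  define A where "A = hermitian z z"
  define B where "B = hermitian v z"
  define C where "C = hermitian v v"
  define c' b' where "c' = cnj c" "b' = cnj b"
  have B': "hermitian z v = cnj B" by (simp add: B_def hermitian_def mult.commute)
  have 1: "hermitian (c *s z) (c *s z) = c * c' * A"
    by (simp add: A_def c'_b'_def hermitian_def sum_distrib_left mult_ac)
  have 2: "hermitian (b *s z + c *s v) (c *s z) = c' * (b * A + c * B)"
    by (simp add: A_def B_def c'_b'_def hermitian_def sum_distrib_left sum.distrib algebra_simps)
  have 3: "hermitian (c *s z) (b *s z + c *s v) = c * (b' * A + c' * cnj B)"
    unfolding B'[symmetric]
    by (simp add: A_def c'_b'_def hermitian_def sum_distrib_left sum.distrib algebra_simps)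
  have 4: "hermitian (b *s z + c *s v) (b *s z + c *s v) =
     b * b' * A + b * c' * cnj B + c * b' * B + c * c' * C"
    unfolding B'[symmetric]
    by (simp add: A_def B_def C_def c'_b'_def hermitian_def sum_distrib_left sum.distrib algebra_simps)
  have cc: "c * c' \<noteq> 0" using assms by (simp add: c'_b'_def)
  have "(b * b' * A + b * c' * cnj B + c * b' * B + c * c' * C) * (c * c' * A)
      - c' * (b * A + c * B) * (c * (b' * A + c' * cnj B))
      = (c * c')\<^sup>2 * (C * A - B * cnj B)"
    by (simp add: algebra_simps power2_eq_square)
  then show ?thesis
    using cc unfolding fubini_study_def 1 2 3 4 B' A_def[symmetric] B_def[symmetric] C_def[symmetric]
    by (simp add: power_mult_distrib)
qed

lemma fs_speed_eq:
  assumes "smooth_curve \<gamma>" and k: "in_chart k (\<gamma> t)"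
  shows "fs_speed \<gamma> t = chart_speed k \<gamma> t"
proof -
  define l where "l = (SOME l. in_chart l (\<gamma> t))"
  have l: "in_chart l (\<gamma> t)" unfolding l_def using ex_in_chart by (rule someI_ex)
  define z where "z = affine_rep k \<circ> \<gamma>"
  define v where "v = vector_derivative z (at t)"
  have dz: "(z has_vector_derivative v) (at t)"
  proof -
    obtain F where "F 0 = z" "\<forall>n. \<forall>t\<in>{t. in_chart k (\<gamma> t)}. (F n has_vector_derivative F (Suc n) t) (at t)"
      using assms(1) unfolding smooth_curve_def C_infinity_on_def z_def by blast
    then have "(z has_vector_derivative F (Suc 0) t) (at t)" using k by (metis mem_Collect_eq)
    then show ?thesis unfolding v_def by (metis vector_derivative_at)
  qed
  have zl: "z t $ l \<noteq> 0" and zk: "z t \<noteq> 0"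
    using affine_rep_nth_nonzero[OF k l] by (auto simp: z_def)
  define c where "c = (\<lambda>s. 1 / z s $ l)"
  have dzl: "((\<lambda>s. z s $ i) has_vector_derivative v $ i) (at t)" for i
    by (rule bounded_linear.has_vector_derivative[OF bounded_linear_vec_nth dz])
  define b where "b = - (v $ l) / (z t $ l)\<^sup>2"
  have dc: "(c has_vector_derivative b) (at t)"
    using dzl[of l] zl unfolding c_def b_def has_vector_derivative_def
    by (auto intro!: derivative_eq_intros simp: fun_eq_iff field_simps power2_eq_square)
  have "((\<lambda>s. c s *s z s) has_vector_derivative b *s z t + c t *s v) (at t)"
  proof -
    have ax: "bounded_linear (\<lambda>x :: complex. axis i x :: complex ^ 3)" for i
      by (intro linear_conv_bounded_linear[THEN iffD1] linearI) (auto simp: axis_def vec_eq_iff)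
    have "((\<lambda>s. c s * z s $ i) has_vector_derivative c t * v $ i + b * z t $ i) (at t)" for i
      by (rule has_vector_derivative_mult[OF dc dzl])
    then have "((\<lambda>s. \<Sum>i\<in>UNIV. axis i (c s * z s $ i) :: complex ^ 3) has_vector_derivative
        (\<Sum>i\<in>UNIV. axis i (c t * v $ i + b * z t $ i))) (at t)"
      by (intro has_vector_derivative_sum bounded_linear.has_vector_derivative[OF ax])
    moreover have "(\<Sum>i\<in>UNIV. axis i (x i) :: complex ^ 3) = (\<chi> i. x i)" for x
      by (simp add: vec_eq_iff axis_def if_distrib cong: if_cong)
    ultimately have "((\<lambda>s. \<chi> i. c s * z s $ i) has_vector_derivative (\<chi> i. c t * v $ i + b * z t $ i)) (at t)"
      by simp
    then show ?thesis
      by (simp add: vector_scalar_mult_def plus_vec_def add.commute)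
  qed
  moreover have ev: "\<forall>\<^sub>F s in nhds t. c s *s z s = (affine_rep l \<circ> \<gamma>) s"
  proof -
    have "open (\<gamma> -` ({p. in_chart k p} \<inter> {p. in_chart l p}))"
      using assms(1) unfolding smooth_curve_def
      by (intro open_vimage open_Int open_in_chart) auto
    moreover have "t \<in> \<gamma> -` ({p. in_chart k p} \<inter> {p. in_chart l p})" using k l by simp
    ultimately have "\<forall>\<^sub>F s in nhds t. s \<in> \<gamma> -` ({p. in_chart k p} \<inter> {p. in_chart l p})"
      by (rule eventually_nhds_in_open)
    then show ?thesis
    proof eventually_elim
      case (elim s)
      then have "in_chart k (\<gamma> s)" "in_chart l (\<gamma> s)" by auto
      from affine_rep_change[OF this] show ?case by (simp add: c_def z_def)
    qed
  qed
  ultimately have "((affine_rep l \<circ> \<gamma>) has_vector_derivative b *s z t + c t *s v) (at t)"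
    using has_vector_derivative_cong_ev[of UNIV "\<lambda>s. c s *s z s" "affine_rep l \<circ> \<gamma>" t]
      eventually_nhds_x_imp_x[OF ev] by simp
  then have "vector_derivative (affine_rep l \<circ> \<gamma>) (at t) = b *s z t + c t *s v"
    by (rule vector_derivative_at)
  moreover have "affine_rep l (\<gamma> t) = c t *s z t"
    unfolding affine_rep_change[OF k l] by (simp add: c_def z_def)
  moreover have "c t \<noteq> 0" using zl by (simp add: c_def)
  ultimately show ?thesis
    unfolding fs_speed_def l_def[symmetric] chart_speed_def Let_def
    using fubini_study_change_rep[OF zk \<open>c t \<noteq> 0\<close>] by (simp add: z_def v_def)
qed

definition fs_length :: "(real \<Rightarrow> cp2) \<Rightarrow> real" where
  "fs_length \<gamma> = integral {0..1} (fs_speed \<gamma>)"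

text \<open>The systole of \<open>Z\<close> with the restriction of the Fubini-Study metric.  If \<open>Z\<close> is an embedded
  submanifold, then the smooth curves in \<open>Z\<close> are the smooth curves of the projective plane with
  values in \<open>Z\<close>, and their lengths for the restricted metric are their Fubini-Study lengths.
  Contractibility refers to free homotopies inside \<open>Z\<close>.  The infimum of the empty set is \<open>\<infinity>\<close>.\<close>

definition contractible_loop :: "'a :: topological_space set \<Rightarrow> (real \<Rightarrow> 'a) \<Rightarrow> bool" where
  "contractible_loop Z \<gamma> \<longleftrightarrow> (\<exists>p\<in>Z. homotopic_loops Z \<gamma> (\<lambda>_. p))"

definition systole :: "cp2 set \<Rightarrow> ereal" where
  "systole Z = Inf {ereal (fs_length \<gamma>) | \<gamma>.
     smooth_closed_curve \<gamma> \<and> range \<gamma> \<subseteq> Z \<and> \<not> contractible_loop Z \<gamma>}"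


section \<open>Random homogeneous polynomials\<close>

definition exponents :: "nat \<Rightarrow> (nat \<times> nat \<times> nat) set" where
  "exponents d = {(i, j, k). i + j + k = d}"

definition hom_poly :: "nat \<Rightarrow> (nat \<times> nat \<times> nat \<Rightarrow> complex) \<Rightarrow> complex ^ 3 \<Rightarrow> complex" where
  "hom_poly d a z = (\<Sum>(i, j, k)\<in>exponents d.
     a (i, j, k) * complex_of_real (sqrt (fact (d + 2) / (2 * fact i * fact j * fact k)))
       * z $ 1 ^ i * z $ 2 ^ j * z $ 3 ^ k)"

definition zero_locus :: "(complex ^ 3 \<Rightarrow> complex) \<Rightarrow> cp2 set" where
  "zero_locus P = abs_cp2 ` {z. z \<noteq> 0 \<and> P z = 0}"

text \<open>The space \<open>\<complex>\<^sup>I\<close> is \<open>I \<rightarrow>\<^sub>E UNIV\<close>, with norm \<open>cnorm I\<close>.\<close>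

definition cnorm :: "'i set \<Rightarrow> ('i \<Rightarrow> complex) \<Rightarrow> real" where
  "cnorm I a = L2_set (\<lambda>i. norm (a i)) I"

text \<open>The uniform (normalised surface) measure on the unit sphere of \<open>\<complex>\<^sup>I\<close>, defined as usual by
  cones: a subset \<open>A\<close> of the sphere has the measure of the part of the unit ball on the rays
  through \<open>A\<close>, divided by the measure of the ball.  The completion makes events
  insensitive to the null set of polynomials whose zero locus is singular, where \<open>systole\<close> has no
  geometric meaning.\<close>

definition uniform_csphere :: "'i set \<Rightarrow> ('i \<Rightarrow> complex) measure" where
  "uniform_csphere I = completion (restrict_space
     (distr (uniform_measure (\<Pi>\<^sub>M i\<in>I. lborel) {a \<in> I \<rightarrow>\<^sub>E UNIV. cnorm I a \<le> 1})
            (\<Pi>\<^sub>M i\<in>I. borel)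
            (\<lambda>a. \<lambda>i\<in>I. a i / complex_of_real (cnorm I a)))
     {a \<in> I \<rightarrow>\<^sub>E UNIV. cnorm I a = 1})"

definition mu :: "nat \<Rightarrow> (nat \<times> nat \<times> nat \<Rightarrow> complex) measure" where
  "mu d = uniform_csphere (exponents d)"

lemma finite_exponents: "finite (exponents d)"
proof (rule finite_subset)
  show "exponents d \<subseteq> {..d} \<times> {..d} \<times> {..d}" by (auto simp: exponents_def)
qed auto

lemma exponents_nonempty: "exponents d \<noteq> {}"
proof -
  have "(d, 0, 0) \<in> exponents d" by (simp add: exponents_def)
  then show ?thesis by blast
qed

lemma cnorm_eq_0_iff: "finite I \<Longrightarrow> cnorm I a = 0 \<longleftrightarrow> (\<forall>i\<in>I. a i = 0)"
  by (simp add: cnorm_def L2_set_eq_0_iff)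

lemma
  assumes I: "finite (I :: 'i set)" "I \<noteq> {}"
  shows prob_space_uniform_csphere: "prob_space (uniform_csphere I)"
    and space_uniform_csphere: "space (uniform_csphere I) = {a \<in> I \<rightarrow>\<^sub>E UNIV. cnorm I a = 1}"
proof -
  let ?L = "\<Pi>\<^sub>M i\<in>I. (lborel :: complex measure)"
  let ?B = "\<Pi>\<^sub>M i\<in>I. (borel :: complex measure)"
  let ?ball = "{a \<in> I \<rightarrow>\<^sub>E UNIV. cnorm I a \<le> 1}"
  let ?sphere = "{a \<in> I \<rightarrow>\<^sub>E UNIV. cnorm I a = 1}"
  let ?f = "\<lambda>a. \<lambda>i\<in>I. a i / complex_of_real (cnorm I a)"
  interpret product_sigma_finite "\<lambda>_::'i. lborel :: complex measure"
    by (simp add: product_sigma_finite_def sigma_finite_lborel)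
  have sets_eq: "sets ?L = sets ?B" by (intro sets_PiM_cong) auto
  have space_L: "space ?L = I \<rightarrow>\<^sub>E UNIV" "space ?B = I \<rightarrow>\<^sub>E UNIV" by (auto simp: space_PiM)
  have cn[measurable]: "cnorm I \<in> borel_measurable ?B"
    unfolding cnorm_def L2_set_def by measurable
  have cnL[measurable]: "cnorm I \<in> borel_measurable ?L"
    unfolding cnorm_def L2_set_def by measurable
  have f[measurable]: "?f \<in> measurable ?B ?B"
    by (rule measurable_restrict) measurable
  have ball: "?ball \<in> sets ?L"
    using measurable_sets[OF cnL, of "{..1}"] by (simp add: vimage_def Int_def space_L conj_commute)
  have sphere: "?sphere \<in> sets ?B"
    using measurable_sets[OF cn, of "{1}"] by (simp add: vimage_def Int_def space_L conj_commute)
  have fin: "emeasure ?L ?ball \<noteq> \<infinity>"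
  proof -
    have "norm (a i) \<le> 1" if "cnorm I a \<le> 1" "i \<in> I" for a i
      using member_le_L2_set[OF I(1) that(2), of "\<lambda>i. norm (a i)"] that(1) by (simp add: cnorm_def)
    then have "?ball \<subseteq> (\<Pi>\<^sub>E i\<in>I. cball 0 1)" by (auto simp only: PiE_iff mem_Collect_eq mem_cball_0 simp_thms subset_eq Ball_def)
    then have "emeasure ?L ?ball \<le> emeasure ?L (\<Pi>\<^sub>E i\<in>I. cball 0 1)"
      by (rule emeasure_mono) (auto intro!: sets_PiM_I_finite I)
    also have "\<dots> = (\<Prod>i\<in>I. emeasure lborel (cball (0::complex) 1))"
      by (rule emeasure_PiM) (auto simp: I)
    also have "\<dots> < \<infinity>"
      by (simp add: ennreal_prod_eq_top power_less_top_ennreal emeasure_bounded_finite[unfolded infinity_ennreal_def])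
    finally show ?thesis by simp
  qed
  have pos: "emeasure ?L ?ball \<noteq> 0"
  proof -
    define r where "r = 1 / real (card I)"
    have r: "r > 0" using I by (simp add: r_def card_gt_0_iff)
    have "a \<in> ?ball" if "a \<in> (\<Pi>\<^sub>E i\<in>I. ball 0 r)" for a
    proof -
      have "cnorm I a \<le> (\<Sum>i\<in>I. norm (a i))" unfolding cnorm_def by (rule L2_set_le_sum) auto
      also have "\<dots> \<le> (\<Sum>i\<in>I. r)" using that by (intro sum_mono) (auto simp: PiE_iff less_imp_le)
      also have "\<dots> = 1" using I by (simp add: r_def)
      finally show ?thesis using that by (auto simp: PiE_iff)
    qed
    then have "emeasure ?L (\<Pi>\<^sub>E i\<in>I. ball 0 r) \<le> emeasure ?L ?ball"
      by (intro emeasure_mono ball) auto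
    moreover have "emeasure ?L (\<Pi>\<^sub>E i\<in>I. ball 0 r) = (\<Prod>i\<in>I. emeasure lborel (ball (0::complex) r))"
      by (rule emeasure_PiM) (auto simp: I)
    moreover have "emeasure lborel (ball (0::complex) r) \<noteq> 0"
      using r by (simp add: emeasure_ball unit_ball_vol_2)
    ultimately show ?thesis using I by auto
  qed
  let ?U = "uniform_measure ?L ?ball"
  interpret U: prob_space ?U by (rule prob_space_uniform_measure[OF pos fin])
  have fU: "?f \<in> measurable ?U ?B" using f sets_eq by (simp cong: measurable_cong_sets)
  let ?D = "distr ?U ?B ?f"
  interpret D: prob_space ?D by (rule U.prob_space_distr[OF fU])
  have zero: "AE a in ?L. cnorm I a \<noteq> 0"
  proof -
    have "emeasure ?L (\<Pi>\<^sub>E i\<in>I. {0}) = (\<Prod>i\<in>I. emeasure lborel {0::complex})"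
      by (rule emeasure_PiM) (auto simp: I)
    also have "\<dots> = 0" using I by (simp add: card_gt_0_iff)
    finally have "(\<Pi>\<^sub>E i\<in>I. {0::complex}) \<in> null_sets ?L"
      by (intro null_setsI sets_PiM_I_finite I) auto
    then show ?thesis
      by (rule AE_I') (auto simp: cnorm_eq_0_iff I space_L PiE_iff simp del: PiE_singleton
        intro!: extensionalityI[of _ I])
  qed
  have f_sphere: "?f a \<in> ?sphere" if "cnorm I a \<noteq> 0" for a
  proof -
    have nn: "cnorm I a \<ge> 0" by (simp add: cnorm_def)
    have "cnorm I (?f a) = L2_set (\<lambda>i. (1 / cnorm I a) * norm (a i)) I"
      unfolding cnorm_def[of I "?f a"] using nn by (intro L2_set_cong) (auto simp: norm_divide)
    also have "\<dots> = (1 / cnorm I a) * cnorm I a"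
      using nn by (subst L2_set_right_distrib[symmetric]) (auto simp: cnorm_def)
    finally show ?thesis using that by auto
  qed
  have nz: "AE a in ?U. cnorm I a \<noteq> 0"
    by (rule AE_uniform_measureI[OF ball]) (use zero in eventually_elim, simp)
  have AE_U: "AE a in ?U. ?f a \<in> ?sphere"
    using nz by (rule AE_mp) (rule AE_I2, rule impI, rule f_sphere)
  have sphere': "{a \<in> space ?B. a \<in> ?sphere} = ?sphere"
    unfolding space_L by blast
  have "AE a in ?D. a \<in> ?sphere"
    using AE_U AE_distr_iff[OF fU, of "\<lambda>a. a \<in> ?sphere", unfolded sphere', OF sphere] by (rule iffD2[rotated])
  moreover have sphereD: "?sphere \<in> sets ?D"
    unfolding sets_distr by (rule sphere)
  ultimately have "emeasure ?D ?sphere = 1"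
    by (intro D.emeasure_eq_1_AE)
  then have "prob_space (restrict_space ?D ?sphere)"
    by (rule prob_space_restrict_space[OF sphereD])
  then show "prob_space (uniform_csphere I)"
    unfolding uniform_csphere_def by (rule prob_space.prob_space_completion)
  show "space (uniform_csphere I) = ?sphere"
    unfolding uniform_csphere_def space_completion space_restrict_space space_distr space_L by blast
qed

end

theory Submission
  imports Defs "HOL-Complex_Analysis.Cauchy_Integral_Formula"
begin

text \<open>Write \<open>M\<close> for a bound of the second derivatives of \<open>P\<close> in tangent directions on the unit sphere, of
  order \<open>d^2\<close> because \<open>|P| \<le> sqrt N_d\<close> there and Cauchy's estimates hold at the scale \<open>1 / sqrt d\<close>.
  If \<open>|grad P| \<ge> \<delta>\<close> at all zeros of \<open>P\<close>, then a Newton iteration along the gradient retracts a neighbourhood of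
  \<open>Z(P)\<close> of radius about \<open>\<delta> / M\<close> onto \<open>Z(P)\<close>.  A loop in \<open>Z(P)\<close> shorter than this radius is contracted
  linearly in an affine chart, and the retraction carries the contraction into \<open>Z(P)\<close>.

  At a fixed point \<open>x\<close> the vector \<open>(P(x), dP(x))\<close> has three orthogonal components of variances \<open>1, d, d\<close>.
  A zero with \<open>|grad P| \<le> \<delta>\<close> makes \<open>|P| \<le> 3 \<delta>\<epsilon>\<close> and \<open>|dP| \<le> 3 \<delta>\<close> at the closest point of
  an \<open>\<epsilon>\<close>-net, \<open>\<epsilon> = \<delta> / M\<close>, of at most \<open>const \<epsilon>^-4\<close> points.  The union bound gives probability
  at most \<open>const \<delta>^4 d^2\<close>, which tends to \<open>0\<close> for \<open>\<delta> = const d^-2\<close>, that is for a radius of order \<open>d^-4\<close>.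

  The event is measurable because singular polynomials form a null set (let \<open>\<delta> \<rightarrow> 0\<close>) and the systole is upper
  semicontinuous elsewhere: the gradient of \<open>P\<close> pushes a short loop of \<open>Z(P)\<close> to a loop in \<open>Z(Q)\<close>, of almost the
  same length, for \<open>Q\<close> near \<open>P\<close>, and the retraction onto \<open>Z(P)\<close> shows that it is again not contractible.\<close>

section \<open>The Hermitian form\<close>

text \<open>Radially a polynomial of degree \<open>d\<close> varies at the scale
  \<open>1 / d\<close>, tangentially at the scale \<open>1 / sqrt d\<close>. The quantitative
  estimates are therefore made in tangent directions, and Euler's relation controls the radial part
  of the gradient. The perturbation argument concerns a fixed \<open>d\<close> and can afford bounds
  that are exponential in \<open>d\<close>. Power count: three complex conditions of sizes
  \<open>\<delta>\<epsilon>\<close>, \<open>\<delta>\<close>, \<open>\<delta>\<close> cost a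
  constant times \<open>(\<delta>\<epsilon>)^2 \<delta>^4 / d^2\<close> at one point, and the
  exponent of the net is the real dimension 4 of the projective plane. The product is
  \<open>\<delta>^6 / (\<epsilon>^2 d^2) = \<delta>^4 M^2 / d^2\<close>. At the chosen
  \<open>\<delta>\<close> this is of order \<open>d^-6\<close>, so no constant has to be sharp.
  Points of the projective plane are handled through unit representatives. Multiplying one by a
  phase \<open>c\<close> multiplies the gradient by \<open>cnj c ^ (d - 1)\<close>; the root on the
  gradient line changes by a compensating phase, which lets the constructions descend.\<close>

lemma hermitian_3: "hermitian v w = v $ 1 * cnj (w $ 1) + v $ 2 * cnj (w $ 2) + v $ 3 * cnj (w $ 3)"
  by (simp add: hermitian_def sum_3)

lemma hermitian_add_left: "hermitian (u + v) w = hermitian u w + hermitian v w"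
  and hermitian_add_right: "hermitian w (u + v) = hermitian w u + hermitian w v"
  and hermitian_diff_left: "hermitian (u - v) w = hermitian u w - hermitian v w"
  and hermitian_diff_right: "hermitian w (u - v) = hermitian w u - hermitian w v"
  and hermitian_minus_left: "hermitian (- v) w = - hermitian v w"
  and hermitian_scale_left: "hermitian (c *s v) w = c * hermitian v w"
  and hermitian_scale_right: "hermitian v (c *s w) = cnj c * hermitian v w"
  and hermitian_scaleR_left: "hermitian (r *\<^sub>R v) w = of_real r * hermitian v w"
  and hermitian_zero_left [simp]: "hermitian 0 w = 0"
  and hermitian_zero_right [simp]: "hermitian w 0 = 0"
  by (simp_all add: hermitian_3 algebra_simps scaleR_conv_of_real[where 'a = complex])

lemma hermitian_commute: "hermitian v w = cnj (hermitian w v)"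
  by (simp add: hermitian_3 mult.commute)

lemma hermitian_self: "hermitian z z = of_real ((norm z)\<^sup>2)"
proof -
  have "(norm z)\<^sup>2 = (norm (z $ 1))\<^sup>2 + (norm (z $ 2))\<^sup>2 + (norm (z $ 3))\<^sup>2"
    by (simp add: norm_vec_def L2_set_def sum_3)
  then show ?thesis
    by (simp add: hermitian_3 complex_norm_square[symmetric] del: of_real_power)
qed

lemma hermitian_self_eq_0_iff: "hermitian z z = 0 \<longleftrightarrow> z = 0"
  by (simp add: hermitian_self)

lemma norm_hermitian_le: "norm (hermitian v w) \<le> norm v * norm w"
proof -
  have "norm (hermitian v w) \<le> (\<Sum>i\<in>UNIV. norm (v $ i) * norm (w $ i))"
    unfolding hermitian_def by (rule order.trans[OF norm_sum]) (simp add: norm_mult)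
  also have "\<dots> \<le> L2_set (\<lambda>i. norm (v $ i)) UNIV * L2_set (\<lambda>i. norm (w $ i)) UNIV"
    using L2_set_mult_ineq[of "\<lambda>i. norm (v $ i)" "\<lambda>i. norm (w $ i)" UNIV] by simp
  finally show ?thesis by (simp add: norm_vec_def)
qed

lemma norm_vector_scale: "norm (c *s (v :: complex ^ 3)) = norm c * norm v"
proof -
  have "norm (c *s v) = L2_set (\<lambda>i. norm c * norm (v $ i)) UNIV"
    by (simp add: norm_vec_def norm_mult)
  then show ?thesis by (simp add: norm_vec_def L2_set_right_distrib)
qed

lemma norm_add_orthogonal:
  assumes "hermitian w z = 0"
  shows "(norm (z + w))\<^sup>2 = (norm z)\<^sup>2 + (norm w)\<^sup>2"
proof -
  have "complex_of_real ((norm (z + w))\<^sup>2) = hermitian (z + w) (z + w)"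
    by (simp only: hermitian_self)
  also have "\<dots> = hermitian z z + hermitian w w"
    using assms hermitian_commute[of z w] by (simp add: hermitian_add_left hermitian_add_right)
  also have "\<dots> = complex_of_real ((norm z)\<^sup>2 + (norm w)\<^sup>2)"
    by (simp add: hermitian_self)
  finally show ?thesis by (simp only: of_real_eq_iff)
qed

lemma hermitian_right_eqI:
  assumes "\<And>v. hermitian v g = hermitian v h"
  shows "g = h"
proof -
  have "hermitian (g - h) (g - h) = 0"
    using assms[of "g - h"] by (simp add: hermitian_diff_right)
  then show ?thesis by (simp add: hermitian_self_eq_0_iff)
qed

lemma bounded_linear_hermitian_left: "bounded_linear (\<lambda>v. hermitian v w)"
  by (rule bounded_linear_intro[where K = "norm w"])
     (simp_all add: hermitian_add_left hermitian_scaleR_left norm_hermitian_le scaleR_conv_of_real[where 'a = complex])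

lemma continuous_on_hermitian [continuous_intros]:
  "continuous_on S f \<Longrightarrow> continuous_on S g \<Longrightarrow> continuous_on S (\<lambda>x. hermitian (f x) (g x))"
  unfolding hermitian_def by (intro continuous_intros)

lemma tendsto_hermitian [tendsto_intros]:
  "(f \<longlongrightarrow> a) F \<Longrightarrow> (g \<longlongrightarrow> b) F \<Longrightarrow> ((\<lambda>x. hermitian (f x) (g x)) \<longlongrightarrow> hermitian a b) F"
  unfolding hermitian_def by (intro tendsto_intros)

lemma continuous_on_vector_scale [continuous_intros]:
  fixes f :: "'a :: topological_space \<Rightarrow> complex" and g :: "'a \<Rightarrow> complex ^ 3"
  assumes "continuous_on S f" "continuous_on S g"
  shows "continuous_on S (\<lambda>x. f x *s g x)"
  unfolding vector_scalar_mult_def using assms by (intro continuous_on_vec_lambda continuous_intros)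

lemma tendsto_vector_scale [tendsto_intros]:
  fixes f :: "'a \<Rightarrow> complex" and g :: "'a \<Rightarrow> complex ^ 3"
  assumes "(f \<longlongrightarrow> c) F" "(g \<longlongrightarrow> v) F"
  shows "((\<lambda>x. f x *s g x) \<longlongrightarrow> c *s v) F"
  unfolding vector_scalar_mult_def using assms by (intro tendsto_vec_lambda tendsto_intros)

section \<open>Homogeneous polynomials\<close>

definition monomials :: "nat \<Rightarrow> complex ^ 3 \<Rightarrow> nat \<times> nat \<times> nat \<Rightarrow> complex" where
  "monomials d z = (\<lambda>(i, j, k).
     complex_of_real (sqrt (fact (d + 2) / (2 * fact i * fact j * fact k))) * z $ 1 ^ i * z $ 2 ^ j * z $ 3 ^ k)"

definition monomials_deriv :: "nat \<Rightarrow> complex ^ 3 \<Rightarrow> complex ^ 3 \<Rightarrow> nat \<times> nat \<times> nat \<Rightarrow> complex" where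
  "monomials_deriv d z v = (\<lambda>(i, j, k).
     complex_of_real (sqrt (fact (d + 2) / (2 * fact i * fact j * fact k))) *
       (v $ 1 * (of_nat i * z $ 1 ^ (i - 1)) * z $ 2 ^ j * z $ 3 ^ k +
        z $ 1 ^ i * (v $ 2 * (of_nat j * z $ 2 ^ (j - 1))) * z $ 3 ^ k +
        z $ 1 ^ i * z $ 2 ^ j * (v $ 3 * (of_nat k * z $ 3 ^ (k - 1)))))"

text \<open>The Hermitian gradient, so that \<open>Df(z)[v] = hermitian v (grad z)\<close>.\<close>

definition grad :: "nat \<Rightarrow> (nat \<times> nat \<times> nat \<Rightarrow> complex) \<Rightarrow> complex ^ 3 \<Rightarrow> complex ^ 3" where
  "grad d a z = (\<chi> l. cnj (\<Sum>\<alpha>\<in>exponents d. a \<alpha> * monomials_deriv d z (axis l 1) \<alpha>))"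

text \<open>Both the number of monomials of degree \<open>d\<close> and, by the choice of the
  weights, the value of the reproducing kernel on the diagonal at unit vectors.\<close>

definition kernel_const :: "nat \<Rightarrow> real" where
  "kernel_const d = (real d + 2) * (real d + 1) / 2"

lemma hom_poly_eq: "hom_poly d a z = (\<Sum>\<alpha>\<in>exponents d. a \<alpha> * monomials d z \<alpha>)"
  unfolding hom_poly_def monomials_def by (intro sum.cong) (auto simp: mult_ac)

section \<open>The reproducing kernel of the weighted monomials\<close>

lemma trinomial:
  fixes x y z :: complex
  shows "(\<Sum>(i, j, k)\<in>exponents d. fact d / (fact i * fact j * fact k) * x ^ i * y ^ j * z ^ k) = (x + y + z) ^ d"
proof -
  have ex: "exponents d = (\<lambda>(i, j). (i, j, d - i - j)) ` (SIGMA i:{..d}. {..d - i})"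
    by (auto simp: exponents_def image_iff)
  have inj: "inj_on (\<lambda>(i, j). (i, j, d - i - j)) (SIGMA i:{..d}. {..d - i})"
    by (auto simp: inj_on_def)
  have "(\<Sum>(i, j, k)\<in>exponents d. fact d / (fact i * fact j * fact k) * x ^ i * y ^ j * z ^ k) =
     (\<Sum>(i, j)\<in>(SIGMA i:{..d}. {..d - i}). fact d / (fact i * fact j * fact (d - i - j)) * x ^ i * y ^ j * z ^ (d - i - j))"
    unfolding ex by (subst sum.reindex[OF inj]) (auto intro!: sum.cong)
  also have "\<dots> = (\<Sum>i\<le>d. \<Sum>j\<le>d - i. fact d / (fact i * fact j * fact (d - i - j)) * x ^ i * y ^ j * z ^ (d - i - j))"
    by (subst sum.Sigma) auto
  also have "\<dots> = (\<Sum>i\<le>d. of_nat (d choose i) * x ^ i * (y + z) ^ (d - i))"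
  proof (intro sum.cong refl)
    fix i assume "i \<in> {..d}"
    then have i: "of_nat (d choose i) = (fact d / (fact i * fact (d - i)) :: complex)"
      by (simp add: binomial_fact)
    have "(\<Sum>j\<le>d - i. fact d / (fact i * fact j * fact (d - i - j)) * x ^ i * y ^ j * z ^ (d - i - j)) =
      (\<Sum>j\<le>d - i. of_nat (d choose i) * x ^ i * (of_nat ((d - i) choose j) * y ^ j * z ^ (d - i - j)))"
      by (intro sum.cong refl) (simp add: i binomial_fact mult_ac)
    also have "\<dots> = of_nat (d choose i) * x ^ i * (y + z) ^ (d - i)"
      by (simp add: sum_distrib_left[symmetric] binomial_ring)
    finally show "(\<Sum>j\<le>d - i. fact d / (fact i * fact j * fact (d - i - j)) * x ^ i * y ^ j * z ^ (d - i - j))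
       = of_nat (d choose i) * x ^ i * (y + z) ^ (d - i)" .
  qed
  also have "\<dots> = (x + (y + z)) ^ d" by (simp add: binomial_ring)
  finally show ?thesis by (simp add: add.assoc)
qed

text \<open>The weights of the random polynomial are exactly those that turn this sum into a
  trinomial expansion. The right-hand side is, up to normalisation, the covariance of
  \<open>P z\<close> and \<open>P y\<close>; differentiating it gives the covariances that involve
  derivatives of \<open>P\<close>.\<close>

lemma monomials_kernel:
  "(\<Sum>\<alpha>\<in>exponents d. monomials d z \<alpha> * cnj (monomials d y \<alpha>)) = of_real (kernel_const d) * hermitian z y ^ d"
proof -
  have *: "complex_of_real (sqrt c) * complex_of_real (sqrt c) = complex_of_real c" if "c \<ge> 0" for c
    using that by (metis of_real_mult real_sqrt_mult_self abs_of_nonneg)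
  have "(\<Sum>\<alpha>\<in>exponents d. monomials d z \<alpha> * cnj (monomials d y \<alpha>)) =
    (\<Sum>(i, j, k)\<in>exponents d. of_real (kernel_const d) * (fact d / (fact i * fact j * fact k) *
       (z $ 1 * cnj (y $ 1)) ^ i * (z $ 2 * cnj (y $ 2)) ^ j * (z $ 3 * cnj (y $ 3)) ^ k))"
  proof (intro sum.cong refl, clarify)
    fix i j k
    define c :: real where "c = fact (d + 2) / (2 * fact i * fact j * fact k)"
    have c: "complex_of_real c = of_real (kernel_const d) * (fact d / (fact i * fact j * fact k))"
      by (simp add: c_def kernel_const_def fact_reduce field_simps)
    have "monomials d z (i, j, k) * cnj (monomials d y (i, j, k)) = (of_real (sqrt c) * of_real (sqrt c)) *
       ((z $ 1 * cnj (y $ 1)) ^ i * (z $ 2 * cnj (y $ 2)) ^ j * (z $ 3 * cnj (y $ 3)) ^ k)"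
      unfolding monomials_def prod.case c_def[symmetric] by (simp add: power_mult_distrib mult_ac)
    also have "complex_of_real (sqrt c) * of_real (sqrt c) = of_real c"
      by (rule *) (simp add: c_def)
    finally show "monomials d z (i, j, k) * cnj (monomials d y (i, j, k)) =
       of_real (kernel_const d) * (fact d / (fact i * fact j * fact k) *
       (z $ 1 * cnj (y $ 1)) ^ i * (z $ 2 * cnj (y $ 2)) ^ j * (z $ 3 * cnj (y $ 3)) ^ k)"
      by (simp add: c mult_ac)
  qed
  also have "\<dots> = of_real (kernel_const d) * (\<Sum>(i, j, k)\<in>exponents d. (fact d / (fact i * fact j * fact k) *
       (z $ 1 * cnj (y $ 1)) ^ i * (z $ 2 * cnj (y $ 2)) ^ j * (z $ 3 * cnj (y $ 3)) ^ k))"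
    by (simp add: sum_distrib_left case_prod_unfold)
  also have "\<dots> = of_real (kernel_const d) * hermitian z y ^ d"
    unfolding hermitian_3 trinomial[symmetric] by (simp add: mult_ac)
  finally show ?thesis .
qed

lemma monomials_has_derivative:
  "((\<lambda>z. monomials d z \<alpha>) has_derivative (\<lambda>v. monomials_deriv d z v \<alpha>)) (at z)"
proof -
  obtain i j k where \<alpha>: "\<alpha> = (i, j, k)" by (cases \<alpha>)
  have [derivative_intros]: "((\<lambda>z :: complex ^ 3. z $ l) has_derivative (\<lambda>v. v $ l)) (at z)" for l
    by (rule bounded_linear_imp_has_derivative[OF bounded_linear_vec_nth])
  show ?thesis
    unfolding \<alpha> monomials_def monomials_deriv_def prod.case
    by (rule derivative_eq_intros refl)+ (simp add: fun_eq_iff algebra_simps)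
qed

lemma monomials_deriv_expand:
  "monomials_deriv d z v \<alpha> = (\<Sum>l\<in>UNIV. v $ l * monomials_deriv d z (axis l 1) \<alpha>)"
  by (cases \<alpha>) (simp add: monomials_deriv_def sum_3 axis_def algebra_simps)

lemma hermitian_grad: "hermitian v (grad d a z) = (\<Sum>\<alpha>\<in>exponents d. a \<alpha> * monomials_deriv d z v \<alpha>)"
proof -
  have "hermitian v (grad d a z) =
      (\<Sum>l\<in>UNIV. \<Sum>\<alpha>\<in>exponents d. v $ l * (a \<alpha> * monomials_deriv d z (axis l 1) \<alpha>))"
    by (simp add: hermitian_def grad_def sum_distrib_left)
  also have "\<dots> = (\<Sum>\<alpha>\<in>exponents d. a \<alpha> * (\<Sum>l\<in>UNIV. v $ l * monomials_deriv d z (axis l 1) \<alpha>))"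
    by (subst sum.swap) (simp add: sum_distrib_left mult_ac)
  finally show ?thesis by (simp only: monomials_deriv_expand[symmetric])
qed

section \<open>Differential, homogeneity and Euler's relation\<close>

lemma hom_poly_has_derivative:
  "(hom_poly d a has_derivative (\<lambda>v. hermitian v (grad d a z))) (at z)"
  unfolding hermitian_grad hom_poly_eq[abs_def]
  by (intro has_derivative_sum has_derivative_mult_right monomials_has_derivative)

lemma hom_poly_line:
  "((\<lambda>\<sigma>. hom_poly d a (p + \<sigma> *s q)) has_field_derivative hermitian q (grad d a (p + \<sigma> *s q))) (at \<sigma>)"
proof -
  have bl: "bounded_linear (\<lambda>\<sigma>. \<sigma> *s q)"
    by (rule bounded_linear_intro[where K = "norm q"])
       (auto simp: vec_eq_iff algebra_simps norm_vector_scale scaleR_conv_of_real[where 'a = complex])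
  have "((\<lambda>\<sigma>. p + \<sigma> *s q) has_derivative (\<lambda>\<sigma>. \<sigma> *s q)) (at \<sigma>)"
    using bounded_linear_imp_has_derivative[OF bl] by (auto intro!: derivative_eq_intros)
  from has_derivative_compose[OF this hom_poly_has_derivative]
  have "((\<lambda>\<sigma>. hom_poly d a (p + \<sigma> *s q)) has_derivative
      (\<lambda>h. hermitian (h *s q) (grad d a (p + \<sigma> *s q)))) (at \<sigma>)" .
  then show ?thesis
    by (simp add: has_field_derivative_def hermitian_scale_left mult.commute[of _ "hermitian _ _"])
qed

lemma hom_poly_scale: "hom_poly d a (c *s z) = c ^ d * hom_poly d a z"
  unfolding hom_poly_def sum_distrib_left
  by (intro sum.cong) (auto simp: exponents_def power_mult_distrib power_add mult_ac)

text \<open>Differentiate \<open>f (c z) = c ^ d * f z\<close> along \<open>c v\<close>. The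
  conjugate appears because the gradient sits in the antilinear slot of the Hermitian
  product.\<close>

lemma grad_scale:
  assumes "c \<noteq> 0" "d \<ge> 1"
  shows "grad d a (c *s z) = cnj c ^ (d - 1) *s grad d a z"
proof (rule hermitian_right_eqI)
  fix v
  have "((\<lambda>\<sigma>. hom_poly d a (c *s z + \<sigma> *s (c *s v))) has_field_derivative
      hermitian (c *s v) (grad d a (c *s z + 0 *s (c *s v)))) (at 0)"
    by (rule hom_poly_line)
  moreover have "(\<lambda>\<sigma>. hom_poly d a (c *s z + \<sigma> *s (c *s v))) = (\<lambda>\<sigma>. c ^ d * hom_poly d a (z + \<sigma> *s v))"
    by (simp add: hom_poly_scale[symmetric] vec_eq_iff algebra_simps)
  ultimately have "((\<lambda>\<sigma>. c ^ d * hom_poly d a (z + \<sigma> *s v)) has_field_derivative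
      c * hermitian v (grad d a (c *s z))) (at 0)"
    by (simp add: hermitian_scale_left)
  moreover have "((\<lambda>\<sigma>. c ^ d * hom_poly d a (z + \<sigma> *s v)) has_field_derivative
      c ^ d * hermitian v (grad d a (z + 0 *s v))) (at 0)"
    by (rule DERIV_cmult[OF hom_poly_line])
  ultimately have "c * hermitian v (grad d a (c *s z)) = c ^ d * hermitian v (grad d a z)"
    using DERIV_unique by fastforce
  moreover have "c ^ d = c * c ^ (d - 1)"
    using assms by (metis power_eq_if not_one_le_zero)
  ultimately show "hermitian v (grad d a (c *s z)) = hermitian v (cnj c ^ (d - 1) *s grad d a z)"
    using assms by (simp add: hermitian_scale_right)
qed

text \<open>Both sides are the derivative of \<open>\<sigma> ^ d * f z\<close> at
  \<open>\<sigma> = 1\<close>. The relation is used to see that the radial part of the gradient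
  vanishes at zeros and is small near them.\<close>

lemma euler: "hermitian z (grad d a z) = of_nat d * hom_poly d a z"
proof -
  have "((\<lambda>\<sigma>. hom_poly d a (0 + \<sigma> *s z)) has_field_derivative hermitian z (grad d a (0 + 1 *s z))) (at 1)"
    by (rule hom_poly_line)
  then have "((\<lambda>\<sigma>. \<sigma> ^ d * hom_poly d a z) has_field_derivative hermitian z (grad d a z)) (at 1)"
    by (simp add: hom_poly_scale)
  moreover have "((\<lambda>\<sigma>. \<sigma> ^ d * hom_poly d a z) has_field_derivative of_nat d * hom_poly d a z) (at 1)"
    by (auto intro!: derivative_eq_intros)
  ultimately show ?thesis by (rule DERIV_unique)
qed

lemma hom_poly_diff: "hom_poly d (\<lambda>\<alpha>. a \<alpha> - b \<alpha>) z = hom_poly d a z - hom_poly d b z"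
  by (simp add: hom_poly_eq sum_subtractf left_diff_distrib)

lemma grad_diff: "grad d (\<lambda>\<alpha>. a \<alpha> - b \<alpha>) z = grad d a z - grad d b z"
  by (simp add: grad_def vec_eq_iff sum_subtractf left_diff_distrib)

section \<open>Supremum bounds and Cauchy estimates\<close>

definition sup_bound :: "nat \<Rightarrow> (nat \<times> nat \<times> nat \<Rightarrow> complex) \<Rightarrow> real" where
  "sup_bound d a = sqrt (kernel_const d) * cnorm (exponents d) a"

lemma kernel_const_pos: "kernel_const d > 0"
  by (simp add: kernel_const_def)

lemma sup_bound_nonneg: "sup_bound d a \<ge> 0"
  using kernel_const_pos[of d] by (simp add: sup_bound_def cnorm_def)

text \<open>Cauchy-Schwarz in the coefficients; the kernel on the diagonal evaluates the second
  factor.\<close>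

lemma norm_hom_poly_le: "norm (hom_poly d a z) \<le> sup_bound d a * norm z ^ d"
proof -
  have "complex_of_real (\<Sum>\<alpha>\<in>exponents d. (norm (monomials d z \<alpha>))\<^sup>2) =
      of_real (kernel_const d * ((norm z)\<^sup>2) ^ d)"
    using monomials_kernel[of d z z]
    by (simp add: complex_norm_square hermitian_self del: of_real_power) simp
  then have "(\<Sum>\<alpha>\<in>exponents d. (norm (monomials d z \<alpha>))\<^sup>2) = kernel_const d * ((norm z) ^ d)\<^sup>2"
    by (simp only: of_real_eq_iff) (simp add: power_mult[symmetric] mult.commute)
  then have *: "L2_set (\<lambda>\<alpha>. norm (monomials d z \<alpha>)) (exponents d) = sqrt (kernel_const d) * norm z ^ d"
    by (simp add: L2_set_def real_sqrt_mult)
  have "norm (hom_poly d a z) \<le> (\<Sum>\<alpha>\<in>exponents d. norm (a \<alpha>) * norm (monomials d z \<alpha>))"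
    unfolding hom_poly_eq by (rule order.trans[OF norm_sum]) (simp add: norm_mult)
  also have "\<dots> \<le> L2_set (\<lambda>\<alpha>. norm (a \<alpha>)) (exponents d) * L2_set (\<lambda>\<alpha>. norm (monomials d z \<alpha>)) (exponents d)"
    using L2_set_mult_ineq[of "\<lambda>\<alpha>. norm (a \<alpha>)" "\<lambda>\<alpha>. norm (monomials d z \<alpha>)" "exponents d"] by simp
  finally show ?thesis by (simp add: * sup_bound_def cnorm_def mult_ac)
qed

lemma holomorphic_hermitian_grad_line:
  "(\<lambda>\<sigma>. hermitian v (grad d a (p + \<sigma> *s q))) holomorphic_on S"
  unfolding hermitian_grad monomials_deriv_def case_prod_unfold vector_add_component vector_smult_component
  by (intro holomorphic_intros)

text \<open>Cauchy's inequality for one variable, on the disc of the line through \<open>p\<close>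
  in direction \<open>v\<close> where the displacement has norm at most \<open>r\<close>. Since
  \<open>K\<close> is required on this line only, a bound that holds merely in tangent directions
  can be fed in.\<close>

lemma hermitian_grad_le:
  assumes "r > 0" and K: "\<And>\<alpha> :: complex. norm (\<alpha> *s v) \<le> r \<Longrightarrow> norm (hom_poly d a (p + \<alpha> *s v)) \<le> K"
  shows "norm (hermitian v (grad d a p)) \<le> K / r * norm v"
proof (cases "v = 0")
  case False
  define h where "h = (\<lambda>\<alpha>. hom_poly d a (p + \<alpha> *s v))"
  have dh: "(h has_field_derivative hermitian v (grad d a (p + \<alpha> *s v))) (at \<alpha>)" for \<alpha>
    unfolding h_def by (rule hom_poly_line)
  then have hol: "h holomorphic_on S" for S
    by (meson field_differentiable_at_within field_differentiable_def holomorphic_on_def)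
  have "norm ((deriv ^^ 1) h 0) \<le> fact 1 * K / (r / norm v) ^ 1"
  proof (rule Cauchy_inequality)
    show "norm (h x) \<le> K" if "norm (0 - x) = r / norm v" for x
      unfolding h_def using that False by (intro K) (simp add: norm_vector_scale)
  qed (use hol False assms(1) in \<open>auto intro: holomorphic_on_imp_continuous_on\<close>)
  moreover have "deriv h 0 = hermitian v (grad d a p)"
    using DERIV_imp_deriv[OF dh[of 0]] by simp
  ultimately show ?thesis by (simp add: mult.commute)
qed auto

text \<open>A mean value estimate along the segment from \<open>p\<close> to \<open>p + q\<close>.
  The mixed second derivative is bounded by two Cauchy estimates, one in \<open>\<alpha>\<close> for
  the direction \<open>v\<close> and one in \<open>\<beta>\<close> for the direction
  \<open>q\<close>, which is why \<open>K\<close> has to hold on bidiscs around the segment.\<close>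

lemma hermitian_grad_difference:
  assumes "r > 0"
    and K: "\<And>(\<tau> :: real) (\<alpha> :: complex) (\<beta> :: complex). 0 \<le> \<tau> \<Longrightarrow> \<tau> \<le> 1 \<Longrightarrow> norm (\<alpha> *s v) \<le> r \<Longrightarrow> norm (\<beta> *s q) \<le> r \<Longrightarrow>
      norm (hom_poly d a (p + (of_real \<tau> + \<beta>) *s q + \<alpha> *s v)) \<le> K"
  shows "norm (hermitian v (grad d a (p + q)) - hermitian v (grad d a p)) \<le> K / r\<^sup>2 * norm v * norm q"
proof (cases "q = 0")
  case False
  define g where "g = (\<lambda>\<beta>. hermitian v (grad d a (p + \<beta> *s q)))"
  have hol: "g holomorphic_on S" for S
    unfolding g_def by (rule holomorphic_hermitian_grad_line)
  have dg: "(g has_field_derivative deriv g x) (at x)" for x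
    using holomorphic_derivI[OF hol[of UNIV]] by auto
  have bd: "norm (deriv g (of_real \<tau>)) \<le> K / r\<^sup>2 * norm v * norm q" if "0 \<le> \<tau>" "\<tau> \<le> 1" for \<tau>
  proof -
    have "norm ((deriv ^^ 1) g (of_real \<tau>)) \<le> fact 1 * (K / r * norm v) / (r / norm q) ^ 1"
    proof (rule Cauchy_inequality)
      fix x :: complex assume x: "norm (of_real \<tau> - x) = r / norm q"
      define \<beta> where "\<beta> = x - of_real \<tau>"
      have "norm \<beta> = r / norm q" "x = of_real \<tau> + \<beta>"
        using x by (simp_all add: \<beta>_def norm_minus_commute)
      then have \<beta>: "x = of_real \<tau> + \<beta>" "norm (\<beta> *s q) \<le> r"
        using False by (simp_all add: norm_vector_scale)
      show "norm (g x) \<le> K / r * norm v"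
        unfolding g_def \<beta>(1) by (rule hermitian_grad_le[OF assms(1)]) (intro K that \<beta>)
    qed (use hol False assms(1) in \<open>auto intro: holomorphic_on_imp_continuous_on\<close>)
    then show ?thesis by (simp add: field_simps power2_eq_square)
  qed
  have "norm (g 1 - g 0) \<le> K / r\<^sup>2 * norm v * norm q * norm (1 - 0 :: complex)"
  proof (rule field_differentiable_bound[where S = "closed_segment 0 1"])
    show "norm (deriv g z) \<le> K / r\<^sup>2 * norm v * norm q" if "z \<in> closed_segment 0 1" for z
      using that bd by (auto simp: in_segment scaleR_conv_of_real)
  qed (auto intro: has_field_derivative_at_within dg)
  then show ?thesis by (simp add: g_def)
qed auto

text \<open>This is \<open>2 * sup_bound d a / (chart_radius d)\<^sup>2\<close>: two Cauchy
  estimates of radius \<open>chart_radius d\<close> applied to a function bounded by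
  \<open>2 * sup_bound d a\<close>.\<close>

definition curvature_bound :: "nat \<Rightarrow> (nat \<times> nat \<times> nat \<Rightarrow> complex) \<Rightarrow> real" where
  "curvature_bound d a = 32 * real d * sup_bound d a"

text \<open>A point at this distance followed by two Cauchy displacements of the same size stays
  within \<open>4 * chart_radius d = 1 / sqrt d\<close>, where the polynomial is still under control
  in tangent directions.\<close>

definition chart_radius :: "nat \<Rightarrow> real" where
  "chart_radius d = 1 / (4 * sqrt (real d))"

text \<open>In a tangent direction the norm of a unit vector grows only quadratically, hence \<open>f\<close> stays bounded
  at the scale \<open>1 / sqrt d\<close>.\<close>

lemma tangential_bound:
  assumes "norm z = 1" "hermitian w z = 0" "norm w \<le> 4 * chart_radius d" "d \<ge> 1"
  shows "norm (hom_poly d a (z + w)) \<le> 2 * sup_bound d a" "norm (z + w) ^ d \<le> 2"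
proof -
  have "(norm w)\<^sup>2 \<le> (4 * chart_radius d)\<^sup>2"
    using assms(3) by (intro power_mono) auto
  then have w: "(norm w)\<^sup>2 \<le> 1 / d"
    using assms(4) by (simp add: chart_radius_def power_divide)
  have "(norm (z + w) ^ d)\<^sup>2 = (1 + (norm w)\<^sup>2) ^ d"
    using norm_add_orthogonal[OF assms(2)] assms(1)
    by (simp add: power_mult[symmetric] mult.commute[of d]) (simp add: power_mult)
  also have "\<dots> \<le> (1 + 1 / d) ^ d"
    using w by (intro power_mono) auto
  also have "\<dots> \<le> exp 1"
    by (rule exp_ge_one_plus_x_over_n_power_n) (use assms(4) in auto)
  also have "\<dots> \<le> 2\<^sup>2"
    using exp_le by simp
  finally show "norm (z + w) ^ d \<le> 2"
    by (rule power2_le_imp_le) simp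
  then show "norm (hom_poly d a (z + w)) \<le> 2 * sup_bound d a"
    using norm_hom_poly_le[of d a "z + w"] sup_bound_nonneg[of d a]
      mult_left_mono[of "norm (z + w) ^ d" 2 "sup_bound d a"] by linarith
qed

lemma chart_radius_pos: "d \<ge> 1 \<Longrightarrow> chart_radius d > 0"
  by (simp add: chart_radius_def)

lemma curvature_bound_nonneg: "curvature_bound d a \<ge> 0"
  using sup_bound_nonneg by (simp add: curvature_bound_def)

text \<open>The segment between the two points and both Cauchy discs stay in the affine plane of
  vectors \<open>z + x\<close> with \<open>x\<close> orthogonal to \<open>z\<close>, so
  \<open>tangential_bound\<close> supplies the constant \<open>K\<close>. No power of
  \<open>d\<close> is lost to radial growth.\<close>

lemma grad_tangential_lipschitz:
  assumes "d \<ge> 1" "norm z = 1" "hermitian w z = 0" "hermitian w' z = 0" "hermitian v z = 0"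
    and "norm w \<le> chart_radius d" "norm w' \<le> chart_radius d"
  shows "norm (hermitian v (grad d a (z + w)) - hermitian v (grad d a (z + w')))
    \<le> curvature_bound d a * norm v * norm (w - w')"
proof -
  note r = chart_radius_pos[OF assms(1)]
  have "norm (hermitian v (grad d a ((z + w') + (w - w'))) - hermitian v (grad d a (z + w')))
    \<le> (2 * sup_bound d a) / (chart_radius d)\<^sup>2 * norm v * norm (w - w')"
  proof (rule hermitian_grad_difference[OF r])
    fix \<tau> :: real and \<alpha> \<beta>
    assume *: "0 \<le> \<tau>" "\<tau> \<le> 1" "norm (\<alpha> *s v) \<le> chart_radius d" "norm (\<beta> *s (w - w')) \<le> chart_radius d"
    define y where "y = (1 - \<tau>) *\<^sub>R w' + \<tau> *\<^sub>R w"
    have "norm y \<le> norm ((1 - \<tau>) *\<^sub>R w') + norm (\<tau> *\<^sub>R w)"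
      unfolding y_def by (rule norm_triangle_ineq)
    also have "\<dots> \<le> (1 - \<tau>) * chart_radius d + \<tau> * chart_radius d"
      using * assms by (auto intro!: add_mono mult_left_mono)
    finally have y: "norm y \<le> chart_radius d" by (simp add: algebra_simps)
    define x where "x = y + \<beta> *s (w - w') + \<alpha> *s v"
    have "norm x \<le> norm y + norm (\<beta> *s (w - w')) + norm (\<alpha> *s v)"
      unfolding x_def by (intro order.trans[OF norm_triangle_ineq] add_mono norm_triangle_ineq order.refl)
    then have "norm x \<le> 4 * chart_radius d" using y * r by linarith
    moreover have "hermitian x z = 0"
      using assms by (simp add: x_def y_def hermitian_add_left hermitian_diff_left hermitian_scale_left hermitian_scaleR_left)
    moreover have "z + w' + (of_real \<tau> + \<beta>) *s (w - w') + \<alpha> *s v = z + x"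
      by (simp add: x_def y_def vec_eq_iff algebra_simps scaleR_conv_of_real[where 'a = complex])
    ultimately show "norm (hom_poly d a (z + w' + (of_real \<tau> + \<beta>) *s (w - w') + \<alpha> *s v)) \<le> 2 * sup_bound d a"
      using tangential_bound(1)[of z x d a] assms by (simp only:)
  qed
  then show ?thesis
    using assms(1) by (simp add: curvature_bound_def chart_radius_def power_divide power_mult_distrib mult_ac)
qed

text \<open>The gradient is frozen at a third point \<open>w0\<close>. With \<open>w0 = 0\<close>
  and free end points this is the Lipschitz condition of the Newton iteration; with
  \<open>w0\<close> at an end point it is the first-order expansion there.\<close>

lemma taylor_tangential:
  assumes "d \<ge> 1" "norm z = 1" "hermitian w z = 0" "hermitian w' z = 0" "hermitian w0 z = 0"
    and "norm w \<le> chart_radius d" "norm w' \<le> chart_radius d" "norm w0 \<le> chart_radius d"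
    and D: "norm (w - w0) \<le> D" "norm (w' - w0) \<le> D"
  shows "norm (hom_poly d a (z + w) - hom_poly d a (z + w') - hermitian (w - w') (grad d a (z + w0)))
    \<le> curvature_bound d a * D * norm (w - w')"
proof -
  define b where "b = hermitian (w - w') (grad d a (z + w0))"
  define h where "h = (\<lambda>\<tau>. hom_poly d a ((z + w') + \<tau> *s (w - w')) - \<tau> * b)"
  have "norm (h 1 - h 0) \<le> curvature_bound d a * D * norm (w - w') * norm (1 - 0 :: complex)"
  proof (rule field_differentiable_bound[where S = "closed_segment 0 1"
      and f' = "\<lambda>\<tau>. hermitian (w - w') (grad d a ((z + w') + \<tau> *s (w - w'))) - b"])
    show "(h has_field_derivative hermitian (w - w') (grad d a ((z + w') + \<tau> *s (w - w'))) - b)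
        (at \<tau> within closed_segment 0 1)" for \<tau>
      unfolding h_def
      by (rule has_field_derivative_at_within) (auto intro!: derivative_eq_intros hom_poly_line simp del: vector_sub_rdistrib vector_ssub_ldistrib vector_sadd_rdistrib)
    fix s :: complex assume "s \<in> closed_segment 0 1"
    then obtain \<tau> where \<tau>: "0 \<le> \<tau>" "\<tau> \<le> 1" "s = of_real \<tau>"
      by (auto simp: in_segment scaleR_conv_of_real)
    define y where "y = (1 - \<tau>) *\<^sub>R w' + \<tau> *\<^sub>R w"
    have "norm y \<le> norm ((1 - \<tau>) *\<^sub>R w') + norm (\<tau> *\<^sub>R w)"
      unfolding y_def by (rule norm_triangle_ineq)
    also have "\<dots> \<le> (1 - \<tau>) * chart_radius d + \<tau> * chart_radius d"
      using \<tau> assms by (auto intro!: add_mono mult_left_mono)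
    finally have y: "norm y \<le> chart_radius d" by (simp add: algebra_simps)
    have "y - w0 = (1 - \<tau>) *\<^sub>R (w' - w0) + \<tau> *\<^sub>R (w - w0)"
      by (simp add: y_def algebra_simps)
    then have "norm (y - w0) \<le> norm ((1 - \<tau>) *\<^sub>R (w' - w0)) + norm (\<tau> *\<^sub>R (w - w0))"
      by (metis norm_triangle_ineq)
    also have "\<dots> \<le> (1 - \<tau>) * D + \<tau> * D"
      using \<tau> D by (auto intro!: add_mono mult_left_mono)
    finally have y0: "norm (y - w0) \<le> D" by (simp add: algebra_simps)
    have eq: "z + w' + s *s (w - w') = z + y"
      by (simp add: y_def \<tau>(3) vec_eq_iff algebra_simps scaleR_conv_of_real[where 'a = complex])
    have "hermitian y z = 0"
      using assms by (simp add: y_def hermitian_add_left hermitian_scaleR_left)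
    then have "norm (hermitian (w - w') (grad d a (z + y)) - b)
        \<le> curvature_bound d a * norm (w - w') * norm (y - w0)"
      unfolding b_def using assms y by (intro grad_tangential_lipschitz) (auto simp: hermitian_diff_left)
    also have "\<dots> \<le> curvature_bound d a * norm (w - w') * D"
      using y0 curvature_bound_nonneg by (intro mult_left_mono) auto
    finally show "norm (hermitian (w - w') (grad d a (z + w' + s *s (w - w'))) - b)
        \<le> curvature_bound d a * D * norm (w - w')"
      unfolding eq by (simp add: mult_ac)
  qed auto
  then show ?thesis by (simp add: h_def b_def algebra_simps)
qed

text \<open>Testing against the gradient itself turns the directional Cauchy estimate into a bound
  of the full norm. The factor \<open>4 ^ d\<close> bounds the growth up to norm 4; it is harmless
  because this estimate and the next one serve only the perturbation argument, where
  \<open>d\<close> is fixed.\<close>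

lemma norm_grad_le:
  assumes "norm y \<le> 2"
  shows "norm (grad d a y) \<le> sup_bound d a * 4 ^ d"
proof -
  define g where "g = grad d a y"
  have "norm (hermitian g (grad d a y)) \<le> (sup_bound d a * 4 ^ d) / 1 * norm g"
  proof (rule hermitian_grad_le)
    fix \<alpha> assume "norm (\<alpha> *s g) \<le> 1"
    then have "norm (y + \<alpha> *s g) \<le> 4"
      using norm_triangle_ineq[of y "\<alpha> *s g"] assms by linarith
    then show "norm (hom_poly d a (y + \<alpha> *s g)) \<le> sup_bound d a * 4 ^ d"
      by (intro order.trans[OF norm_hom_poly_le] mult_left_mono power_mono sup_bound_nonneg) auto
  qed simp
  then show ?thesis
    unfolding g_def[symmetric] hermitian_self
    by (cases "g = 0") (auto simp: power2_eq_square norm_mult sup_bound_nonneg)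
qed

lemma grad_lipschitz:
  assumes "norm y \<le> 2" "norm y' \<le> 2"
  shows "norm (grad d a y - grad d a y') \<le> sup_bound d a * 4 ^ d * norm (y - y')"
proof -
  define g where "g = grad d a y - grad d a y'"
  have "norm (hermitian g (grad d a (y' + (y - y'))) - hermitian g (grad d a y'))
     \<le> (sup_bound d a * 4 ^ d) / 1\<^sup>2 * norm g * norm (y - y')"
  proof (rule hermitian_grad_difference)
    fix \<tau> :: real and \<alpha> \<beta>
    assume *: "0 \<le> \<tau>" "\<tau> \<le> 1" "norm (\<alpha> *s g) \<le> 1" "norm (\<beta> *s (y - y')) \<le> 1"
    define x where "x = (1 - \<tau>) *\<^sub>R y' + \<tau> *\<^sub>R y"
    have "norm x \<le> norm ((1 - \<tau>) *\<^sub>R y') + norm (\<tau> *\<^sub>R y)"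
      unfolding x_def by (rule norm_triangle_ineq)
    also have "\<dots> \<le> (1 - \<tau>) * 2 + \<tau> * 2"
      using *(1,2) assms mult_left_mono[of "norm y'" 2 "1 - \<tau>"] mult_left_mono[of "norm y" 2 \<tau>] by simp
    finally have x: "norm x \<le> 2" by (simp add: algebra_simps)
    have "norm (x + \<beta> *s (y - y') + \<alpha> *s g) \<le> norm x + norm (\<beta> *s (y - y')) + norm (\<alpha> *s g)"
      by (intro order.trans[OF norm_triangle_ineq] add_mono norm_triangle_ineq order.refl)
    then have 4: "norm (x + \<beta> *s (y - y') + \<alpha> *s g) \<le> 4" using x * by linarith
    have eq: "y' + (of_real \<tau> + \<beta>) *s (y - y') + \<alpha> *s g = x + \<beta> *s (y - y') + \<alpha> *s g"
      by (simp add: x_def vec_eq_iff algebra_simps scaleR_conv_of_real[where 'a = complex])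
    show "norm (hom_poly d a (y' + (of_real \<tau> + \<beta>) *s (y - y') + \<alpha> *s g)) \<le> sup_bound d a * 4 ^ d"
      unfolding eq using 4
      by (intro order.trans[OF norm_hom_poly_le] mult_left_mono power_mono sup_bound_nonneg) auto
  qed simp
  then have "norm (hermitian g g) \<le> sup_bound d a * 4 ^ d * norm (y - y') * norm g"
    by (simp add: g_def hermitian_diff_right mult_ac)
  then show ?thesis
    unfolding g_def[symmetric] hermitian_self
    by (cases "g = 0") (auto simp: power2_eq_square norm_mult sup_bound_nonneg)
qed

section \<open>Smooth functions of a real variable\<close>

text \<open>Smoothness asks for a whole sequence of derivatives. Choosing for each member of
  \<open>A\<close> a derivative that is again in \<open>A\<close> and iterating the choice produces
  it.\<close>

lemma C_infinity_on_coinduct: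
  fixes f :: "real \<Rightarrow> 'a :: real_normed_vector"
  assumes "f \<in> A" and A: "\<And>g. g \<in> A \<Longrightarrow> \<exists>g'\<in>A. \<forall>t\<in>S. (g has_vector_derivative g' t) (at t)"
  shows "C_infinity_on f S"
proof -
  from A obtain D where D: "\<And>g. g \<in> A \<Longrightarrow> D g \<in> A \<and> (\<forall>t\<in>S. (g has_vector_derivative D g t) (at t))"
    by metis
  have "(D ^^ n) f \<in> A" for n
    by (induction n) (use D assms(1) in auto)
  then show ?thesis
    unfolding C_infinity_on_def by (intro exI[of _ "\<lambda>n. (D ^^ n) f"]) (use D in auto)
qed

lemma C_infinity_on_derivative:
  assumes "C_infinity_on f S"
  obtains f' where "C_infinity_on f' S" "\<And>t. t \<in> S \<Longrightarrow> (f has_vector_derivative f' t) (at t)"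
proof -
  obtain F where F: "F 0 = f" "\<And>n t. t \<in> S \<Longrightarrow> (F n has_vector_derivative F (Suc n) t) (at t)"
    using assms unfolding C_infinity_on_def by blast
  have "C_infinity_on (F 1) S"
    unfolding C_infinity_on_def by (rule exI[of _ "\<lambda>n. F (Suc n)"]) (use F in auto)
  then show ?thesis using that[of "F 1"] F(2)[of _ 0] F(1) by auto
qed

lemma C_infinity_on_continuous: "C_infinity_on f S \<Longrightarrow> continuous_on S f"
  by (meson C_infinity_on_derivative continuous_at_imp_continuous_on has_vector_derivative_continuous)

lemma C_infinity_on_subset: "C_infinity_on f S \<Longrightarrow> T \<subseteq> S \<Longrightarrow> C_infinity_on f T"
  unfolding C_infinity_on_def by blast

lemma C_infinity_on_cong:
  assumes "C_infinity_on f S" "open S" "\<And>t. t \<in> S \<Longrightarrow> g t = f t"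
  shows "C_infinity_on g S"
proof -
  obtain F where F: "F 0 = f" "\<And>n t. t \<in> S \<Longrightarrow> (F n has_vector_derivative F (Suc n) t) (at t)"
    using assms(1) unfolding C_infinity_on_def by blast
  show ?thesis
    unfolding C_infinity_on_def
  proof (intro exI[of _ "F(0 := g)"] conjI allI ballI)
    fix n t assume t: "t \<in> S"
    have "(g has_vector_derivative F 1 t) (at t)"
      by (rule has_vector_derivative_transform_within_open[OF _ assms(2) t, of f])
         (use F(2)[OF t, of 0] F(1) assms(3) in auto)
    then show "((F(0 := g)) n has_vector_derivative (F(0 := g)) (Suc n) t) (at t)"
      using F(2)[OF t] by (cases n) auto
  qed simp
qed

text \<open>The derivative sequences on the neighbourhoods need not fit together, so the invariant
  family consists of the locally smooth functions, and \<open>vector_derivative\<close> picks one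
  derivative on all of \<open>S\<close>.\<close>

lemma C_infinity_on_local:
  assumes "\<And>t. t \<in> S \<Longrightarrow> \<exists>T. open T \<and> t \<in> T \<and> C_infinity_on f T"
  shows "C_infinity_on f S"
proof (rule C_infinity_on_coinduct)
  let ?A = "{g. \<forall>t\<in>S. \<exists>T. open T \<and> t \<in> T \<and> C_infinity_on g T}"
  show "f \<in> ?A" using assms by blast
  fix g assume g: "g \<in> ?A"
  define g' where "g' = (\<lambda>t. vector_derivative g (at t))"
  have "\<exists>T. open T \<and> t \<in> T \<and> C_infinity_on g' T \<and> (g has_vector_derivative g' t) (at t)" if t: "t \<in> S" for t
  proof -
    obtain T where T: "open T" "t \<in> T" "C_infinity_on g T" using g t by blast
    obtain h where h: "C_infinity_on h T" "\<And>s. s \<in> T \<Longrightarrow> (g has_vector_derivative h s) (at s)"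
      using C_infinity_on_derivative[OF T(3)] by blast
    have eq: "g' s = h s" if "s \<in> T" for s
      unfolding g'_def by (rule vector_derivative_at[OF h(2)[OF that]])
    have "C_infinity_on g' T" by (rule C_infinity_on_cong[OF h(1) T(1) eq])
    moreover have "(g has_vector_derivative g' t) (at t)" using h(2) T(2) eq by simp
    ultimately show ?thesis using T by blast
  qed
  then show "\<exists>g'\<in>?A. \<forall>t\<in>S. (g has_vector_derivative g' t) (at t)" by blast
qed

lemma C_infinity_on_bounded_linear:
  assumes "bounded_linear L" "C_infinity_on f S"
  shows "C_infinity_on (\<lambda>t. L (f t)) S"
proof -
  obtain F where F: "F 0 = f" "\<And>n t. t \<in> S \<Longrightarrow> (F n has_vector_derivative F (Suc n) t) (at t)"
    using assms(2) unfolding C_infinity_on_def by blast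
  show ?thesis
    unfolding C_infinity_on_def
    by (rule exI[of _ "\<lambda>n t. L (F n t)"]) (use F bounded_linear.has_vector_derivative[OF assms(1)] in auto)
qed

lemma C_infinity_on_sum:
  assumes "\<And>i. i \<in> I \<Longrightarrow> C_infinity_on (f i) S"
  shows "C_infinity_on (\<lambda>t. \<Sum>i\<in>I. f i t) S"
proof -
  have "\<forall>i\<in>I. \<exists>F. F 0 = f i \<and> (\<forall>n. \<forall>t\<in>S. (F n has_vector_derivative F (Suc n) t) (at t))"
    using assms unfolding C_infinity_on_def by blast
  then obtain F where F: "\<And>i. i \<in> I \<Longrightarrow> F i 0 = f i"
    "\<And>i n t. i \<in> I \<Longrightarrow> t \<in> S \<Longrightarrow> (F i n has_vector_derivative F i (Suc n) t) (at t)"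
    by (auto dest!: bchoice)
  show ?thesis
    unfolding C_infinity_on_def
    by (rule exI[of _ "\<lambda>n t. \<Sum>i\<in>I. F i n t"]) (use F in \<open>auto intro!: has_vector_derivative_sum\<close>)
qed

text \<open>Closed under differentiation as soon as the derivatives of the generators belong to it; then all
  its elements are smooth.\<close>

inductive_set algebra_hull :: "(real \<Rightarrow> complex) set \<Rightarrow> (real \<Rightarrow> complex) set" for B where
  generator: "b \<in> B \<Longrightarrow> b \<in> algebra_hull B"
| const: "(\<lambda>_. c) \<in> algebra_hull B"
| add: "f \<in> algebra_hull B \<Longrightarrow> g \<in> algebra_hull B \<Longrightarrow> (\<lambda>t. f t + g t) \<in> algebra_hull B"
| mult: "f \<in> algebra_hull B \<Longrightarrow> g \<in> algebra_hull B \<Longrightarrow> (\<lambda>t. f t * g t) \<in> algebra_hull B"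

lemma algebra_hull_sum:
  assumes "\<And>i. i \<in> I \<Longrightarrow> f i \<in> algebra_hull B"
  shows "(\<lambda>t. \<Sum>i\<in>I. f i t) \<in> algebra_hull B"
proof (cases "finite I")
  case True
  then show ?thesis using assms
    by (induction I) (auto intro: algebra_hull.const algebra_hull.add)
qed (simp add: algebra_hull.const)

lemma algebra_hull_power: "f \<in> algebra_hull B \<Longrightarrow> (\<lambda>t. f t ^ n) \<in> algebra_hull B"
  by (induction n) (auto intro: algebra_hull.const algebra_hull.mult)

lemma algebra_hull_uminus: "f \<in> algebra_hull B \<Longrightarrow> (\<lambda>t. - f t) \<in> algebra_hull B"
  using algebra_hull.mult[OF algebra_hull.const[of "-1"], of f B] by simp

lemma algebra_hull_mono: "f \<in> algebra_hull B \<Longrightarrow> B \<subseteq> C \<Longrightarrow> f \<in> algebra_hull C"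
  by (induction rule: algebra_hull.induct) (auto intro: algebra_hull.intros)

text \<open>Two generating sets are allowed because differentiation may leave the first algebra: the
  derivative of an implicit function involves a reciprocal that only the larger algebra
  contains.\<close>

lemma algebra_hull_derivative:
  assumes "f \<in> algebra_hull B" "B \<subseteq> algebra_hull C"
    and "\<And>b. b \<in> B \<Longrightarrow> \<exists>g\<in>algebra_hull C. \<forall>t\<in>S. (b has_vector_derivative g t) (at t)"
  shows "f \<in> algebra_hull C \<and> (\<exists>g\<in>algebra_hull C. \<forall>t\<in>S. (f has_vector_derivative g t) (at t))"
  using assms(1)
proof (induction rule: algebra_hull.induct)
  case (generator b) then show ?case using assms by blast
next
  case (const c)
  show ?case by (intro conjI bexI[of _ "\<lambda>_. 0"]) (auto intro: algebra_hull.const)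
next
  case (add f g)
  then obtain f' g' where "f' \<in> algebra_hull C" "g' \<in> algebra_hull C"
    "\<forall>t\<in>S. (f has_vector_derivative f' t) (at t)" "\<forall>t\<in>S. (g has_vector_derivative g' t) (at t)"
    by blast
  then show ?case using add
    by (intro conjI bexI[of _ "\<lambda>t. f' t + g' t"]) (auto intro: algebra_hull.add has_vector_derivative_add)
next
  case (mult f g)
  then obtain f' g' where "f' \<in> algebra_hull C" "g' \<in> algebra_hull C"
    "\<forall>t\<in>S. (f has_vector_derivative f' t) (at t)" "\<forall>t\<in>S. (g has_vector_derivative g' t) (at t)"
    by blast
  then show ?case using mult
    by (intro conjI bexI[of _ "\<lambda>t. f t * g' t + f' t * g t"])
       (auto intro: algebra_hull.add algebra_hull.mult has_vector_derivative_mult)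
qed

lemma C_infinity_on_algebra:
  assumes "f \<in> algebra_hull B"
    and "\<And>b. b \<in> B \<Longrightarrow> \<exists>g\<in>algebra_hull B. \<forall>t\<in>S. (b has_vector_derivative g t) (at t)"
  shows "C_infinity_on f S"
  using assms(1)
proof (rule C_infinity_on_coinduct)
  fix g assume "g \<in> algebra_hull B"
  then show "\<exists>g'\<in>algebra_hull B. \<forall>t\<in>S. (g has_vector_derivative g' t) (at t)"
    using algebra_hull_derivative[of g B B S] assms(2) by (blast intro: algebra_hull.generator)
qed

lemma C_infinity_on_algebra_hull:
  assumes "f \<in> algebra_hull {g. C_infinity_on g S}"
  shows "C_infinity_on f S"
  using assms
proof (rule C_infinity_on_algebra)
  fix b assume "b \<in> {g :: real \<Rightarrow> complex. C_infinity_on g S}"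
  then obtain b' where "C_infinity_on b' S" "\<And>t. t \<in> S \<Longrightarrow> (b has_vector_derivative b' t) (at t)"
    using C_infinity_on_derivative by blast
  then show "\<exists>g\<in>algebra_hull {g. C_infinity_on g S}. \<forall>t\<in>S. (b has_vector_derivative g t) (at t)"
    by (intro bexI[of _ b'] ballI algebra_hull.generator) auto
qed

section \<open>Closure properties of smooth functions\<close>

lemma has_vector_derivative_inverse:
  fixes f :: "real \<Rightarrow> complex"
  assumes "(f has_vector_derivative f') (at t)" "f t \<noteq> 0"
  shows "((\<lambda>t. 1 / f t) has_vector_derivative - f' * (1 / f t) * (1 / f t)) (at t)"
  using assms unfolding has_vector_derivative_def
  by (auto intro!: derivative_eq_intros simp: fun_eq_iff field_simps)

text \<open>Adjoining \<open>1 / f\<close> to the smooth functions gives an algebra closed under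
  differentiation, since the derivative of \<open>1 / f\<close> is \<open>- f'\<close> times the
  square of \<open>1 / f\<close>.\<close>

lemma C_infinity_on_inverse:
  fixes f :: "real \<Rightarrow> complex"
  assumes "C_infinity_on f S" "\<And>t. t \<in> S \<Longrightarrow> f t \<noteq> 0"
  shows "C_infinity_on (\<lambda>t. 1 / f t) S"
proof (rule C_infinity_on_algebra)
  let ?B = "insert (\<lambda>t. 1 / f t) {g. C_infinity_on g S}"
  show "(\<lambda>t. 1 / f t) \<in> algebra_hull ?B" by (rule algebra_hull.generator) simp
  fix b assume "b \<in> ?B"
  then consider "b = (\<lambda>t. 1 / f t)" | "C_infinity_on b S" by blast
  then show "\<exists>g\<in>algebra_hull ?B. \<forall>t\<in>S. (b has_vector_derivative g t) (at t)"
  proof cases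
    case 1
    obtain f' where "C_infinity_on f' S" "\<And>t. t \<in> S \<Longrightarrow> (f has_vector_derivative f' t) (at t)"
      using C_infinity_on_derivative[OF assms(1)] by blast
    note f' = this
    show ?thesis unfolding 1
    proof (intro bexI[of _ "\<lambda>t. - f' t * (1 / f t) * (1 / f t)"] ballI)
      fix t assume "t \<in> S"
      then show "((\<lambda>t. 1 / f t) has_vector_derivative - f' t * (1 / f t) * (1 / f t)) (at t)"
        by (intro has_vector_derivative_inverse f' assms)
    qed (intro algebra_hull.mult algebra_hull_uminus algebra_hull.generator; use f' in simp)
  next
    case 2
    then obtain b' where "C_infinity_on b' S" "\<And>t. t \<in> S \<Longrightarrow> (b has_vector_derivative b' t) (at t)"
      using C_infinity_on_derivative by blast
    then show ?thesis by (intro bexI[of _ b'] ballI algebra_hull.generator) auto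
  qed
qed

lemma C_infinity_on_mult:
  fixes f g :: "real \<Rightarrow> complex"
  shows "C_infinity_on f S \<Longrightarrow> C_infinity_on g S \<Longrightarrow> C_infinity_on (\<lambda>t. f t * g t) S"
  by (rule C_infinity_on_algebra_hull) (auto intro: algebra_hull.intros)

lemma C_infinity_on_add:
  fixes f g :: "real \<Rightarrow> complex"
  shows "C_infinity_on f S \<Longrightarrow> C_infinity_on g S \<Longrightarrow> C_infinity_on (\<lambda>t. f t + g t) S"
  by (rule C_infinity_on_algebra_hull) (auto intro: algebra_hull.intros)

lemma bounded_linear_axis: "bounded_linear (\<lambda>x :: complex. axis i x :: complex ^ 'n)"
  by (intro linear_conv_bounded_linear[THEN iffD1] linearI) (auto simp: axis_def vec_eq_iff)

lemma sum_axis: "(\<Sum>i\<in>UNIV. axis i (v $ i)) = (v :: complex ^ 'n)"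
  by (simp add: vec_eq_iff axis_def if_distrib cong: if_cong)

lemma C_infinity_on_vecI:
  fixes f :: "real \<Rightarrow> complex ^ 'n"
  assumes "\<And>i. C_infinity_on (\<lambda>t. f t $ i) S"
  shows "C_infinity_on f S"
proof -
  have "C_infinity_on (\<lambda>t. \<Sum>i\<in>UNIV. axis i (f t $ i)) S"
    by (intro C_infinity_on_sum C_infinity_on_bounded_linear[OF bounded_linear_axis] assms)
  then show ?thesis by (simp add: sum_axis)
qed

lemma C_infinity_on_nth:
  fixes f :: "real \<Rightarrow> complex ^ 'n"
  shows "C_infinity_on f S \<Longrightarrow> C_infinity_on (\<lambda>t. f t $ i) S"
  by (rule C_infinity_on_bounded_linear[OF bounded_linear_vec_nth])

lemma C_infinity_on_scale:
  fixes f :: "real \<Rightarrow> complex ^ 'n"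
  assumes "C_infinity_on c S" "C_infinity_on f S"
  shows "C_infinity_on (\<lambda>t. c t *s f t) S"
  by (rule C_infinity_on_vecI) (simp add: C_infinity_on_mult C_infinity_on_nth assms)

lemma has_vector_derivative_scale:
  fixes f :: "real \<Rightarrow> complex ^ 'n"
  assumes "(c has_vector_derivative c') (at t)" "(f has_vector_derivative f') (at t)"
  shows "((\<lambda>t. c t *s f t) has_vector_derivative (c' *s f t + c t *s f')) (at t)"
proof -
  have "((\<lambda>t. \<Sum>i\<in>UNIV. axis i (c t * f t $ i)) has_vector_derivative
      (\<Sum>i\<in>UNIV. axis i (c t * f' $ i + c' * f t $ i))) (at t)"
    by (intro has_vector_derivative_sum bounded_linear.has_vector_derivative[OF bounded_linear_axis]
        has_vector_derivative_mult assms bounded_linear.has_vector_derivative[OF bounded_linear_vec_nth])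
  moreover have "(\<Sum>i\<in>UNIV. axis i (c t * f t $ i)) = c t *s f t" for t
    using sum_axis[of "c t *s f t"] by simp
  moreover have "(\<Sum>i\<in>UNIV. axis i (c t * f' $ i + c' * f t $ i)) = c' *s f t + c t *s f'"
    using sum_axis[of "c' *s f t + c t *s f'"] by (simp add: add.commute)
  ultimately show ?thesis by simp
qed

text \<open>The conjugation in \<open>grad\<close> and that in \<open>hermitian\<close> cancel,
  leaving a polynomial in the components of \<open>w\<close> and \<open>y\<close>. This is why the
  algebras need not be closed under conjugation.\<close>

lemma algebra_hull_hermitian_grad:
  assumes "\<And>i. (\<lambda>t. y t $ i) \<in> algebra_hull B" "\<And>i. (\<lambda>t. w t $ i) \<in> algebra_hull B"
  shows "(\<lambda>t. hermitian (w t) (grad d a (y t))) \<in> algebra_hull B"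
  unfolding hermitian_grad monomials_deriv_def case_prod_unfold
  by (intro algebra_hull_sum algebra_hull.mult algebra_hull.add algebra_hull_power algebra_hull.const assms)

lemma C_infinity_on_grad:
  assumes "C_infinity_on z S"
  shows "C_infinity_on (\<lambda>t. grad d a (z t)) S"
proof (rule C_infinity_on_vecI)
  fix i
  have "C_infinity_on (\<lambda>t. hermitian (axis i 1) (grad d a (z t))) S"
    by (rule C_infinity_on_algebra_hull, rule algebra_hull_hermitian_grad)
       (auto intro: algebra_hull.generator algebra_hull.const C_infinity_on_nth[OF assms])
  then have "C_infinity_on (\<lambda>t. cnj (hermitian (axis i 1) (grad d a (z t)))) S"
    by (rule C_infinity_on_bounded_linear[OF bounded_linear_cnj])
  moreover have "cnj (hermitian (axis i 1) g) = g $ i" for g :: "complex ^ 3"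
    by (simp add: hermitian_def axis_def if_distrib[of "\<lambda>x. x * _"] cong: if_cong)
  ultimately show "C_infinity_on (\<lambda>t. grad d a (z t) $ i) S" by simp
qed

lemma C_infinity_on_hermitian_const:
  "C_infinity_on z S \<Longrightarrow> C_infinity_on (\<lambda>t. hermitian (z t) w) S"
  by (rule C_infinity_on_bounded_linear[OF bounded_linear_hermitian_left])

lemma continuous_on_grad [continuous_intros]:
  assumes "continuous_on S y"
  shows "continuous_on S (\<lambda>x. grad d a (y x))"
  unfolding grad_def monomials_deriv_def case_prod_unfold
  by (intro continuous_on_vec_lambda continuous_intros assms)

lemma continuous_on_hom_poly [continuous_intros]:
  assumes "continuous_on S y"
  shows "continuous_on S (\<lambda>x. hom_poly d a (y x))"
  unfolding hom_poly_def case_prod_unfold by (intro continuous_intros assms)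

section \<open>Implicit functions along a curve\<close>

lemma has_vector_derivative_quotientI:
  fixes f :: "real \<Rightarrow> 'a :: real_normed_vector"
  assumes "((\<lambda>s. (f s - f t) /\<^sub>R (s - t)) \<longlongrightarrow> f') (at t)"
  shows "(f has_vector_derivative f') (at t)"
  unfolding has_vector_derivative_def has_derivative_iff_norm
proof (intro conjI bounded_linear_scaleR_left)
  have "((\<lambda>s. norm ((f s - f t) /\<^sub>R (s - t) - f')) \<longlongrightarrow> 0) (at t)"
    using assms by (simp add: LIM_zero tendsto_norm_zero)
  moreover have "\<forall>\<^sub>F s in at t. norm ((f s - f t) /\<^sub>R (s - t) - f') = norm (f s - f t - (s - t) *\<^sub>R f') / norm (s - t)"
    using eventually_neq_at_within[of t]
  proof eventually_elim
    case (elim s)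
    then have "(f s - f t) /\<^sub>R (s - t) - f' = (f s - f t - (s - t) *\<^sub>R f') /\<^sub>R (s - t)"
      by (simp add: scaleR_diff_right)
    then show ?case by (simp add: divide_inverse mult.commute)
  qed
  ultimately show "((\<lambda>s. norm (f s - f t - (s - t) *\<^sub>R f') / norm (s - t)) \<longlongrightarrow> 0) (at t)"
    by (rule Lim_transform_eventually)
qed

lemma has_vector_derivative_quotientD:
  fixes f :: "real \<Rightarrow> 'a :: real_normed_vector"
  assumes "(f has_vector_derivative f') (at t)"
  shows "((\<lambda>s. (f s - f t) /\<^sub>R (s - t)) \<longlongrightarrow> f') (at t)"
proof -
  have "((\<lambda>s. norm (f s - f t - (s - t) *\<^sub>R f') / norm (s - t)) \<longlongrightarrow> 0) (at t)"
    using assms unfolding has_vector_derivative_def has_derivative_iff_norm by blast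
  moreover have "\<forall>\<^sub>F s in at t. norm (f s - f t - (s - t) *\<^sub>R f') / norm (s - t) = norm ((f s - f t) /\<^sub>R (s - t) - f')"
    using eventually_neq_at_within[of t]
  proof eventually_elim
    case (elim s)
    then have "(f s - f t) /\<^sub>R (s - t) - f' = (f s - f t - (s - t) *\<^sub>R f') /\<^sub>R (s - t)"
      by (simp add: scaleR_diff_right)
    then show ?case by (simp add: divide_inverse mult.commute)
  qed
  ultimately have "((\<lambda>s. norm ((f s - f t) /\<^sub>R (s - t) - f')) \<longlongrightarrow> 0) (at t)"
    by (rule Lim_transform_eventually)
  then show ?thesis by (simp add: LIM_zero_iff tendsto_norm_zero_iff)
qed

text \<open>Caratheodory's form of differentiability: the increment is an exact product with a
  factor that is continuous at \<open>y0\<close>. It removes the error terms from the computation of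
  the implicit derivative.\<close>

lemma hom_poly_quotient:
  obtains q where "\<And>y. hom_poly d a y - hom_poly d a y0 = hermitian (y - y0) (q y)"
    and "isCont q y0" "q y0 = grad d a y0"
proof -
  define e where "e = (\<lambda>y. hom_poly d a y - hom_poly d a y0 - hermitian (y - y0) (grad d a y0))"
  \<comment> \<open>The added multiple of \<open>y - y0\<close> has product \<open>e y\<close> with
    \<open>y - y0\<close>, and its norm is the relative error of the linearisation, which tends to
    0.\<close>
  define q where "q = (\<lambda>y. grad d a y0 + (cnj (e y) / of_real ((norm (y - y0))\<^sup>2)) *s (y - y0))"
  have q0: "q y0 = grad d a y0" by (simp add: q_def)
  have 1: "hom_poly d a y - hom_poly d a y0 = hermitian (y - y0) (q y)" for y
    by (cases "y = y0") (simp_all add: q_def e_def hermitian_add_right hermitian_scale_right hermitian_self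
        del: vector_ssub_ldistrib)
  have "((\<lambda>y. norm (e y) / norm (y - y0)) \<longlongrightarrow> 0) (at y0)"
    using hom_poly_has_derivative[of d a y0] unfolding has_derivative_iff_norm e_def by blast
  moreover have "norm (q y - grad d a y0) = norm (e y) / norm (y - y0)" for y
    by (cases "y = y0") (simp_all add: q_def norm_vector_scale norm_divide norm_mult power2_eq_square del: vector_ssub_ldistrib)
  ultimately have "((\<lambda>y. q y - grad d a y0) \<longlongrightarrow> 0) (at y0)"
    by (simp add: tendsto_norm_zero_iff[of "\<lambda>y. q y - grad d a y0", symmetric])
  then have "isCont q y0"
    by (simp add: isCont_def q0 LIM_zero_iff)
  from that[OF 1 this q0] show thesis .
qed

text \<open>Only continuity of \<open>s\<close> is assumed. The Caratheodory factor turns the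
  equation satisfied by \<open>s\<close> into a linear equation for its difference quotient, which
  can be solved before the limit is taken.\<close>

lemma implicit_derivative:
  fixes z v :: "real \<Rightarrow> complex ^ 3" and s :: "real \<Rightarrow> complex"
  assumes T: "open T" "t \<in> T"
    and z: "(z has_vector_derivative z') (at t)" and v: "(v has_vector_derivative v') (at t)"
    and s: "isCont s t" and zero: "\<And>t. t \<in> T \<Longrightarrow> hom_poly d a (z t + s t *s v t) = 0"
    and nz: "hermitian (v t) (grad d a (z t + s t *s v t)) \<noteq> 0"
  shows "(s has_vector_derivative
     - hermitian (z' + s t *s v') (grad d a (z t + s t *s v t)) / hermitian (v t) (grad d a (z t + s t *s v t))) (at t)"
proof (rule has_vector_derivative_quotientI)
  define y where "y = (\<lambda>t. z t + s t *s v t)"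
  obtain q where q: "\<And>x. hom_poly d a x - hom_poly d a (y t) = hermitian (x - y t) (q x)"
    "isCont q (y t)" "q (y t) = grad d a (y t)"
    using hom_poly_quotient[of d a "y t"] by blast
  have lim [tendsto_intros]: "(z \<longlongrightarrow> z t) (at t)" "(v \<longlongrightarrow> v t) (at t)" "(s \<longlongrightarrow> s t) (at t)"
    using has_vector_derivative_continuous[OF z] has_vector_derivative_continuous[OF v] s
    by (simp_all add: isCont_def)
  have y: "(y \<longlongrightarrow> y t) (at t)"
    unfolding y_def by (intro tendsto_intros)
  have qy [tendsto_intros]: "((\<lambda>r. q (y r)) \<longlongrightarrow> grad d a (y t)) (at t)"
    using isCont_tendsto_compose[OF q(2) y] by (simp add: q(3))
  define dz where "dz = (\<lambda>r. (z r - z t) /\<^sub>R (r - t))"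
  define dv where "dv = (\<lambda>r. (v r - v t) /\<^sub>R (r - t))"
  have [tendsto_intros]: "(dz \<longlongrightarrow> z') (at t)" "(dv \<longlongrightarrow> v') (at t)"
    unfolding dz_def dv_def by (intro has_vector_derivative_quotientD z v)+
  have nz': "hermitian (v t) (grad d a (y t)) \<noteq> 0" using nz by (simp add: y_def)
  have "((\<lambda>r. - hermitian (dz r + s r *s dv r) (q (y r)) / hermitian (v t) (q (y r)))
     \<longlongrightarrow> - hermitian (z' + s t *s v') (grad d a (y t)) / hermitian (v t) (grad d a (y t))) (at t)"
    by (intro tendsto_intros nz')
  moreover have "\<forall>\<^sub>F r in at t. - hermitian (dz r + s r *s dv r) (q (y r)) / hermitian (v t) (q (y r))
     = (s r - s t) /\<^sub>R (r - t)"
  proof -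
    have "((\<lambda>r. hermitian (v t) (q (y r))) \<longlongrightarrow> hermitian (v t) (grad d a (y t))) (at t)"
      by (intro tendsto_intros)
    then have "\<forall>\<^sub>F r in at t. hermitian (v t) (q (y r)) \<noteq> 0"
      using nz' tendsto_imp_eventually_ne by blast
    moreover have "\<forall>\<^sub>F r in at t. r \<in> T" using T by (simp add: eventually_at_in_open')
    moreover have "\<forall>\<^sub>F r in at t. r \<noteq> t" by (rule eventually_neq_at_within)
    ultimately show ?thesis
    proof eventually_elim
      case (elim r)
      have "0 = hermitian (y r - y t) (q (y r))"
        using q(1)[of "y r"] zero[OF elim(2)] zero[OF T(2)] by (simp add: y_def)
      also have "y r - y t = (r - t) *\<^sub>R (dz r + s r *s dv r) + (s r - s t) *s v t"
      proof -
        have "(r - t) *\<^sub>R dz r = z r - z t" "(r - t) *\<^sub>R dv r = v r - v t"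
          using elim(3) by (simp_all add: dz_def dv_def)
        moreover have "(r - t) *\<^sub>R (dz r + s r *s dv r) = (r - t) *\<^sub>R dz r + s r *s ((r - t) *\<^sub>R dv r)"
          by (simp add: vec_eq_iff algebra_simps)
        ultimately have *: "(r - t) *\<^sub>R (dz r + s r *s dv r) = (z r - z t) + s r *s (v r - v t)"
          by (simp only:)
        show ?thesis unfolding * by (simp add: y_def vec_eq_iff algebra_simps)
      qed
      finally have "0 = of_real (r - t) * hermitian (dz r + s r *s dv r) (q (y r)) + (s r - s t) * hermitian (v t) (q (y r))"
        by (simp only: hermitian_add_left hermitian_scaleR_left hermitian_scale_left)
      then have "(s r - s t) * hermitian (v t) (q (y r)) = - of_real (r - t) * hermitian (dz r + s r *s dv r) (q (y r))"
        by (simp only: mult_minus_left eq_neg_iff_add_eq_0 add.commute)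
      then show ?case
        using elim(1,3) by (simp add: scaleR_conv_of_real[where 'a = complex] field_simps del: of_real_diff)
    qed
  qed
  ultimately show "((\<lambda>r. (s r - s t) /\<^sub>R (r - t)) \<longlongrightarrow>
     - hermitian (z' + s t *s v') (grad d a (z t + s t *s v t)) / hermitian (v t) (grad d a (z t + s t *s v t))) (at t)"
    unfolding y_def by (rule Lim_transform_eventually)
qed

text \<open>The formula for the derivative of \<open>s\<close> contains \<open>s\<close> again.
  Smoothness is obtained all at once, without counting derivatives: the smooth functions together
  with \<open>s\<close> and the reciprocal \<open>R\<close> generate an algebra closed under
  differentiation.\<close>

lemma implicit_smooth:
  fixes z v :: "real \<Rightarrow> complex ^ 3" and s :: "real \<Rightarrow> complex"
  assumes T: "open T" and z: "C_infinity_on z T" and v: "C_infinity_on v T" and s: "continuous_on T s"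
    and zero: "\<And>t. t \<in> T \<Longrightarrow> hom_poly d a (z t + s t *s v t) = 0"
    and nz: "\<And>t. t \<in> T \<Longrightarrow> hermitian (v t) (grad d a (z t + s t *s v t)) \<noteq> 0"
  shows "C_infinity_on s T"
proof -
  define D where "D = (\<lambda>t. hermitian (v t) (grad d a (z t + s t *s v t)))"
  define R where "R = (\<lambda>t. 1 / D t)"
  obtain z' where z': "C_infinity_on z' T" "\<And>t. t \<in> T \<Longrightarrow> (z has_vector_derivative z' t) (at t)"
    using C_infinity_on_derivative[OF z] by blast
  obtain v' where v': "C_infinity_on v' T" "\<And>t. t \<in> T \<Longrightarrow> (v has_vector_derivative v' t) (at t)"
    using C_infinity_on_derivative[OF v] by blast
  define B where "B = insert s {g. C_infinity_on g T}"
  define C where "C = insert R B"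
  have gen: "g \<in> algebra_hull B" if "g \<in> B" for g
    using that by (rule algebra_hull.generator)
  have BC: "g \<in> algebra_hull C" if "g \<in> algebra_hull B" for g
    using that by (rule algebra_hull_mono) (auto simp: C_def)
  have nth: "(\<lambda>t. z t $ i) \<in> algebra_hull B" "(\<lambda>t. v t $ i) \<in> algebra_hull B"
    "(\<lambda>t. z' t $ i) \<in> algebra_hull B" "(\<lambda>t. v' t $ i) \<in> algebra_hull B" for i
    by (intro gen; simp add: B_def C_infinity_on_nth z v z'(1) v'(1))+
  have s_alg: "s \<in> algebra_hull B" by (rule gen) (simp add: B_def)
  have ynth: "(\<lambda>t. (z t + s t *s v t) $ i) \<in> algebra_hull B" for i
    by (simp add: algebra_hull.add algebra_hull.mult nth s_alg)
  have D_alg: "D \<in> algebra_hull B"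
    unfolding D_def by (rule algebra_hull_hermitian_grad[OF ynth nth(2)])
  have N_alg: "(\<lambda>t. hermitian (z' t + s t *s v' t) (grad d a (z t + s t *s v t))) \<in> algebra_hull B"
    by (rule algebra_hull_hermitian_grad[OF ynth]) (simp add: algebra_hull.add algebra_hull.mult nth s_alg)
  have R_alg: "R \<in> algebra_hull C" by (rule algebra_hull.generator) (simp add: C_def)
  have ds: "(s has_vector_derivative - hermitian (z' t + s t *s v' t) (grad d a (z t + s t *s v t)) * R t) (at t)"
    if "t \<in> T" for t
  proof -
    have "isCont s t" using s T that by (simp add: continuous_on_eq_continuous_at)
    from implicit_derivative[OF T that z'(2)[OF that] v'(2)[OF that] this zero nz[OF that]]
    show ?thesis by (simp add: R_def D_def)
  qed
  have dB: "\<exists>g\<in>algebra_hull C. \<forall>t\<in>T. (b has_vector_derivative g t) (at t)" if "b \<in> B" for b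
  proof (cases "b = s")
    case True
    show ?thesis unfolding True
      by (intro bexI[of _ "\<lambda>t. - hermitian (z' t + s t *s v' t) (grad d a (z t + s t *s v t)) * R t"] ballI ds
          algebra_hull.mult algebra_hull_uminus BC N_alg R_alg)
  next
    case False
    with that have "C_infinity_on b T" by (auto simp: B_def)
    then obtain b' where "C_infinity_on b' T" "\<And>t. t \<in> T \<Longrightarrow> (b has_vector_derivative b' t) (at t)"
      using C_infinity_on_derivative by blast
    moreover from this have "b' \<in> algebra_hull C" by (intro BC gen) (simp add: B_def)
    ultimately show ?thesis by blast
  qed
  have dC: "\<exists>g\<in>algebra_hull C. \<forall>t\<in>T. (b has_vector_derivative g t) (at t)" if "b \<in> C" for b
  proof (cases "b = R")
    case True
    \<comment> \<open>\<open>D\<close> lies in the algebra without \<open>R\<close>, whose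
      derivatives are already known; this avoids a circular appeal to the derivative of
      \<open>R\<close>.\<close>
    obtain D' where D': "D' \<in> algebra_hull C" "\<forall>t\<in>T. (D has_vector_derivative D' t) (at t)"
      using algebra_hull_derivative[OF D_alg _ dB] gen BC by blast
    show ?thesis unfolding True
    proof (intro bexI[of _ "\<lambda>t. - D' t * R t * R t"] ballI)
      fix t assume "t \<in> T"
      then show "(R has_vector_derivative - D' t * R t * R t) (at t)"
        unfolding R_def using D'(2) nz by (intro has_vector_derivative_inverse) (auto simp: D_def)
    qed (intro algebra_hull.mult algebra_hull_uminus D' R_alg)
  next
    case False
    with that show ?thesis by (intro dB) (simp add: C_def)
  qed
  show ?thesis
    by (rule C_infinity_on_algebra[OF BC[OF s_alg] dC])
qed

section \<open>Lifts of curves and their lengths\<close>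

lemma proportional_refl: "z \<noteq> 0 \<Longrightarrow> proportional z z"
  by (auto simp: proportional_def intro: exI[of _ 1])

lemma abs_cp2_eq_iff:
  assumes "z \<noteq> 0" "w \<noteq> 0"
  shows "abs_cp2 z = abs_cp2 w \<longleftrightarrow> (\<exists>c. c \<noteq> 0 \<and> w = c *s z)"
proof -
  have "abs_cp2 z = abs_cp2 w \<longleftrightarrow> proportional z w"
    using Quotient_rel[OF Quotient_cp2, of z w] assms proportional_refl by blast
  also have "\<dots> \<longleftrightarrow> (\<exists>c. c \<noteq> 0 \<and> w = c *s z)"
    using assms by (auto simp: proportional_def vec_eq_iff)
  finally show ?thesis .
qed

lemma abs_cp2_scale: "c \<noteq> 0 \<Longrightarrow> z \<noteq> 0 \<Longrightarrow> abs_cp2 (c *s z) = abs_cp2 z"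
  by (subst eq_commute, subst abs_cp2_eq_iff) (auto simp: vec_eq_iff)

lemma cp2_unit_rep:
  obtains z where "norm z = 1" "p = abs_cp2 z"
proof -
  obtain w where "proportional w w" "p = abs_cp2 w"
    by (induction p rule: cp2.abs_induct) blast
  then have w: "w \<noteq> 0" "p = abs_cp2 w" by (auto simp: proportional_def)
  then have "norm ((1 / of_real (norm w)) *s w) = 1" "p = abs_cp2 ((1 / of_real (norm w)) *s w)"
    by (simp_all add: norm_vector_scale norm_divide abs_cp2_scale)
  then show thesis using that by blast
qed

lemma affine_rep_abs: "z \<noteq> 0 \<Longrightarrow> affine_rep k (abs_cp2 z) = (1 / z $ k) *s z"
  by (simp add: affine_rep.abs_eq proportional_refl)

lemma continuous_on_abs_cp2:
  assumes "continuous_on S y" "\<And>x. x \<in> S \<Longrightarrow> y x \<noteq> 0"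
  shows "continuous_on S (\<lambda>x. abs_cp2 (y x))"
proof -
  have "continuous_on (- {0}) abs_cp2"
  proof (subst continuous_on_open_vimage)
    have "abs_cp2 -` B \<inter> - {0} = {z. z \<noteq> 0 \<and> abs_cp2 z \<in> B}" for B by auto
    then show "\<forall>B. open B \<longrightarrow> open (abs_cp2 -` B \<inter> - {0})" by (simp add: open_cp2_def)
  qed auto
  then show ?thesis
    by (rule continuous_on_compose2[OF _ assms(1)]) (use assms(2) in auto)
qed

text \<open>Lifts with arbitrary scaling are more flexible than the standard charts, since a lift
  can be chosen to be adapted to a point or to the gradient.\<close>

definition lift_on :: "(real \<Rightarrow> cp2) \<Rightarrow> (real \<Rightarrow> complex ^ 3) \<Rightarrow> real set \<Rightarrow> bool" where
  "lift_on \<gamma> y T \<longleftrightarrow> open T \<and> C_infinity_on y T \<and> (\<forall>t\<in>T. y t \<noteq> 0 \<and> \<gamma> t = abs_cp2 (y t))"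

lemma open_subset_nonzero:
  assumes "open (T :: real set)" "continuous_on T (f :: real \<Rightarrow> complex)"
  shows "open {t \<in> T. f t \<noteq> 0}"
proof -
  have "open (T \<inter> f -` (- {0}))"
    using assms continuous_on_open_vimage[OF assms(1)] by (metis Int_commute open_Compl closed_singleton)
  then show ?thesis by (simp add: vimage_def Int_def)
qed

lemma lift_on_scale:
  assumes "lift_on \<gamma> y T" "C_infinity_on c T"
  shows "lift_on \<gamma> (\<lambda>t. (1 / c t) *s y t) {t \<in> T. c t \<noteq> 0}"
proof -
  have "C_infinity_on (\<lambda>t. (1 / c t) *s y t) {t \<in> T. c t \<noteq> 0}"
    using assms unfolding lift_on_def
    by (intro C_infinity_on_scale C_infinity_on_inverse) (auto intro: C_infinity_on_subset)
  moreover have "open {t \<in> T. c t \<noteq> 0}"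
    using assms unfolding lift_on_def by (intro open_subset_nonzero C_infinity_on_continuous) auto
  ultimately show ?thesis
    using assms(1) by (auto simp: lift_on_def abs_cp2_scale)
qed

lemma smooth_curveI_lift:
  assumes "\<And>t. \<exists>T y. t \<in> T \<and> lift_on \<gamma> y T"
  shows "smooth_curve \<gamma>"
  unfolding smooth_curve_def
proof (intro conjI allI)
  show "continuous_on UNIV \<gamma>"
  proof (rule continuous_at_imp_continuous_on, rule ballI)
    fix t
    obtain T y where Ty: "t \<in> T" "lift_on \<gamma> y T" using assms by blast
    then have "continuous_on T (\<lambda>t. abs_cp2 (y t))"
      by (intro continuous_on_abs_cp2 C_infinity_on_continuous) (auto simp: lift_on_def)
    then have "continuous_on T \<gamma>"
      using Ty(2) by (auto simp: lift_on_def elim: continuous_on_eq)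
    moreover have "open T" using Ty(2) by (simp add: lift_on_def)
    ultimately show "isCont \<gamma> t"
      using Ty(1) continuous_on_eq_continuous_at by blast
  qed
next
  fix k
  show "C_infinity_on (affine_rep k \<circ> \<gamma>) {t. in_chart k (\<gamma> t)}"
  proof (rule C_infinity_on_local)
    fix t assume t: "t \<in> {t. in_chart k (\<gamma> t)}"
    obtain T y where Ty: "t \<in> T" "lift_on \<gamma> y T" using assms by blast
    define T' where "T' = {t \<in> T. y t $ k \<noteq> 0}"
    have "C_infinity_on (\<lambda>t. y t $ k) T" using Ty by (auto simp: lift_on_def intro: C_infinity_on_nth)
    then have l: "lift_on \<gamma> (\<lambda>t. (1 / y t $ k) *s y t) T'"
      unfolding T'_def by (rule lift_on_scale[OF Ty(2)])
    have "C_infinity_on (affine_rep k \<circ> \<gamma>) T'"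
    proof (rule C_infinity_on_cong)
      show "C_infinity_on (\<lambda>t. (1 / y t $ k) *s y t) T'" "open T'" using l by (auto simp: lift_on_def)
      show "(affine_rep k \<circ> \<gamma>) s = (1 / y s $ k) *s y s" if "s \<in> T'" for s
        using that Ty by (simp add: T'_def lift_on_def affine_rep_abs)
    qed
    moreover have "t \<in> T'" using t Ty by (auto simp: T'_def lift_on_def in_chart_abs)
    ultimately show "\<exists>T. open T \<and> t \<in> T \<and> C_infinity_on (affine_rep k \<circ> \<gamma>) T"
      using l by (auto simp: lift_on_def)
  qed
qed

lemma smooth_curve_lift:
  assumes "smooth_curve \<gamma>"
  obtains T y where "t \<in> T" "lift_on \<gamma> y T"
proof -
  obtain k where k: "in_chart k (\<gamma> t)" using ex_in_chart by blast
  let ?T = "{t. in_chart k (\<gamma> t)}"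
  have "open (\<gamma> -` {p. in_chart k p})"
    using assms unfolding smooth_curve_def by (intro open_vimage open_in_chart) auto
  then have "open ?T" by (simp add: vimage_def)
  moreover have "affine_rep k p \<noteq> 0 \<and> p = abs_cp2 (affine_rep k p)" if "in_chart k p" for p
  proof -
    obtain z where z: "norm z = 1" "p = abs_cp2 z" by (rule cp2_unit_rep)
    then have z0: "z \<noteq> 0" by auto
    then have "z $ k \<noteq> 0" using that z by (simp add: in_chart_abs)
    with z0 show ?thesis using z by (auto simp: affine_rep_abs abs_cp2_scale vec_eq_iff)
  qed
  ultimately have "lift_on \<gamma> (affine_rep k \<circ> \<gamma>) ?T"
    using assms by (auto simp: lift_on_def smooth_curve_def)
  moreover have "t \<in> ?T" using k by simp
  ultimately show thesis by (intro that)
qed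

text \<open>A chart representative is a lift divided by one of its components; the product rule then
  adds a multiple of \<open>y t\<close> to the scaled velocity, which
  \<open>fubini_study_change_rep\<close> shows to be invisible to the metric.\<close>

lemma fs_speed_lift:
  assumes "smooth_curve \<gamma>" "lift_on \<gamma> y T" "t \<in> T" "(y has_vector_derivative y') (at t)"
  shows "fs_speed \<gamma> t = sqrt (fubini_study (y t) y' y')"
proof -
  have T: "open T" "y t \<noteq> 0" using assms by (auto simp: lift_on_def)
  then obtain k where k: "y t $ k \<noteq> 0" by (auto simp: vec_eq_iff)
  define c where "c = (\<lambda>s. 1 / y s $ k)"
  have ct: "c t \<noteq> 0" using k by (simp add: c_def)
  obtain b where b: "(c has_vector_derivative b) (at t)"
    using has_vector_derivative_inverse[OF bounded_linear.has_vector_derivative[OF bounded_linear_vec_nth assms(4)] k]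
    unfolding c_def by blast
  have d: "((\<lambda>s. c s *s y s) has_vector_derivative (b *s y t + c t *s y')) (at t)"
    by (rule has_vector_derivative_scale[OF b assms(4)])
  have eq: "affine_rep k (\<gamma> s) = c s *s y s" if "s \<in> T" for s
    using that assms(2) by (simp add: lift_on_def affine_rep_abs c_def)
  have "((affine_rep k \<circ> \<gamma>) has_vector_derivative (b *s y t + c t *s y')) (at t)"
    by (rule has_vector_derivative_transform_within_open[OF d T(1) assms(3)]) (simp add: eq)
  then have "vector_derivative (affine_rep k \<circ> \<gamma>) (at t) = b *s y t + c t *s y'"
    by (rule vector_derivative_at)
  moreover have "in_chart k (\<gamma> t)" using assms k by (simp add: lift_on_def in_chart_abs)
  ultimately show ?thesis
    using fs_speed_eq[OF assms(1), of k t] eq[OF assms(3)] fubini_study_change_rep[OF T(2) ct, of b y']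
    by (simp add: chart_speed_def)
qed

section \<open>Estimates for the Fubini-Study norm\<close>

lemma fubini_study_real:
  "fubini_study z v v = ((norm v)\<^sup>2 * (norm z)\<^sup>2 - (norm (hermitian v z))\<^sup>2) / ((norm z) ^ 4 * pi)"
proof -
  have "hermitian v z * hermitian z v = complex_of_real ((norm (hermitian v z))\<^sup>2)"
    by (subst hermitian_commute[of z v]) (rule complex_norm_square[symmetric, THEN sym, symmetric])
  then have "hermitian v v * hermitian z z - hermitian v z * hermitian z v =
      complex_of_real ((norm v)\<^sup>2 * (norm z)\<^sup>2 - (norm (hermitian v z))\<^sup>2)"
    by (simp add: hermitian_self)
  moreover have "(hermitian z z)\<^sup>2 = complex_of_real (norm z ^ 4)"
    by (simp add: hermitian_self power_mult[symmetric])
  ultimately show ?thesis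
    unfolding fubini_study_def by (simp only: of_real_divide[symmetric] Re_complex_of_real divide_divide_eq_left)
qed

lemma fubini_study_orthogonal:
  "norm z = 1 \<Longrightarrow> hermitian v z = 0 \<Longrightarrow> fubini_study z v v = (norm v)\<^sup>2 / pi"
  by (simp add: fubini_study_real)

lemma fubini_study_le:
  assumes "z \<noteq> 0"
  shows "fubini_study z v v \<le> (norm v / norm z)\<^sup>2 / pi"
proof -
  have "fubini_study z v v \<le> ((norm v)\<^sup>2 * (norm z)\<^sup>2) / ((norm z) ^ 4 * pi)"
    unfolding fubini_study_real by (intro divide_right_mono) auto
  also have "\<dots> = (norm v / norm z)\<^sup>2 / pi"
    using assms by (simp add: power_divide field_simps power4_eq_xxxx power2_eq_square)
  finally show ?thesis .
qed

text \<open>As \<open>v\<close> is orthogonal to \<open>z0\<close>, only \<open>u\<close>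
  contributes to the product that is subtracted in the metric, and Cauchy-Schwarz bounds it. This
  converts speed into Euclidean speed in the affine chart.\<close>

lemma fubini_study_affine_ge:
  assumes "norm z0 = 1" "hermitian u z0 = 0" "hermitian v z0 = 0"
  shows "fubini_study (z0 + u) v v \<ge> (norm v / (1 + (norm u)\<^sup>2))\<^sup>2 / pi"
proof -
  have n: "(norm (z0 + u))\<^sup>2 = 1 + (norm u)\<^sup>2"
    using norm_add_orthogonal[OF assms(2)] assms(1) by simp
  then have n4: "norm (z0 + u) ^ 4 = (1 + (norm u)\<^sup>2)\<^sup>2"
    by (metis power_mult mult_2 numeral_Bit0)
  have "hermitian v (z0 + u) = hermitian v u" using assms by (simp add: hermitian_add_right)
  then have "(norm (hermitian v (z0 + u)))\<^sup>2 \<le> (norm v * norm u)\<^sup>2"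
    using norm_hermitian_le[of v u] by (simp add: power_mono)
  then have "(norm v)\<^sup>2 \<le> (norm v)\<^sup>2 * (norm (z0 + u))\<^sup>2 - (norm (hermitian v (z0 + u)))\<^sup>2"
    unfolding n by (simp add: power_mult_distrib distrib_left)
  then have "(norm v)\<^sup>2 / ((1 + (norm u)\<^sup>2)\<^sup>2 * pi) \<le> fubini_study (z0 + u) v v"
    unfolding fubini_study_real n4 by (intro divide_right_mono) auto
  then show ?thesis by (simp add: power_divide)
qed

lemma fs_speed_nonneg: "fs_speed \<gamma> t \<ge> 0"
proof -
  have "fubini_study z v v \<ge> 0" for z v
  proof -
    have "(norm (hermitian v z))\<^sup>2 \<le> (norm v * norm z)\<^sup>2"
      by (intro power_mono norm_hermitian_le) auto
    then show ?thesis by (simp add: fubini_study_real power_mult_distrib)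
  qed
  then show ?thesis by (simp add: fs_speed_def chart_speed_def Let_def)
qed

lemma continuous_on_fs_speed:
  assumes "smooth_curve \<gamma>"
  shows "continuous_on S (fs_speed \<gamma>)"
proof (rule continuous_at_imp_continuous_on, rule ballI)
  fix t
  obtain T y where Ty: "t \<in> T" "lift_on \<gamma> y T" using smooth_curve_lift[OF assms] by blast
  obtain y' where y': "C_infinity_on y' T" "\<And>t. t \<in> T \<Longrightarrow> (y has_vector_derivative y' t) (at t)"
    using Ty C_infinity_on_derivative unfolding lift_on_def by blast
  have "continuous_on T (\<lambda>t. sqrt (fubini_study (y t) (y' t) (y' t)))"
    using Ty y'(1) unfolding fubini_study_def lift_on_def
    by (intro continuous_intros C_infinity_on_continuous) (auto simp: hermitian_self_eq_0_iff)
  then have "continuous_on T (fs_speed \<gamma>)"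
    using fs_speed_lift[OF assms Ty(2) _ y'(2)] by (auto elim: continuous_on_eq)
  then show "isCont (fs_speed \<gamma>) t"
    using Ty continuous_on_eq_continuous_at by (auto simp: lift_on_def)
qed

text \<open>The affine coordinate centred at \<open>[z0]\<close>: the representative \<open>z\<close> with \<open>hermitian z z0 = 1\<close>, and \<open>0\<close>
  (because of \<open>1 / 0 = 0\<close>) on the polar line of \<open>z0\<close>.\<close>

definition affine_at :: "complex ^ 3 \<Rightarrow> cp2 \<Rightarrow> complex ^ 3" where
  "affine_at z0 p = (let z = SOME z. z \<noteq> 0 \<and> p = abs_cp2 z in (1 / hermitian z z0) *s z)"

lemma affine_at_abs:
  assumes "z \<noteq> 0"
  shows "affine_at z0 (abs_cp2 z) = (1 / hermitian z z0) *s z"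
proof -
  define w where "w = (SOME w. w \<noteq> 0 \<and> abs_cp2 z = abs_cp2 w)"
  have "w \<noteq> 0 \<and> abs_cp2 z = abs_cp2 w"
    unfolding w_def by (rule someI[of _ z]) (use assms in auto)
  then obtain c where "c \<noteq> 0" "w = c *s z" using abs_cp2_eq_iff assms by blast
  then show ?thesis
    by (simp add: affine_at_def w_def[symmetric] hermitian_scale_left)
qed

lemma affine_at_nonzero:
  assumes "affine_at z0 p \<noteq> 0"
  shows "hermitian (affine_at z0 p) z0 = 1" "abs_cp2 (affine_at z0 p) = p"
proof -
  obtain z where z: "norm z = 1" "p = abs_cp2 z" by (rule cp2_unit_rep)
  then have "z \<noteq> 0" by auto
  moreover from this have "hermitian z z0 \<noteq> 0" using assms z by (auto simp: affine_at_abs)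
  ultimately show "hermitian (affine_at z0 p) z0 = 1" "abs_cp2 (affine_at z0 p) = p"
    using z by (auto simp: affine_at_abs hermitian_scale_left abs_cp2_scale)
qed

lemma affine_at_self: "norm z0 = 1 \<Longrightarrow> affine_at z0 (abs_cp2 z0) = z0"
  by (subst affine_at_abs) (auto simp: hermitian_self)

lemma lift_affine_at:
  assumes "smooth_curve \<gamma>"
  shows "lift_on \<gamma> (\<lambda>t. affine_at z0 (\<gamma> t)) {t. affine_at z0 (\<gamma> t) \<noteq> 0}"
proof -
  let ?D = "{t. affine_at z0 (\<gamma> t) \<noteq> 0}"
  have loc: "\<exists>T. open T \<and> t \<in> T \<and> T \<subseteq> ?D \<and> C_infinity_on (\<lambda>t. affine_at z0 (\<gamma> t)) T" if t: "t \<in> ?D" for t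
  proof -
    obtain T y where Ty: "t \<in> T" "lift_on \<gamma> y T" using smooth_curve_lift[OF assms] by blast
    define T' where "T' = {t \<in> T. hermitian (y t) z0 \<noteq> 0}"
    have "C_infinity_on (\<lambda>t. hermitian (y t) z0) T"
      using Ty by (auto simp: lift_on_def intro: C_infinity_on_hermitian_const)
    then have l: "lift_on \<gamma> (\<lambda>t. (1 / hermitian (y t) z0) *s y t) T'"
      unfolding T'_def by (rule lift_on_scale[OF Ty(2)])
    have eq: "affine_at z0 (\<gamma> s) = (1 / hermitian (y s) z0) *s y s" if "s \<in> T" for s
      using that Ty by (simp add: lift_on_def affine_at_abs)
    have T': "open T'" "C_infinity_on (\<lambda>t. (1 / hermitian (y t) z0) *s y t) T'"
      using l unfolding lift_on_def by blast+
    have "C_infinity_on (\<lambda>t. affine_at z0 (\<gamma> t)) T'"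
      by (rule C_infinity_on_cong[OF T'(2,1)]) (rule eq, simp add: T'_def)
    moreover have "t \<in> T'" using t Ty eq[of t] by (auto simp: T'_def)
    moreover have "T' \<subseteq> ?D"
    proof
      fix s assume "s \<in> T'"
      then show "s \<in> ?D" using l eq[of s] by (simp add: T'_def lift_on_def)
    qed
    ultimately show ?thesis using T'(1) by blast
  qed
  then have "C_infinity_on (\<lambda>t. affine_at z0 (\<gamma> t)) ?D"
    by (intro C_infinity_on_local) blast
  moreover have "open ?D"
    using loc by (subst open_subopen) blast
  ultimately show ?thesis
    by (auto simp: lift_on_def affine_at_nonzero)
qed

text \<open>The centred coordinate stays in the plane where the product with \<open>z0\<close> is 1,
  so its velocity is tangent.\<close>

lemma lift_affine_derivative:
  assumes "smooth_curve \<gamma>" "affine_at z0 (\<gamma> t) \<noteq> 0"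
  obtains y' where "((\<lambda>t. affine_at z0 (\<gamma> t)) has_vector_derivative y') (at t)" "hermitian y' z0 = 0"
proof -
  let ?y = "\<lambda>t. affine_at z0 (\<gamma> t)" and ?D = "{t. affine_at z0 (\<gamma> t) \<noteq> 0}"
  have l: "C_infinity_on ?y ?D" "open ?D" using lift_affine_at[OF assms(1)] by (auto simp: lift_on_def)
  obtain y' where y': "(?y has_vector_derivative y' t) (at t)"
    using C_infinity_on_derivative[OF l(1)] assms(2) by blast
  have "((\<lambda>t. hermitian (?y t) z0) has_vector_derivative hermitian (y' t) z0) (at t)"
    by (rule bounded_linear.has_vector_derivative[OF bounded_linear_hermitian_left y'])
  moreover have "((\<lambda>t. hermitian (?y t) z0) has_vector_derivative 0) (at t)"
    by (rule has_vector_derivative_transform_within_open[OF has_vector_derivative_const[of 1] l(2)])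
       (use assms(2) affine_at_nonzero in auto)
  ultimately have "hermitian (y' t) z0 = 0" by (rule vector_derivative_unique_at)
  with y' that show thesis by blast
qed

lemma norm_diff_le_integral:
  fixes f :: "real \<Rightarrow> 'a :: banach"
  assumes f: "\<And>t. t \<in> {0..1} \<Longrightarrow> (f has_vector_derivative f' t) (at t)"
    and bd: "\<And>t. t \<in> {0..1} \<Longrightarrow> norm (f' t) \<le> C * g t"
    and g: "continuous_on {0..1} g" "\<And>t. g t \<ge> 0" and "C \<ge> 0" and t: "t \<in> {0..1}"
  shows "norm (f t - f 0) \<le> C * integral {0..1} g"
proof -
  have 1: "(f' has_integral (f t - f 0)) {0..t}"
    using t by (intro fundamental_theorem_of_calculus)
      (auto intro!: has_vector_derivative_at_within f)
  have g1: "(\<lambda>t. C * g t) integrable_on {0..1}"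
    by (intro integrable_continuous_interval continuous_intros g)
  then have g2: "(\<lambda>t. C * g t) integrable_on {0..t}"
    using t by (auto intro: integrable_on_subinterval)
  have "norm (integral {0..t} f') \<le> integral {0..t} (\<lambda>t. C * g t)"
    by (rule integral_norm_bound_integral) (use 1 g2 bd t in auto)
  also have "\<dots> \<le> integral {0..1} (\<lambda>t. C * g t)"
    by (rule integral_subset_le) (use t g1 g2 g assms in auto)
  finally show ?thesis using 1 by (simp add: integral_unique)
qed

text \<open>The square \<open>1 / |w|^2\<close> of the cosine of the distance to \<open>z0\<close> is Lipschitz along the curve; this first
  keeps the curve inside the affine chart, where the speed then controls \<open>|w'|\<close>.\<close>

lemma short_curve_affine:
  assumes \<gamma>: "smooth_curve \<gamma>" and z0: "norm z0 = 1" "\<gamma> 0 = abs_cp2 z0"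
    and short: "fs_length \<gamma> \<le> 1 / 9" and t: "t \<in> {0..1}"
  shows "affine_at z0 (\<gamma> t) \<noteq> 0" "norm (affine_at z0 (\<gamma> t) - z0) \<le> 4 * fs_length \<gamma>"
proof -
  define \<phi> where "\<phi> = (\<lambda>t. 1 / (norm (affine_at z0 (\<gamma> t)))\<^sup>2)"
  have spi: "sqrt pi \<le> 2" using pi_less_4 real_sqrt_le_mono[of pi 4] by simp
  have "\<exists>\<phi>'. (\<phi> has_vector_derivative \<phi>') (at s) \<and> norm \<phi>' \<le> 4 * fs_speed \<gamma> s" for s
  proof -
    \<comment> \<open>Recentring the coordinate at the current point makes the speed exactly
      \<open>norm y' / sqrt pi\<close> at that time.\<close>
    obtain z1 where z1: "norm z1 = 1" "\<gamma> s = abs_cp2 z1" by (rule cp2_unit_rep)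
    define y where "y = (\<lambda>t. affine_at z1 (\<gamma> t))"
    have ys: "y s = z1" using affine_at_self z1 by (simp add: y_def)
    then have ys0: "affine_at z1 (\<gamma> s) \<noteq> 0" using z1 by (auto simp: y_def)
    obtain y' where y': "(y has_vector_derivative y') (at s)" "hermitian y' z1 = 0"
      using lift_affine_derivative[OF \<gamma> ys0] unfolding y_def by blast
    define D where "D = {t. affine_at z1 (\<gamma> t) \<noteq> 0}"
    have l: "lift_on \<gamma> y D" unfolding y_def D_def by (rule lift_affine_at[OF \<gamma>])
    have sD: "s \<in> D" using ys0 by (simp add: D_def)
    have speed: "fs_speed \<gamma> s = norm y' / sqrt pi"
      using fs_speed_lift[OF \<gamma> l sD y'(1)] fubini_study_orthogonal[of z1 y'] z1(1) y'(2)
      by (simp add: ys real_sqrt_divide)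
    define h where "h = (\<lambda>t. hermitian (y t) z0)"
    \<comment> \<open>The default values agree: on the polar line of \<open>z0\<close> the
      coordinate is 0, so \<open>\<phi>\<close> is \<open>1 / 0 = 0\<close>, which is also the value
      of this quotient. Thus \<open>\<phi>\<close> is differentiable even where the curve might
      leave the chart.\<close>
    have \<phi>: "\<phi> t = Re (h t * cnj (h t)) / Re (hermitian (y t) (y t))" if "t \<in> D" for t
    proof -
      have "y t \<noteq> 0" "\<gamma> t = abs_cp2 (y t)" using that l by (auto simp: lift_on_def)
      then have "norm (affine_at z0 (\<gamma> t)) = norm (y t) / norm (h t)"
        by (simp add: affine_at_abs norm_vector_scale norm_divide h_def)
      then show ?thesis
        by (simp add: \<phi>_def hermitian_self complex_norm_square[symmetric] power_divide
            del: of_real_power)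
    qed
    have dh: "(h has_vector_derivative hermitian y' z0) (at s)"
      unfolding h_def by (rule bounded_linear.has_vector_derivative[OF bounded_linear_hermitian_left y'(1)])
    have dN: "((\<lambda>t. Re (h t * cnj (h t))) has_real_derivative
        2 * Re (hermitian y' z0 * cnj (h s))) (at s)"
    proof -
      have "((\<lambda>t. Re (h t * cnj (h t))) has_vector_derivative
          Re (h s * cnj (hermitian y' z0) + hermitian y' z0 * cnj (h s))) (at s)"
        by (intro bounded_linear.has_vector_derivative[OF bounded_linear_Re] has_vector_derivative_mult dh
            bounded_linear.has_vector_derivative[OF bounded_linear_cnj])
      then show ?thesis
        by (simp add: has_real_derivative_iff_has_vector_derivative algebra_simps)
    qed
    have dM: "((\<lambda>t. Re (hermitian (y t) (y t))) has_real_derivative 0) (at s)"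
    proof -
      have "((\<lambda>t. Re (\<Sum>i\<in>UNIV. y t $ i * cnj (y t $ i))) has_vector_derivative
          Re (\<Sum>i\<in>UNIV. y s $ i * cnj (y' $ i) + y' $ i * cnj (y s $ i))) (at s)"
        by (intro bounded_linear.has_vector_derivative[OF bounded_linear_Re] has_vector_derivative_mult y'(1)
            has_vector_derivative_sum bounded_linear.has_vector_derivative[OF bounded_linear_cnj]
            bounded_linear.has_vector_derivative[OF bounded_linear_vec_nth])
      moreover have "(\<Sum>i\<in>UNIV. y s $ i * cnj (y' $ i) + y' $ i * cnj (y s $ i)) = hermitian z1 y' + hermitian y' z1"
        by (simp add: hermitian_def sum.distrib ys)
      ultimately show ?thesis
        using y'(2) hermitian_commute[of z1 y']
        by (simp add: has_real_derivative_iff_has_vector_derivative hermitian_def[symmetric])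
    qed
    have M1: "Re (hermitian (y s) (y s)) = 1" using z1 by (simp add: ys hermitian_self)
    have "((\<lambda>t. Re (h t * cnj (h t)) / Re (hermitian (y t) (y t))) has_real_derivative
        2 * Re (hermitian y' z0 * cnj (h s))) (at s)"
      using DERIV_divide[OF dN dM] M1 by simp
    then have "(\<phi> has_vector_derivative 2 * Re (hermitian y' z0 * cnj (h s))) (at s)"
      unfolding has_real_derivative_iff_has_vector_derivative
      by (rule has_vector_derivative_transform_within_open[where S = D])
         (use l sD \<phi> in \<open>auto simp: lift_on_def\<close>)
    moreover have "norm (2 * Re (hermitian y' z0 * cnj (h s))) \<le> 4 * fs_speed \<gamma> s"
    proof -
      have "\<bar>Re (hermitian y' z0 * cnj (h s))\<bar> \<le> norm (hermitian y' z0 * cnj (h s))"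
        by (rule abs_Re_le_cmod)
      also have "\<dots> \<le> norm y' * 1"
        using norm_hermitian_le[of y' z0] norm_hermitian_le[of z1 z0] z0 z1
        by (simp add: norm_mult h_def ys) (metis mult_left_le norm_ge_zero order_trans mult_right_mono)
      also have "\<dots> = sqrt pi * fs_speed \<gamma> s" by (simp add: speed)
      also have "\<dots> \<le> 2 * fs_speed \<gamma> s"
        using spi fs_speed_nonneg by (intro mult_right_mono) auto
      finally show ?thesis by simp
    qed
    ultimately show ?thesis by blast
  qed
  then obtain \<phi>' where \<phi>': "\<And>s. (\<phi> has_vector_derivative \<phi>' s) (at s)" "\<And>s. norm (\<phi>' s) \<le> 4 * fs_speed \<gamma> s"
    by metis
  \<comment> \<open>The length bound \<open>1 / 9\<close> lets \<open>\<phi>\<close> drop from 1 by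
    at most \<open>4 / 9\<close>, which is less than \<open>1 / 2\<close>.\<close>
  have \<phi>_ge: "\<phi> s > 1 / 2" if "s \<in> {0..1}" for s
  proof -
    have "norm (\<phi> s - \<phi> 0) \<le> 4 * fs_length \<gamma>"
      unfolding fs_length_def
      by (rule norm_diff_le_integral[where f' = \<phi>'])
         (use \<phi>' that continuous_on_fs_speed[OF \<gamma>] fs_speed_nonneg in auto)
    moreover have "\<phi> 0 = 1" using z0 affine_at_self by (simp add: \<phi>_def)
    ultimately show ?thesis using short by (simp add: abs_if split: if_splits)
  qed
  have nz: "affine_at z0 (\<gamma> s) \<noteq> 0" if "s \<in> {0..1}" for s
    using \<phi>_ge[OF that] by (auto simp: \<phi>_def)
  then show "affine_at z0 (\<gamma> t) \<noteq> 0" using t by blast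
  define w where "w = (\<lambda>t. affine_at z0 (\<gamma> t))"
  have "\<exists>w'. (w has_vector_derivative w') (at s) \<and> norm w' \<le> 4 * fs_speed \<gamma> s" if s: "s \<in> {0..1}" for s
  proof -
    obtain w' where w': "(w has_vector_derivative w') (at s)" "hermitian w' z0 = 0"
      using lift_affine_derivative[OF \<gamma> nz[OF s]] unfolding w_def by blast
    define u where "u = w s - z0"
    have u: "hermitian u z0 = 0" "w s = z0 + u"
      using affine_at_nonzero(1)[OF nz[OF s]] z0 by (simp_all add: u_def w_def hermitian_diff_left hermitian_self)
    have "(norm (w s))\<^sup>2 < 2"
      using \<phi>_ge[OF s] nz[OF s] by (simp add: \<phi>_def w_def field_simps)
    then have u1: "1 + (norm u)\<^sup>2 \<le> 2"
      using norm_add_orthogonal[OF u(1)] z0 u(2) by simp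
    \<comment> \<open>The lower bound for \<open>\<phi>\<close> gives
      \<open>1 + (norm u)\<^sup>2 \<le> 2\<close>, so the chart distorts speed by at most 2;
      together with \<open>sqrt pi \<le> 2\<close> this yields the factor 4.\<close>
    have "norm w' / 2 / sqrt pi \<le> norm w' / (1 + (norm u)\<^sup>2) / sqrt pi"
      using u1 by (intro divide_right_mono divide_left_mono mult_pos_pos) (auto simp: add_pos_nonneg)
    also have "\<dots> = sqrt ((norm w' / (1 + (norm u)\<^sup>2))\<^sup>2 / pi)"
      by (simp add: real_sqrt_divide real_sqrt_abs abs_of_pos add_pos_nonneg)
    also have "\<dots> \<le> sqrt (fubini_study (w s) w' w')"
      unfolding u(2) by (intro real_sqrt_le_mono fubini_study_affine_ge z0 u w')
    also have "\<dots> = fs_speed \<gamma> s"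
      using fs_speed_lift[OF \<gamma> lift_affine_at[OF \<gamma>, of z0], of s w'] nz[OF s] w'(1) by (simp add: w_def)
    finally have "norm w' \<le> 2 * sqrt pi * fs_speed \<gamma> s" by (simp add: field_simps)
    also have "\<dots> \<le> 4 * fs_speed \<gamma> s"
      using spi fs_speed_nonneg by (intro mult_right_mono) auto
    finally show ?thesis using w'(1) by blast
  qed
  then obtain w' where w': "\<And>s. s \<in> {0..1} \<Longrightarrow> (w has_vector_derivative w' s) (at s)"
     "\<And>s. s \<in> {0..1} \<Longrightarrow> norm (w' s) \<le> 4 * fs_speed \<gamma> s"
    by metis
  have "norm (w t - w 0) \<le> 4 * fs_length \<gamma>"
    unfolding fs_length_def
    by (rule norm_diff_le_integral[where f' = w'])
       (use w' t continuous_on_fs_speed[OF \<gamma>] fs_speed_nonneg in auto)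
  then show "norm (affine_at z0 (\<gamma> t) - z0) \<le> 4 * fs_length \<gamma>"
    using z0 affine_at_self by (simp add: w_def)
qed

section \<open>The retraction onto the zero locus\<close>

text \<open>A Newton iteration with the slope frozen at \<open>b\<close>. The Lipschitz hypothesis
  makes it a contraction with factor \<open>1 / 2\<close>, and the bound of \<open>h 0\<close> makes
  the first step at most \<open>\<rho> / 2\<close>, so the disc is mapped into itself.\<close>

lemma contraction_root:
  fixes h :: "complex \<Rightarrow> complex"
  assumes "b \<noteq> 0" "\<rho> \<ge> 0"
    and lip: "\<And>\<sigma> \<tau>. norm \<sigma> \<le> \<rho> \<Longrightarrow> norm \<tau> \<le> \<rho> \<Longrightarrow> norm (h \<sigma> - h \<tau> - (\<sigma> - \<tau>) * b) \<le> norm b / 2 * norm (\<sigma> - \<tau>)"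
    and h0: "norm (h 0) \<le> norm b * \<rho> / 2"
  shows "\<exists>!\<sigma>. norm \<sigma> \<le> \<rho> \<and> h \<sigma> = 0"
proof -
  define T where "T = (\<lambda>\<sigma>. \<sigma> - h \<sigma> / b)"
  have TT: "norm (T \<sigma> - T \<tau>) \<le> 1 / 2 * norm (\<sigma> - \<tau>)" if "norm \<sigma> \<le> \<rho>" "norm \<tau> \<le> \<rho>" for \<sigma> \<tau>
  proof -
    have "T \<sigma> - T \<tau> = - (h \<sigma> - h \<tau> - (\<sigma> - \<tau>) * b) / b"
      using assms(1) by (simp add: T_def field_simps)
    then have "norm (T \<sigma> - T \<tau>) = norm (h \<sigma> - h \<tau> - (\<sigma> - \<tau>) * b) / norm b"
      by (simp only: norm_divide norm_minus_cancel)
    also have "\<dots> \<le> (norm b / 2 * norm (\<sigma> - \<tau>)) / norm b"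
      by (intro divide_right_mono lip that) auto
    finally show ?thesis using assms(1) by simp
  qed
  have "norm (T 0) \<le> \<rho> / 2"
  proof -
    have "norm (T 0) = norm (h 0) / norm b" by (simp add: T_def norm_divide)
    also have "\<dots> \<le> (norm b * \<rho> / 2) / norm b" by (intro divide_right_mono h0) auto
    finally show ?thesis using assms(1) by simp
  qed
  then have T: "norm (T \<sigma>) \<le> \<rho>" if "norm \<sigma> \<le> \<rho>" for \<sigma>
    using TT[OF that, of 0] norm_triangle_sub[of "T \<sigma>" "T 0"] that assms(2) by simp
  have "\<exists>!\<sigma>\<in>cball 0 \<rho>. T \<sigma> = \<sigma>"
  proof (rule Banach_fix[where c = "1/2"])
    show "dist (T x) (T y) \<le> 1 / 2 * dist x y" if "x \<in> cball 0 \<rho>" "y \<in> cball 0 \<rho>" for x y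
      using TT[of x y] that by (simp add: dist_norm)
  qed (use T assms(2) in \<open>auto intro!: compact_imp_complete\<close>)
  then show ?thesis
    using assms(1) by (simp add: T_def)
qed

text \<open>The hypotheses of the contraction principle for the restriction of \<open>f\<close> to the complex line
  through \<open>z\<close> in the tangent direction \<open>n\<close>.\<close>

definition admissible :: "nat \<Rightarrow> (nat \<times> nat \<times> nat \<Rightarrow> complex) \<Rightarrow> real \<Rightarrow> complex ^ 3 \<Rightarrow> complex ^ 3 \<Rightarrow> bool" where
  "admissible d a \<rho> z n \<longleftrightarrow> d \<ge> 1 \<and> norm z = 1 \<and> norm n = 1 \<and> hermitian n z = 0 \<and> 0 < \<rho> \<and> \<rho> \<le> chart_radius d \<and>
     hermitian n (grad d a z) \<noteq> 0 \<and> 2 * curvature_bound d a * \<rho> \<le> norm (hermitian n (grad d a z)) \<and>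
     norm (hom_poly d a z) \<le> norm (hermitian n (grad d a z)) * \<rho> / 2"

definition line_root :: "nat \<Rightarrow> (nat \<times> nat \<times> nat \<Rightarrow> complex) \<Rightarrow> real \<Rightarrow> complex ^ 3 \<Rightarrow> complex ^ 3 \<Rightarrow> complex" where
  "line_root d a \<rho> z n = (THE \<sigma>. norm \<sigma> \<le> \<rho> \<and> hom_poly d a (z + \<sigma> *s n) = 0)"

lemma admissible_lipschitz:
  assumes "admissible d a \<rho> z n" "norm \<sigma> \<le> \<rho>" "norm \<tau> \<le> \<rho>"
  shows "norm (hom_poly d a (z + \<sigma> *s n) - hom_poly d a (z + \<tau> *s n) - (\<sigma> - \<tau>) * hermitian n (grad d a z))
    \<le> norm (hermitian n (grad d a z)) / 2 * norm (\<sigma> - \<tau>)"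
proof -
  note A = assms(1)[unfolded admissible_def]
  have "norm (hom_poly d a (z + \<sigma> *s n) - hom_poly d a (z + \<tau> *s n) - hermitian (\<sigma> *s n - \<tau> *s n) (grad d a (z + 0)))
    \<le> curvature_bound d a * \<rho> * norm (\<sigma> *s n - \<tau> *s n)"
    using A assms by (intro taylor_tangential) (auto simp: hermitian_scale_left norm_vector_scale)
  also have "\<sigma> *s n - \<tau> *s n = (\<sigma> - \<tau>) *s n" by (rule vector_sub_rdistrib[symmetric])
  also have "curvature_bound d a * \<rho> * norm ((\<sigma> - \<tau>) *s n) \<le> norm (hermitian n (grad d a z)) / 2 * norm (\<sigma> - \<tau>)"
    unfolding norm_vector_scale using A by (intro mult_mono) auto
  finally show ?thesis by (simp add: hermitian_scale_left del: vector_sub_rdistrib)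
qed

lemma admissible_ex1:
  assumes "admissible d a \<rho> z n"
  shows "\<exists>!\<sigma>. norm \<sigma> \<le> \<rho> \<and> hom_poly d a (z + \<sigma> *s n) = 0"
proof (rule contraction_root[where b = "hermitian n (grad d a z)"])
  show "norm (hom_poly d a (z + \<sigma> *s n) - hom_poly d a (z + \<tau> *s n) - (\<sigma> - \<tau>) * hermitian n (grad d a z))
    \<le> norm (hermitian n (grad d a z)) / 2 * norm (\<sigma> - \<tau>)" if "norm \<sigma> \<le> \<rho>" "norm \<tau> \<le> \<rho>" for \<sigma> \<tau>
    by (rule admissible_lipschitz[OF assms that])
qed (use assms in \<open>auto simp: admissible_def\<close>)

lemma line_root:
  assumes "admissible d a \<rho> z n"
  shows "norm (line_root d a \<rho> z n) \<le> \<rho>" "hom_poly d a (z + line_root d a \<rho> z n *s n) = 0"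
  using theI'[OF admissible_ex1[OF assms]] by (auto simp: line_root_def)

lemma line_root_unique:
  assumes "admissible d a \<rho> z n" "norm \<sigma> \<le> \<rho>" "hom_poly d a (z + \<sigma> *s n) = 0"
  shows "line_root d a \<rho> z n = \<sigma>"
  unfolding line_root_def using the1_equality[OF admissible_ex1[OF assms(1)]] assms(2,3) by blast

text \<open>Over the disc the derivative along the line loses at most half of its size. In
  particular the line is transversal to the zero set at the root, as the implicit function argument
  requires.\<close>

lemma admissible_derivative:
  assumes "admissible d a \<rho> z n" "norm \<sigma> \<le> \<rho>"
  shows "norm (hermitian n (grad d a (z + \<sigma> *s n))) \<ge> norm (hermitian n (grad d a z)) / 2"
proof -
  note A = assms(1)[unfolded admissible_def]
  have "norm (hermitian n (grad d a (z + \<sigma> *s n)) - hermitian n (grad d a (z + 0)))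
    \<le> curvature_bound d a * norm n * norm (\<sigma> *s n - 0)"
    using A assms by (intro grad_tangential_lipschitz) (auto simp: hermitian_scale_left norm_vector_scale)
  also have "\<dots> \<le> curvature_bound d a * \<rho>"
    using A assms(2) curvature_bound_nonneg[of d a] by (simp add: norm_vector_scale mult_left_mono)
  also have "\<dots> \<le> norm (hermitian n (grad d a z)) / 2" using A by simp
  finally show ?thesis
    using norm_triangle_ineq2[of "hermitian n (grad d a z)" "hermitian n (grad d a (z + \<sigma> *s n))"]
    by (simp add: norm_minus_commute)
qed

text \<open>The root \<open>\<sigma>0\<close> at \<open>x0\<close> is an approximate root at nearby
  \<open>x\<close>, and the Lipschitz estimate bounds its distance from the exact one by twice the
  value there over the slope.\<close>

lemma continuous_on_line_root:
  fixes z n :: "'x :: topological_space \<Rightarrow> complex ^ 3"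
  assumes z: "continuous_on S z" and n: "continuous_on S n"
    and A: "\<And>x. x \<in> S \<Longrightarrow> admissible d a \<rho> (z x) (n x)"
  shows "continuous_on S (\<lambda>x. line_root d a \<rho> (z x) (n x))"
  unfolding continuous_on_def
proof
  fix x0 assume x0: "x0 \<in> S"
  define \<sigma>0 where "\<sigma>0 = line_root d a \<rho> (z x0) (n x0)"
  define h where "h = (\<lambda>x. hom_poly d a (z x + \<sigma>0 *s n x))"
  define b where "b = (\<lambda>x. hermitian (n x) (grad d a (z x)))"
  have hb: "continuous_on S h" "continuous_on S b"
    unfolding h_def b_def by (intro continuous_intros z n)+
  have b0: "b x0 \<noteq> 0" using A[OF x0] by (simp add: b_def admissible_def)
  have h0: "h x0 = 0" using line_root(2)[OF A[OF x0]] by (simp add: h_def \<sigma>0_def)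
  have "((\<lambda>x. 2 * norm (h x) / norm (b x)) \<longlongrightarrow> 2 * norm (h x0) / norm (b x0)) (at x0 within S)"
    using hb x0 b0 unfolding continuous_on_def by (intro tendsto_intros) auto
  then have lim: "((\<lambda>x. 2 * norm (h x) / norm (b x)) \<longlongrightarrow> 0) (at x0 within S)"
    by (simp add: h0)
  have bd: "norm (line_root d a \<rho> (z x) (n x) - \<sigma>0) \<le> 2 * norm (h x) / norm (b x)" if x: "x \<in> S" for x
  proof -
    define \<sigma> where "\<sigma> = line_root d a \<rho> (z x) (n x)"
    have "norm (0 - h x - (\<sigma> - \<sigma>0) * b x) \<le> norm (b x) / 2 * norm (\<sigma> - \<sigma>0)"
      using admissible_lipschitz[OF A[OF x] line_root(1)[OF A[OF x]] line_root(1)[OF A[OF x0]]] line_root(2)[OF A[OF x]]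
      by (simp add: \<sigma>_def \<sigma>0_def h_def b_def)
    moreover have "norm (\<sigma> - \<sigma>0) * norm (b x) \<le> norm (0 - h x - (\<sigma> - \<sigma>0) * b x) + norm (h x)"
      using norm_triangle_ineq[of "0 - h x - (\<sigma> - \<sigma>0) * b x" "h x"] by (simp add: norm_mult)
    ultimately have "norm (\<sigma> - \<sigma>0) * norm (b x) \<le> 2 * norm (h x)" by (simp add: mult.commute)
    moreover have "norm (b x) > 0" using A[OF x] by (simp add: b_def admissible_def)
    ultimately show ?thesis by (simp add: \<sigma>_def field_simps)
  qed
  have "((\<lambda>x. line_root d a \<rho> (z x) (n x) - \<sigma>0) \<longlongrightarrow> 0) (at x0 within S)"
  proof (rule Lim_null_comparison[OF _ lim])
    show "\<forall>\<^sub>F x in at x0 within S. norm (line_root d a \<rho> (z x) (n x) - \<sigma>0) \<le> 2 * norm (h x) / norm (b x)"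
      unfolding eventually_at_filter by (rule always_eventually) (use bd in auto)
  qed
  then show "((\<lambda>x. line_root d a \<rho> (z x) (n x)) \<longlongrightarrow> line_root d a \<rho> (z x0) (n x0)) (at x0 within S)"
    by (simp add: LIM_zero_iff \<sigma>0_def)
qed

text \<open>Changing the representative and the direction by phases leaves all conditions intact,
  and the point reached on the line changes by the phase of the representative alone. This makes the
  root a construction on the projective plane.\<close>

lemma line_root_phase:
  assumes A: "admissible d a \<rho> z n" and c: "norm c = 1" "norm c' = 1"
  shows "admissible d a \<rho> (c *s z) (c' *s n)"
    "line_root d a \<rho> (c *s z) (c' *s n) * c' = c * line_root d a \<rho> z n"
proof -
  have d: "d \<ge> 1" using A by (simp add: admissible_def)
  have c0: "c \<noteq> 0" "c' \<noteq> 0" using c by auto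
  have "hermitian (c' *s n) (grad d a (c *s z)) = c' * c ^ (d - 1) * hermitian n (grad d a z)"
    using grad_scale[OF c0(1) d] by (simp add: hermitian_scale_left hermitian_scale_right)
  then have b: "norm (hermitian (c' *s n) (grad d a (c *s z))) = norm (hermitian n (grad d a z))"
    using c by (simp add: norm_mult norm_power)
  then show A': "admissible d a \<rho> (c *s z) (c' *s n)"
    using A c b unfolding admissible_def
    by (auto simp: norm_vector_scale hermitian_scale_left hermitian_scale_right hom_poly_scale norm_mult norm_power)
  define \<sigma> where "\<sigma> = c * line_root d a \<rho> z n / c'"
  have eq: "c *s z + \<sigma> *s (c' *s n) = c *s (z + line_root d a \<rho> z n *s n)"
    using c0 by (simp add: \<sigma>_def vec_eq_iff algebra_simps)
  have r: "line_root d a \<rho> (c *s z) (c' *s n) = \<sigma>"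
  proof (rule line_root_unique[OF A'])
    show "norm \<sigma> \<le> \<rho>" using line_root(1)[OF A] c by (simp add: \<sigma>_def norm_mult norm_divide)
    show "hom_poly d a (c *s z + \<sigma> *s (c' *s n)) = 0"
      unfolding eq hom_poly_scale using line_root(2)[OF A] by simp
  qed
  show "line_root d a \<rho> (c *s z) (c' *s n) * c' = c * line_root d a \<rho> z n"
    unfolding r using c0 by (simp add: \<sigma>_def)
qed

section \<open>The gradient direction and the retraction\<close>

definition tangential_grad :: "nat \<Rightarrow> (nat \<times> nat \<times> nat \<Rightarrow> complex) \<Rightarrow> complex ^ 3 \<Rightarrow> complex ^ 3" where
  "tangential_grad d a z = grad d a z - hermitian (grad d a z) z *s z"

definition direction :: "nat \<Rightarrow> (nat \<times> nat \<times> nat \<Rightarrow> complex) \<Rightarrow> complex ^ 3 \<Rightarrow> complex ^ 3" where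
  "direction d a z = (1 / of_real (norm (tangential_grad d a z))) *s tangential_grad d a z"

text \<open>Normalising by \<open>sgn\<close> makes this a cone, the preimage of a set in the
  projective plane. The inequalities are those of \<open>admissible\<close> for the gradient
  direction, made strict so that the set is open.\<close>

definition near_zeros :: "nat \<Rightarrow> (nat \<times> nat \<times> nat \<Rightarrow> complex) \<Rightarrow> real \<Rightarrow> real \<Rightarrow> (complex ^ 3) set" where
  "near_zeros d a \<beta> \<rho> = {z. z \<noteq> 0 \<and> norm (tangential_grad d a (sgn z)) > \<beta> \<and>
     norm (hom_poly d a (sgn z)) < norm (tangential_grad d a (sgn z)) * \<rho> / 2}"

definition retract :: "nat \<Rightarrow> (nat \<times> nat \<times> nat \<Rightarrow> complex) \<Rightarrow> real \<Rightarrow> complex ^ 3 \<Rightarrow> complex ^ 3" where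
  "retract d a \<rho> z = sgn z + line_root d a \<rho> (sgn z) (direction d a (sgn z)) *s direction d a (sgn z)"

lemma tangential_grad_orthogonal: "norm z = 1 \<Longrightarrow> hermitian (tangential_grad d a z) z = 0"
  by (simp add: tangential_grad_def hermitian_diff_left hermitian_scale_left hermitian_self)

lemma hermitian_tangential_grad:
  assumes "norm z = 1"
  shows "hermitian (tangential_grad d a z) (grad d a z) = of_real ((norm (tangential_grad d a z))\<^sup>2)"
proof -
  have "grad d a z = tangential_grad d a z + hermitian (grad d a z) z *s z"
    by (simp add: tangential_grad_def)
  then have "hermitian (tangential_grad d a z) (grad d a z) = hermitian (tangential_grad d a z) (tangential_grad d a z)
    + cnj (hermitian (grad d a z) z) * hermitian (tangential_grad d a z) z"
    by (metis hermitian_add_right hermitian_scale_right)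
  then show ?thesis by (simp add: tangential_grad_orthogonal[OF assms] hermitian_self)
qed

lemma direction:
  assumes "norm z = 1" "tangential_grad d a z \<noteq> 0"
  shows "norm (direction d a z) = 1" "hermitian (direction d a z) z = 0"
    "hermitian (direction d a z) (grad d a z) = of_real (norm (tangential_grad d a z))"
  using assms
  by (simp_all add: direction_def norm_vector_scale norm_divide hermitian_scale_left
      tangential_grad_orthogonal hermitian_tangential_grad power2_eq_square)

lemma tangential_grad_phase:
  assumes "norm z = 1" "norm c = 1" "d \<ge> 1"
  shows "tangential_grad d a (c *s z) = cnj c ^ (d - 1) *s tangential_grad d a z"
proof -
  have c0: "c \<noteq> 0" using assms by auto
  have "cnj c * c = 1" using assms(2) complex_norm_square[of c] by (simp add: mult.commute)
  then show ?thesis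
    unfolding tangential_grad_def grad_scale[OF c0 assms(3)]
    by (simp add: hermitian_scale_left hermitian_scale_right)
qed

lemma norm_sgn_vec: "z \<noteq> 0 \<Longrightarrow> norm (sgn (z :: complex ^ 3)) = 1"
  by (simp add: norm_sgn)

lemma sgn_eq_scale: "sgn (z :: complex ^ 3) = (1 / of_real (norm z)) *s z"
  by (simp add: sgn_div_norm vec_eq_iff scaleR_conv_of_real[where 'a = complex] divide_inverse)

lemma sgn_unit: "norm z = 1 \<Longrightarrow> sgn (z :: complex ^ 3) = z"
  by (simp add: sgn_div_norm)

lemma sgn_scale: "c \<noteq> 0 \<Longrightarrow> sgn (c *s (z :: complex ^ 3)) = (c / of_real (norm c)) *s sgn z"
  by (simp add: sgn_eq_scale norm_vector_scale)

lemma abs_cp2_sgn: "z \<noteq> 0 \<Longrightarrow> abs_cp2 (sgn z) = abs_cp2 z"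
  by (simp add: sgn_eq_scale abs_cp2_scale)

lemma continuous_on_sgn_vec: "continuous_on (- {0}) (sgn :: complex ^ 3 \<Rightarrow> _)"
  unfolding sgn_div_norm by (intro continuous_intros) auto

lemma continuous_on_tangential_grad [continuous_intros]:
  "continuous_on S y \<Longrightarrow> continuous_on S (\<lambda>x. tangential_grad d a (y x))"
  unfolding tangential_grad_def by (intro continuous_intros)

lemma open_less_on:
  fixes f g :: "'x :: topological_space \<Rightarrow> real"
  assumes "open S" "continuous_on S f" "continuous_on S g"
  shows "open {x \<in> S. f x < g x}"
proof -
  have "continuous_on S (\<lambda>x. g x - f x)" by (intro continuous_intros assms)
  then have "open ((\<lambda>x. g x - f x) -` {0<..} \<inter> S)"
    using continuous_on_open_vimage[OF assms(1)] open_greaterThan by blast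
  moreover have "(\<lambda>x. g x - f x) -` {0<..} \<inter> S = {x \<in> S. f x < g x}" by auto
  ultimately show ?thesis by simp
qed

lemma near_zeros_nonzero: "z \<in> near_zeros d a \<beta> \<rho> \<Longrightarrow> z \<noteq> 0"
  by (simp add: near_zeros_def)

lemma open_near_zeros: "open (near_zeros d a \<beta> \<rho>)"
proof -
  have o: "open (- {0 :: complex ^ 3})" by (rule open_Compl) simp
  have "open {z \<in> - {0}. \<beta> < norm (tangential_grad d a (sgn z))}"
    "open {z \<in> - {0}. norm (hom_poly d a (sgn z)) < norm (tangential_grad d a (sgn z)) * \<rho> / 2}"
    by (intro open_less_on o continuous_intros continuous_on_sgn_vec; simp)+
  then have "open ({z \<in> - {0}. \<beta> < norm (tangential_grad d a (sgn z))} \<inter>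
    {z \<in> - {0}. norm (hom_poly d a (sgn z)) < norm (tangential_grad d a (sgn z)) * \<rho> / 2})"
    by (rule open_Int)
  also have "\<dots> = near_zeros d a \<beta> \<rho>" by (auto simp: near_zeros_def)
  finally show ?thesis .
qed

definition retraction_params :: "nat \<Rightarrow> (nat \<times> nat \<times> nat \<Rightarrow> complex) \<Rightarrow> real \<Rightarrow> real \<Rightarrow> bool" where
  "retraction_params d a \<beta> \<rho> \<longleftrightarrow> d \<ge> 1 \<and> \<beta> > 0 \<and> 0 < \<rho> \<and> \<rho> \<le> chart_radius d \<and> 2 * curvature_bound d a * \<rho> \<le> \<beta>"

lemma near_zeros_admissible:
  assumes "retraction_params d a \<beta> \<rho>" "z \<in> near_zeros d a \<beta> \<rho>"
  shows "admissible d a \<rho> (sgn z) (direction d a (sgn z))"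
proof -
  have z: "norm (sgn z) = 1" "tangential_grad d a (sgn z) \<noteq> 0"
    using assms by (auto simp: near_zeros_def retraction_params_def norm_sgn)
  show ?thesis
    using assms direction[OF z] z unfolding admissible_def near_zeros_def retraction_params_def by auto
qed

lemma continuous_on_retract:
  assumes "retraction_params d a \<beta> \<rho>"
  shows "continuous_on (near_zeros d a \<beta> \<rho>) (retract d a \<rho>)"
proof -
  have s: "continuous_on (near_zeros d a \<beta> \<rho>) sgn"
    by (rule continuous_on_subset[OF continuous_on_sgn_vec]) (auto dest: near_zeros_nonzero)
  have "norm (tangential_grad d a (sgn z)) \<noteq> 0" if "z \<in> near_zeros d a \<beta> \<rho>" for z
    using that assms by (auto simp: near_zeros_def retraction_params_def)
  then have n: "continuous_on (near_zeros d a \<beta> \<rho>) (\<lambda>z. direction d a (sgn z))"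
    unfolding direction_def by (intro continuous_intros s) auto
  show ?thesis
    unfolding retract_def
    by (intro continuous_on_add continuous_on_vector_scale continuous_on_line_root s n near_zeros_admissible[OF assms])
qed

text \<open>The component along \<open>sgn z\<close> is always 1, which excludes the value 0; at a
  zero, 0 is a root on the line, and uniqueness makes the retraction fix the point.\<close>

lemma retract:
  assumes "retraction_params d a \<beta> \<rho>" "z \<in> near_zeros d a \<beta> \<rho>"
  shows "hom_poly d a (retract d a \<rho> z) = 0" "retract d a \<rho> z \<noteq> 0"
    "hom_poly d a z = 0 \<Longrightarrow> retract d a \<rho> z = sgn z"
proof -
  note A = near_zeros_admissible[OF assms]
  show "hom_poly d a (retract d a \<rho> z) = 0"
    unfolding retract_def by (rule line_root(2)[OF A])
  have "hermitian (retract d a \<rho> z) (sgn z) = 1"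
    using A by (simp add: retract_def admissible_def hermitian_add_left hermitian_scale_left hermitian_self)
  then show "retract d a \<rho> z \<noteq> 0" by auto
  assume "hom_poly d a z = 0"
  then have "hom_poly d a (sgn z + 0 *s direction d a (sgn z)) = 0"
    by (simp add: sgn_eq_scale[of z] hom_poly_scale)
  then have "line_root d a \<rho> (sgn z) (direction d a (sgn z)) = 0"
    using A by (intro line_root_unique) (auto simp: admissible_def)
  then show "retract d a \<rho> z = sgn z" by (simp add: retract_def)
qed

lemma near_zeros_scale:
  assumes "d \<ge> 1" "c \<noteq> 0" "z \<in> near_zeros d a \<beta> \<rho>"
  shows "c *s z \<in> near_zeros d a \<beta> \<rho>"
proof -
  define e where "e = c / of_real (norm c)"
  have e: "norm e = 1" "sgn (c *s z) = e *s sgn z"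
    using assms(2) by (simp_all add: e_def norm_divide sgn_scale)
  have "norm (sgn z) = 1" using assms(3) by (simp add: norm_sgn near_zeros_def)
  then have "norm (tangential_grad d a (sgn (c *s z))) = norm (tangential_grad d a (sgn z))"
    unfolding e(2) using e(1) assms(1) by (simp add: tangential_grad_phase norm_vector_scale norm_power)
  moreover have "norm (hom_poly d a (sgn (c *s z))) = norm (hom_poly d a (sgn z))"
    unfolding e(2) using e(1) by (simp add: hom_poly_scale norm_mult norm_power)
  ultimately show ?thesis using assms(2,3) by (simp add: near_zeros_def)
qed

lemma retract_scale:
  assumes P: "retraction_params d a \<beta> \<rho>" and "c \<noteq> 0" and z: "z \<in> near_zeros d a \<beta> \<rho>"
  shows "abs_cp2 (retract d a \<rho> (c *s z)) = abs_cp2 (retract d a \<rho> z)"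
proof -
  define e where "e = c / of_real (norm c)"
  have e: "norm e = 1" "sgn (c *s z) = e *s sgn z"
    using assms(2) by (simp_all add: e_def norm_divide sgn_scale)
  have d: "d \<ge> 1" using P by (simp add: retraction_params_def)
  have u: "norm (sgn z) = 1" using z by (simp add: norm_sgn near_zeros_def)
  have "direction d a (sgn (c *s z)) = cnj e ^ (d - 1) *s direction d a (sgn z)"
    unfolding e(2) direction_def tangential_grad_phase[OF u e(1) d]
    using e(1) by (simp add: norm_vector_scale norm_power)
  moreover have "norm (cnj e ^ (d - 1)) = 1" using e(1) by (simp add: norm_power)
  ultimately have "retract d a \<rho> (c *s z) = e *s retract d a \<rho> z"
    unfolding retract_def e(2) using line_root_phase(2)[OF near_zeros_admissible[OF P z] e(1)] by simp
  moreover have "e \<noteq> 0" using e(1) by auto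
  ultimately show ?thesis using retract(2)[OF P z] by (simp add: abs_cp2_scale)
qed

text \<open>An open cone is saturated for the projection, so its image is open and the quotient
  topology restricts well to it.\<close>

lemma continuous_on_cp2_image:
  fixes f :: "cp2 \<Rightarrow> 'b :: topological_space"
  assumes D: "open D" "\<And>z. z \<in> D \<Longrightarrow> z \<noteq> 0" "\<And>c z. c \<noteq> 0 \<Longrightarrow> z \<in> D \<Longrightarrow> c *s z \<in> D"
    and f: "continuous_on D (\<lambda>z. f (abs_cp2 z))"
  shows "continuous_on (abs_cp2 ` D) f"
proof -
  have mem: "abs_cp2 z \<in> abs_cp2 ` D \<longleftrightarrow> z \<in> D" if "z \<noteq> 0" for z
  proof
    assume "abs_cp2 z \<in> abs_cp2 ` D"
    then obtain w where "w \<in> D" "abs_cp2 w = abs_cp2 z" by auto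
    with abs_cp2_eq_iff[of w z] D(2,3) that show "z \<in> D" by blast
  qed auto
  have "{z. z \<noteq> 0 \<and> abs_cp2 z \<in> abs_cp2 ` D} = D" using mem D(2) by blast
  then have o: "open (abs_cp2 ` D)" using D(1) by (simp add: open_cp2_def)
  show ?thesis
  proof (subst continuous_on_open_vimage[OF o], intro allI impI)
    fix B :: "'b set" assume "open B"
    have "{z. z \<noteq> 0 \<and> abs_cp2 z \<in> f -` B \<inter> abs_cp2 ` D} = (\<lambda>z. f (abs_cp2 z)) -` B \<inter> D"
      using mem D(2) by blast
    then show "open (f -` B \<inter> abs_cp2 ` D)"
      using f[unfolded continuous_on_open_vimage[OF D(1)]] \<open>open B\<close> by (simp add: open_cp2_def)
  qed
qed

lemma zero_locus_abs: "z \<noteq> 0 \<Longrightarrow> abs_cp2 z \<in> zero_locus (hom_poly d a) \<longleftrightarrow> hom_poly d a z = 0"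
proof
  assume z: "z \<noteq> 0" "abs_cp2 z \<in> zero_locus (hom_poly d a)"
  then obtain w where w: "w \<noteq> 0" "hom_poly d a w = 0" "abs_cp2 w = abs_cp2 z"
    by (auto simp: zero_locus_def)
  then show "hom_poly d a z = 0"
    using abs_cp2_eq_iff[OF w(1) z(1)] by (auto simp: hom_poly_scale)
qed (auto simp: zero_locus_def)

lemma retraction_exists:
  assumes P: "retraction_params d a \<beta> \<rho>"
  obtains R where "continuous_on (abs_cp2 ` near_zeros d a \<beta> \<rho>) R"
    "\<And>z. z \<in> near_zeros d a \<beta> \<rho> \<Longrightarrow> R (abs_cp2 z) \<in> zero_locus (hom_poly d a)"
    "\<And>z. z \<in> near_zeros d a \<beta> \<rho> \<Longrightarrow> hom_poly d a z = 0 \<Longrightarrow> R (abs_cp2 z) = abs_cp2 z"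
proof -
  let ?D = "near_zeros d a \<beta> \<rho>"
  define R where "R = (\<lambda>p. abs_cp2 (retract d a \<rho> (SOME z. z \<in> ?D \<and> p = abs_cp2 z)))"
  have d: "d \<ge> 1" using P by (simp add: retraction_params_def)
  have R: "R (abs_cp2 z) = abs_cp2 (retract d a \<rho> z)" if z: "z \<in> ?D" for z
  proof -
    define w where "w = (SOME w. w \<in> ?D \<and> abs_cp2 z = abs_cp2 w)"
    have "w \<in> ?D \<and> abs_cp2 z = abs_cp2 w"
      unfolding w_def by (rule someI[of _ z]) (use z in auto)
    then obtain c where "c \<noteq> 0" "w = c *s z"
      using abs_cp2_eq_iff near_zeros_nonzero z by blast
    then show ?thesis using retract_scale[OF P _ z] by (simp add: R_def w_def[symmetric])
  qed
  show thesis
  proof (rule that)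
    have "continuous_on ?D (\<lambda>z. abs_cp2 (retract d a \<rho> z))"
      by (intro continuous_on_abs_cp2 continuous_on_retract P retract(2)[OF P])
    then have "continuous_on ?D (\<lambda>z. R (abs_cp2 z))"
      by (rule continuous_on_eq) (simp add: R)
    then show "continuous_on (abs_cp2 ` ?D) R"
      by (intro continuous_on_cp2_image open_near_zeros near_zeros_scale[OF d] near_zeros_nonzero)
    show "R (abs_cp2 z) \<in> zero_locus (hom_poly d a)" if "z \<in> ?D" for z
      using retract(1,2)[OF P that] by (simp add: R[OF that] zero_locus_abs)
    show "R (abs_cp2 z) = abs_cp2 z" if "z \<in> ?D" "hom_poly d a z = 0" for z
      using retract(3)[OF P that] near_zeros_nonzero[OF that(1)] by (simp add: R[OF that(1)] abs_cp2_sgn)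
  qed
qed

text \<open>Let \<open>g0\<close> be the gradient norm at \<open>z0\<close>. Normalising
  \<open>z0 + u\<close> divides by powers of its norm that are at most 2, leaving a gradient of at
  least \<open>15 / 32 * g0\<close>. The bound \<open>1 / (16 * d)\<close> makes the radial part,
  \<open>d * |f|\<close> by Euler, at most \<open>g0 / 8\<close>, so the tangential part is at least
  \<open>11 / 32 * g0\<close>, which exceeds \<open>\<beta>\<close> because
  \<open>g0 \<ge> 4 * \<beta>\<close>. The bound \<open>\<rho> / 12\<close> gives
  \<open>|f| \<le> \<rho> / 6 * g0\<close>, just below the required
  \<open>11 / 64 * \<rho> * g0\<close>.\<close>

lemma near_zeros_tangent_ball:
  assumes P: "retraction_params d a \<beta> \<rho>"
    and z0: "norm z0 = 1" "hom_poly d a z0 = 0" "norm (grad d a z0) \<ge> 4 * \<beta>"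
    and u: "hermitian u z0 = 0" "norm u \<le> \<rho> / 12" "norm u \<le> 1 / (16 * real d)"
  shows "z0 + u \<in> near_zeros d a \<beta> \<rho>"
proof -
  note P' = P[unfolded retraction_params_def]
  have d: "d \<ge> 1" using P' by simp
  define M where "M = curvature_bound d a"
  define g0 where "g0 = norm (grad d a z0)"
  define \<nu> where "\<nu> = norm (z0 + u)"
  have g0: "g0 \<ge> 4 * \<beta>" "g0 > 0" using z0(3) P' by (auto simp: g0_def)
  have M: "M \<ge> 0" unfolding M_def by (rule curvature_bound_nonneg)
  have ur: "norm u \<le> chart_radius d" using u(2) P' by linarith
  have Mu: "M * norm u \<le> g0 / 16"
  proof -
    have "M * norm u \<le> M * (\<rho> / 12)" using u(2) M by (intro mult_left_mono) auto
    also have "\<dots> \<le> \<beta> / 24" using P' by (simp add: M_def mult_ac)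
    finally show ?thesis using g0 by linarith
  qed
  have \<nu>2: "\<nu>\<^sup>2 = 1 + (norm u)\<^sup>2"
    using norm_add_orthogonal[OF u(1)] z0(1) by (simp add: \<nu>_def)
  then have \<nu>1: "\<nu> \<ge> 1"
    by (metis \<nu>_def abs_norm_cancel le_add_same_cancel1 one_power2 power2_le_iff_abs_le zero_le_power2
        abs_le_square_iff abs_one)
  have \<nu>d: "\<nu> ^ d \<le> 2"
    unfolding \<nu>_def using z0 u ur d chart_radius_pos[OF d] by (intro tangential_bound(2)) auto
  define zh where "zh = sgn (z0 + u)"
  have nz: "z0 + u \<noteq> 0" using \<nu>1 by (auto simp: \<nu>_def)
  have "norm zh = 1" unfolding zh_def using nz by (rule norm_sgn_vec)
  then have zh: "zh = (1 / of_real \<nu>) *s (z0 + u)" "norm zh = 1"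
    by (simp_all only: zh_def sgn_eq_scale[of "z0 + u"] \<nu>_def)
  have n0: "hermitian (grad d a z0) z0 = 0"
    using euler[of z0 d a] z0(2) hermitian_commute[of "grad d a z0" z0] by simp
  have f: "norm (hom_poly d a zh) \<le> 2 * norm u * g0"
  proof -
    have "norm (hom_poly d a (z0 + u) - hom_poly d a (z0 + 0) - hermitian (u - 0) (grad d a (z0 + 0)))
      \<le> M * norm u * norm (u - 0)"
      unfolding M_def using z0 u ur d chart_radius_pos[OF d] by (intro taylor_tangential) auto
    then have "norm (hom_poly d a (z0 + u)) \<le> norm (hermitian u (grad d a z0)) + M * norm u * norm u"
      using z0(2) norm_triangle_sub[of "hom_poly d a (z0 + u)" "hermitian u (grad d a z0)"] by simp
    also have "\<dots> \<le> norm u * g0 + g0 * norm u"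
      using norm_hermitian_le[of u "grad d a z0"] Mu g0(2)
      by (intro add_mono mult_right_mono) (simp_all add: g0_def[symmetric])
    finally have 1: "norm (hom_poly d a (z0 + u)) \<le> 2 * norm u * g0" by (simp add: mult_ac)
    have "norm (hom_poly d a zh) = norm (hom_poly d a (z0 + u)) / \<nu> ^ d"
      using \<nu>1 unfolding zh(1) hom_poly_scale by (simp add: norm_mult norm_power norm_divide power_divide)
    also have "\<dots> \<le> norm (hom_poly d a (z0 + u)) / 1"
      using \<nu>1 by (intro divide_left_mono) auto
    finally show ?thesis using 1 by simp
  qed
  have g: "norm (grad d a zh) \<ge> 15 / 32 * g0"
  proof -
    \<comment> \<open>Testing with the normalised gradient at \<open>z0\<close> bounds the gradient
      at \<open>z0 + u\<close> from below. The vector \<open>n\<close> is tangent because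
      \<open>z0\<close> is a zero, so the tangential Lipschitz estimate applies.\<close>
    define n where "n = (1 / of_real g0) *s grad d a z0"
    have n: "norm n = 1" "hermitian n z0 = 0" "hermitian n (grad d a z0) = of_real g0"
      using g0 n0 by (simp_all add: n_def norm_vector_scale norm_divide g0_def[symmetric] hermitian_scale_left
          hermitian_self power2_eq_square)
    have "norm (hermitian n (grad d a (z0 + u)) - hermitian n (grad d a (z0 + 0))) \<le> M * norm n * norm (u - 0)"
      unfolding M_def using z0 u ur d chart_radius_pos[OF d] n by (intro grad_tangential_lipschitz) auto
    then have "norm (hermitian n (grad d a (z0 + u))) \<ge> g0 - g0 / 16"
      using Mu n g0 norm_triangle_ineq2[of "hermitian n (grad d a z0)" "hermitian n (grad d a (z0 + u))"]
      by (simp add: norm_minus_commute)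
    then have 1: "norm (grad d a (z0 + u)) \<ge> 15 / 16 * g0"
      using norm_hermitian_le[of n "grad d a (z0 + u)"] n(1) by simp
    have "norm (grad d a zh) = norm (grad d a (z0 + u)) / \<nu> ^ (d - 1)"
      using \<nu>1 d unfolding zh(1) by (subst grad_scale) (auto simp: norm_vector_scale norm_power norm_divide power_divide)
    moreover have "\<nu> ^ (d - 1) \<le> 2"
      using power_increasing[of "d - 1" d \<nu>] \<nu>1 \<nu>d by linarith
    moreover have "norm (grad d a (z0 + u)) / 2 \<le> norm (grad d a (z0 + u)) / \<nu> ^ (d - 1)"
      using calculation(2) \<nu>1 by (intro divide_left_mono) auto
    ultimately show ?thesis using 1 by linarith
  qed
  have "norm (hermitian (grad d a zh) zh *s zh) = real d * norm (hom_poly d a zh)"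
    using zh(2) euler[of zh d a] hermitian_commute[of "grad d a zh" zh] by (simp add: norm_vector_scale norm_mult)
  also have "\<dots> \<le> real d * (2 * norm u * g0)" using f by (intro mult_left_mono) auto
  also have "\<dots> \<le> g0 / 8"
    using u(3) d g0 mult_right_mono[of "norm u * (16 * real d)" 1 g0] by (simp add: field_simps)
  finally have t: "norm (tangential_grad d a zh) \<ge> 11 / 32 * g0"
    using g norm_triangle_ineq2[of "grad d a zh" "hermitian (grad d a zh) zh *s zh"]
    by (simp add: tangential_grad_def)
  have "norm (hom_poly d a zh) < norm (tangential_grad d a zh) * \<rho> / 2"
  proof -
    have "norm (hom_poly d a zh) \<le> \<rho> / 6 * g0"
    proof -
      have "norm u * g0 \<le> \<rho> / 12 * g0" using u(2) g0(2) by (intro mult_right_mono) auto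
      then show ?thesis using f by linarith
    qed
    also have "\<dots> < (11 / 32 * g0) * \<rho> / 2" using P' g0 by simp
    also have "\<dots> \<le> norm (tangential_grad d a zh) * \<rho> / 2"
      using t P' by (intro divide_right_mono mult_right_mono) auto
    finally show ?thesis .
  qed
  moreover have "norm (tangential_grad d a zh) > \<beta>" using t g0 P' by linarith
  ultimately show ?thesis using nz by (simp add: near_zeros_def zh_def)
qed

lemma short_loop_contractible:
  assumes P: "retraction_params d a \<beta> \<rho>"
    and reg: "\<And>z. norm z = 1 \<Longrightarrow> hom_poly d a z = 0 \<Longrightarrow> norm (grad d a z) \<ge> 4 * \<beta>"
    and \<gamma>: "smooth_closed_curve \<gamma>" "range \<gamma> \<subseteq> zero_locus (hom_poly d a)"
    and short: "4 * fs_length \<gamma> \<le> \<rho> / 12" "4 * fs_length \<gamma> \<le> 1 / (16 * real d)"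
  shows "contractible_loop (zero_locus (hom_poly d a)) \<gamma>"
proof -
  let ?Z = "zero_locus (hom_poly d a)"
  obtain R where R: "continuous_on (abs_cp2 ` near_zeros d a \<beta> \<rho>) R"
    "\<And>z. z \<in> near_zeros d a \<beta> \<rho> \<Longrightarrow> R (abs_cp2 z) \<in> ?Z"
    "\<And>z. z \<in> near_zeros d a \<beta> \<rho> \<Longrightarrow> hom_poly d a z = 0 \<Longrightarrow> R (abs_cp2 z) = abs_cp2 z"
    using retraction_exists[OF P] by blast
  have d: "d \<ge> 1" using P by (simp add: retraction_params_def)
  obtain z0 where z0: "norm z0 = 1" "\<gamma> 0 = abs_cp2 z0" by (rule cp2_unit_rep)
  have z0nz: "z0 \<noteq> 0" using z0 by auto
  have zero: "hom_poly d a z0 = 0"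
    using \<gamma>(2) z0 zero_locus_abs[OF z0nz, of d a] by (metis rangeI subsetD)
  have sm: "smooth_curve \<gamma>" and per: "\<gamma> 1 = \<gamma> 0"
    using \<gamma>(1) unfolding smooth_closed_curve_def by (auto dest: spec[of _ 0])
  define w where "w = (\<lambda>t. affine_at z0 (\<gamma> t))"
  have len: "fs_length \<gamma> \<le> 1 / 9"
  proof -
    have "1 / (16 * real d) \<le> 1 / 16" using d by simp
    then show ?thesis using short(2) by linarith
  qed
  have w: "w t \<noteq> 0" "norm (w t - z0) \<le> 4 * fs_length \<gamma>" if "t \<in> {0..1}" for t
    unfolding w_def by (intro short_curve_affine[OF sm z0 len that])+
  have wp: "hermitian (w t - z0) z0 = 0" "abs_cp2 (w t) = \<gamma> t" if "t \<in> {0..1}" for t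
    using affine_at_nonzero[of z0 "\<gamma> t"] w(1)[OF that] z0
    by (simp_all add: w_def hermitian_diff_left hermitian_self)
  have cw: "continuous_on {0..1} w"
  proof -
    have "continuous_on {t. affine_at z0 (\<gamma> t) \<noteq> 0} w"
      using lift_affine_at[OF sm, of z0] unfolding w_def lift_on_def by (blast intro: C_infinity_on_continuous)
    then show ?thesis by (rule continuous_on_subset) (use w(1) in \<open>auto simp: w_def\<close>)
  qed
  \<comment> \<open>The parameter \<open>s\<close> shrinks the loop to \<open>z0\<close> inside the
    plane tangent at \<open>z0\<close>, where membership in \<open>near_zeros\<close> depends only
    on the distance to \<open>z0\<close>.\<close>
  define H where "H = (\<lambda>(s, t). z0 + (1 - s) *\<^sub>R (w t - z0))"
  have H: "H x \<in> near_zeros d a \<beta> \<rho>" if "x \<in> {0..1} \<times> {0..1}" for x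
  proof -
    obtain s t where x: "x = (s, t)" "s \<in> {0..1}" "t \<in> {0..1}" using \<open>x \<in> _\<close> by auto
    have "norm ((1 - s) *\<^sub>R (w t - z0)) \<le> 1 * norm (w t - z0)"
      unfolding norm_scaleR using x by (intro mult_right_mono) auto
    then show ?thesis
      unfolding H_def x(1) prod.case using w(2)[OF x(3)] wp(1)[OF x(3)] short
      by (intro near_zeros_tangent_ball[OF P z0(1) zero reg[OF z0(1) zero]]) (auto simp: hermitian_scaleR_left)
  qed
  have cH: "continuous_on ({0..1} \<times> {0..1}) H"
    unfolding H_def case_prod_unfold
    by (intro continuous_intros continuous_on_compose2[OF cw]) auto
  have "continuous_on ({0..1} \<times> {0..1}) (\<lambda>x. R (abs_cp2 (H x)))"
    using H near_zeros_nonzero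
    by (intro continuous_on_compose2[OF R(1)] continuous_on_abs_cp2 cH) blast+
  moreover have "H (0, t) = w t" "H (1, t) = z0" for t by (simp_all add: H_def)
  moreover have "R (abs_cp2 (w t)) = \<gamma> t" if t: "t \<in> {0..1}" for t
  proof -
    have near: "w t \<in> near_zeros d a \<beta> \<rho>" using H[of "(0, t)"] t by (simp add: H_def)
    have "hom_poly d a (w t) = 0"
      using \<gamma>(2) zero_locus_abs[OF w(1)[OF t], of d a] wp(2)[OF t] by (metis rangeI subsetD)
    then show ?thesis using R(3)[of "w t"] wp(2)[OF t] near by simp
  qed
  moreover have "R (abs_cp2 z0) = \<gamma> 0" using R(3)[of z0] H[of "(1, 0)"] zero z0 by (simp add: H_def)
  moreover have "w 1 = w 0" by (simp add: w_def per)
  ultimately have "homotopic_loops ?Z \<gamma> (\<lambda>_. \<gamma> 0)"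
    unfolding homotopic_loops
    by (intro exI[of _ "\<lambda>x. R (abs_cp2 (H x))"])
       (use R(2) H in \<open>auto simp: pathfinish_def pathstart_def H_def\<close>)
  moreover have "\<gamma> 0 \<in> ?Z" using \<gamma>(2) by auto
  ultimately show ?thesis unfolding contractible_loop_def by blast
qed

section \<open>Perturbation of the polynomial\<close>

lemma zero_tangential_grad:
  assumes "hom_poly d a z = 0"
  shows "hermitian (grad d a z) z = 0" "tangential_grad d a z = grad d a z"
proof -
  show "hermitian (grad d a z) z = 0"
    using euler[of z d a] assms hermitian_commute[of "grad d a z" z] by simp
  then show "tangential_grad d a z = grad d a z" by (simp add: tangential_grad_def)
qed

text \<open>The zero locus of \<open>a0\<close> is pushed onto the zero locus of the nearby polynomial \<open>a\<close> along the gradient of \<open>a0\<close>.\<close>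

locale perturbation =
  fixes d :: nat and a0 a :: "nat \<times> nat \<times> nat \<Rightarrow> complex" and \<rho> :: real
  assumes d: "d \<ge> 1"
    and grad_nonzero: "\<And>z. norm z = 1 \<Longrightarrow> hom_poly d a0 z = 0 \<Longrightarrow> grad d a0 z \<noteq> 0"
    and adm: "\<And>z. norm z = 1 \<Longrightarrow> hom_poly d a0 z = 0 \<Longrightarrow> admissible d a \<rho> z (direction d a0 z)"
begin

definition shift :: "complex ^ 3 \<Rightarrow> complex" where
  "shift z = line_root d a \<rho> (sgn z) (direction d a0 (sgn z))"

text \<open>The factor \<open>\<tau>\<close> interpolates between the identity and the move onto the
  new zero locus; the intermediate values supply the homotopy used to compare the two loops.\<close>

definition push :: "real \<Rightarrow> complex ^ 3 \<Rightarrow> complex ^ 3" where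
  "push \<tau> z = sgn z + (of_real \<tau> * shift z) *s direction d a0 (sgn z)"

definition push_cp2 :: "real \<Rightarrow> cp2 \<Rightarrow> cp2" where
  "push_cp2 \<tau> p = abs_cp2 (push \<tau> (SOME z. z \<noteq> 0 \<and> p = abs_cp2 z))"

lemma zero_sgn:
  assumes "z \<noteq> 0" "hom_poly d a0 z = 0"
  shows "norm (sgn z) = 1" "hom_poly d a0 (sgn z) = 0"
  using assms by (simp_all add: norm_sgn_vec) (simp add: sgn_eq_scale hom_poly_scale)

lemma zero_admissible: "z \<noteq> 0 \<Longrightarrow> hom_poly d a0 z = 0 \<Longrightarrow> admissible d a \<rho> (sgn z) (direction d a0 (sgn z))"
  using adm zero_sgn by blast

lemma push_nonzero:
  assumes "z \<noteq> 0" "hom_poly d a0 z = 0"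
  shows "push \<tau> z \<noteq> 0"
proof -
  have "hermitian (push \<tau> z) (sgn z) = 1"
    using zero_admissible[OF assms] by (simp add: push_def admissible_def hermitian_add_left hermitian_scale_left hermitian_self)
  then show ?thesis by auto
qed

lemma push_zero: "z \<noteq> 0 \<Longrightarrow> hom_poly d a0 z = 0 \<Longrightarrow> hom_poly d a (push 1 z) = 0"
  using line_root(2)[OF zero_admissible] by (simp add: push_def shift_def)

lemma push_scale:
  assumes "c \<noteq> 0" "z \<noteq> 0" "hom_poly d a0 z = 0"
  shows "abs_cp2 (push \<tau> (c *s z)) = abs_cp2 (push \<tau> z)"
proof -
  define e where "e = c / of_real (norm c)"
  have e: "norm e = 1" "sgn (c *s z) = e *s sgn z"
    using assms(1) by (simp_all add: e_def norm_divide sgn_scale)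
  have u: "norm (sgn z) = 1" using assms(2) by (rule norm_sgn_vec)
  have dir: "direction d a0 (e *s sgn z) = cnj e ^ (d - 1) *s direction d a0 (sgn z)"
    unfolding direction_def tangential_grad_phase[OF u e(1) d]
    using e(1) by (simp add: norm_vector_scale norm_power)
  have n: "norm (cnj e ^ (d - 1)) = 1" using e(1) by (simp add: norm_power)
  have r: "shift (c *s z) * cnj e ^ (d - 1) = e * shift z"
    unfolding shift_def e(2) dir by (rule line_root_phase(2)[OF zero_admissible[OF assms(2,3)] e(1) n])
  have "push \<tau> (c *s z) = e *s sgn z + (of_real \<tau> * (shift (c *s z) * cnj e ^ (d - 1))) *s direction d a0 (sgn z)"
    unfolding push_def e(2) dir by (simp add: mult.assoc)
  also have "\<dots> = e *s push \<tau> z"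
    unfolding r by (simp add: push_def mult_ac)
  finally have "push \<tau> (c *s z) = e *s push \<tau> z" .
  moreover have "e \<noteq> 0" using e(1) by auto
  ultimately show ?thesis using push_nonzero[OF assms(2,3)] by (simp add: abs_cp2_scale)
qed

lemma push_cp2_abs:
  assumes "z \<noteq> 0" "hom_poly d a0 z = 0"
  shows "push_cp2 \<tau> (abs_cp2 z) = abs_cp2 (push \<tau> z)"
proof -
  define w where "w = (SOME w. w \<noteq> 0 \<and> abs_cp2 z = abs_cp2 w)"
  have "w \<noteq> 0 \<and> abs_cp2 z = abs_cp2 w"
    unfolding w_def by (rule someI[of _ z]) (use assms in auto)
  then obtain c where "c \<noteq> 0" "w = c *s z" using abs_cp2_eq_iff assms by blast
  then show ?thesis using push_scale[OF _ assms] by (simp add: push_cp2_def w_def[symmetric])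
qed

lemma zero_locus_rep:
  assumes "p \<in> zero_locus (hom_poly d a0)"
  obtains z where "z \<noteq> 0" "hom_poly d a0 z = 0" "p = abs_cp2 z"
  using assms by (auto simp: zero_locus_def)

lemma push_cp2_endpoints:
  assumes "p \<in> zero_locus (hom_poly d a0)"
  shows "push_cp2 1 p \<in> zero_locus (hom_poly d a)" "push_cp2 0 p = p"
proof -
  obtain z where z: "z \<noteq> 0" "hom_poly d a0 z = 0" "p = abs_cp2 z" using zero_locus_rep[OF assms] .
  show "push_cp2 1 p \<in> zero_locus (hom_poly d a)"
    using push_zero[OF z(1,2)] push_nonzero[OF z(1,2)] by (simp add: z(3) push_cp2_abs[OF z(1,2)] zero_locus_abs)
  show "push_cp2 0 p = p"
    using z(1) by (simp add: z(3) push_cp2_abs[OF z(1,2)] push_def abs_cp2_sgn)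
qed

lemma lift_zero:
  assumes "lift_on \<gamma> y T" "range \<gamma> \<subseteq> zero_locus (hom_poly d a0)" "t \<in> T"
  shows "y t \<noteq> 0" "hom_poly d a0 (y t) = 0" "\<gamma> t = abs_cp2 (y t)"
proof -
  show *: "y t \<noteq> 0" "\<gamma> t = abs_cp2 (y t)" using assms by (auto simp: lift_on_def)
  have "\<gamma> t \<in> zero_locus (hom_poly d a0)" using assms(2) by blast
  then show "hom_poly d a0 (y t) = 0" using * zero_locus_abs by simp
qed

lemma continuous_on_shift:
  assumes y: "continuous_on S y" "\<And>x. x \<in> S \<Longrightarrow> y x \<noteq> 0 \<and> hom_poly d a0 (y x) = 0"
  shows "continuous_on S (\<lambda>x. sgn (y x))" "continuous_on S (\<lambda>x. direction d a0 (sgn (y x)))"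
    "continuous_on S (\<lambda>x. shift (y x))"
proof -
  show s: "continuous_on S (\<lambda>x. sgn (y x))"
    by (rule continuous_on_compose2[OF continuous_on_sgn_vec y(1)]) (use y(2) in auto)
  have "tangential_grad d a0 (sgn (y x)) \<noteq> 0" if "x \<in> S" for x
    using y(2)[OF that] zero_sgn grad_nonzero by (simp add: zero_tangential_grad)
  then show n: "continuous_on S (\<lambda>x. direction d a0 (sgn (y x)))"
    unfolding direction_def by (intro continuous_on_vector_scale continuous_intros s) auto
  show "continuous_on S (\<lambda>x. shift (y x))"
    unfolding shift_def using y(2) by (intro continuous_on_line_root s n zero_admissible) auto
qed

text \<open>\<open>Y\<close> is \<open>push 1\<close> rescaled by \<open>norm (y t)\<close>, moved
  along the unnormalised gradient. The smoothness of \<open>s\<close> is not read off from its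
  formula, which contains norms and a root, but from the equation
  \<open>hom_poly d a (Y t) = 0\<close> by \<open>implicit_smooth\<close>.\<close>

lemma lift_push:
  assumes l: "lift_on \<gamma> y T" and \<gamma>: "range \<gamma> \<subseteq> zero_locus (hom_poly d a0)"
  defines "s \<equiv> \<lambda>t. of_real (norm (y t)) * shift (y t) / of_real (norm (grad d a0 (y t)))"
  defines "Y \<equiv> \<lambda>t. y t + s t *s grad d a0 (y t)"
  shows "C_infinity_on s T" "lift_on (\<lambda>t. push_cp2 1 (\<gamma> t)) Y T"
    "\<And>t. t \<in> T \<Longrightarrow> hom_poly d a (Y t) = 0"
    "\<And>t. t \<in> T \<Longrightarrow> hermitian (grad d a0 (y t)) (grad d a (Y t)) \<noteq> 0"
proof -
  note z = lift_zero[OF l \<gamma>]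
  have T: "open T" "C_infinity_on y T" using l by (auto simp: lift_on_def)
  have cy: "continuous_on T y" by (rule C_infinity_on_continuous[OF T(2)])
  have gnz: "grad d a0 (y t) \<noteq> 0" if "t \<in> T" for t
  proof -
    have "grad d a0 (sgn (y t)) \<noteq> 0" using grad_nonzero zero_sgn z(1,2)[OF that] by blast
    then show ?thesis
      unfolding sgn_eq_scale using z(1)[OF that] d by (auto simp: grad_scale)
  qed
  have dir: "direction d a0 (sgn (y t)) = (1 / of_real (norm (grad d a0 (y t)))) *s grad d a0 (y t)" if "t \<in> T" for t
  proof -
    have r: "norm (y t) > 0" using z(1)[OF that] by simp
    then have "grad d a0 (sgn (y t)) = (of_real ((1 / norm (y t)) ^ (d - 1))) *s grad d a0 (y t)"
      unfolding sgn_eq_scale using d by (subst grad_scale) auto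
    then show ?thesis
      using r zero_sgn[OF z(1,2)[OF that]]
      by (simp add: direction_def zero_tangential_grad norm_vector_scale norm_power norm_divide power_divide)
  qed
  have eq: "push 1 (y t) = (1 / of_real (norm (y t))) *s Y t" if "t \<in> T" for t
    using z(1)[OF that] unfolding push_def dir[OF that] Y_def s_def unfolding sgn_eq_scale by simp
  show Y0: "hom_poly d a (Y t) = 0" if "t \<in> T" for t
    using push_zero[OF z(1,2)[OF that]] z(1)[OF that] by (simp add: eq[OF that] hom_poly_scale)
  show D: "hermitian (grad d a0 (y t)) (grad d a (Y t)) \<noteq> 0" if "t \<in> T" for t
  proof -
    note A = zero_admissible[OF z(1,2)[OF that]]
    have r: "norm (y t) > 0" using z(1)[OF that] by simp
    have "hermitian (direction d a0 (sgn (y t))) (grad d a (push 1 (y t))) \<noteq> 0"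
      using admissible_derivative[OF A line_root(1)[OF A]] A
      by (auto simp: push_def shift_def admissible_def)
    moreover have "grad d a (push 1 (y t)) = cnj (1 / of_real (norm (y t))) ^ (d - 1) *s grad d a (Y t)"
      unfolding eq[OF that] using r d by (intro grad_scale) auto
    ultimately show ?thesis
      unfolding dir[OF that] by (auto simp: hermitian_scale_left hermitian_scale_right)
  qed
  have "continuous_on T (\<lambda>t. shift (y t))"
    by (rule continuous_on_shift(3)[OF cy]) (use z in auto)
  then have cs: "continuous_on T s"
    unfolding s_def using gnz by (intro continuous_intros cy) auto
  show s: "C_infinity_on s T"
    by (rule implicit_smooth[OF T C_infinity_on_grad[OF T(2)] cs])
       (use Y0 D in \<open>simp_all add: Y_def\<close>)
  have "C_infinity_on Y T"
  proof (rule C_infinity_on_vecI)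
    fix i
    show "C_infinity_on (\<lambda>t. Y t $ i) T"
      unfolding Y_def vector_add_component vector_smult_component
      by (intro C_infinity_on_add C_infinity_on_mult C_infinity_on_nth T(2) s C_infinity_on_grad)
  qed
  moreover have "Y t \<noteq> 0 \<and> push_cp2 1 (\<gamma> t) = abs_cp2 (Y t)" if "t \<in> T" for t
  proof -
    have "Y t \<noteq> 0" using push_nonzero[OF z(1,2)[OF that], of 1] by (auto simp: eq[OF that])
    then show ?thesis
      using z(1)[OF that] by (simp add: z(3)[OF that] push_cp2_abs[OF z(1,2)[OF that]] eq[OF that] abs_cp2_scale)
  qed
  ultimately show "lift_on (\<lambda>t. push_cp2 1 (\<gamma> t)) Y T"
    using T(1) by (simp add: lift_on_def)
qed

lemma smooth_curve_push:
  assumes "smooth_curve \<gamma>" "range \<gamma> \<subseteq> zero_locus (hom_poly d a0)"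
  shows "smooth_curve (\<lambda>t. push_cp2 1 (\<gamma> t))"
proof (rule smooth_curveI_lift)
  fix t
  obtain T y where "t \<in> T" "lift_on \<gamma> y T" using smooth_curve_lift[OF assms(1)] by blast
  then show "\<exists>T y. t \<in> T \<and> lift_on (\<lambda>t. push_cp2 1 (\<gamma> t)) y T"
    using lift_push(2)[OF _ assms(2)] by blast
qed

lemma continuous_on_push:
  assumes \<gamma>: "smooth_curve \<gamma>" "range \<gamma> \<subseteq> zero_locus (hom_poly d a0)"
  shows "continuous_on S (\<lambda>x. push_cp2 (fst x) (\<gamma> (snd x)))"
proof -
  let ?f = "\<lambda>x. push_cp2 (fst x) (\<gamma> (snd x))"
  have "isCont ?f x" for x
  proof -
    obtain T y where Ty: "snd x \<in> T" "lift_on \<gamma> y T" using smooth_curve_lift[OF \<gamma>(1)] by blast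
    note z = lift_zero[OF Ty(2) \<gamma>(2)]
    have T: "open T" "C_infinity_on y T" using Ty by (auto simp: lift_on_def)
    have "continuous_on (UNIV \<times> T) (\<lambda>x :: real \<times> real. y (snd x))"
      by (rule continuous_on_compose2[OF C_infinity_on_continuous[OF T(2)]]) (auto intro: continuous_intros)
    note c = continuous_on_shift[OF this]
    have "continuous_on (UNIV \<times> T) (\<lambda>x. push (fst x) (y (snd x)))"
      unfolding push_def
      by (intro continuous_on_add continuous_on_vector_scale continuous_on_mult continuous_on_of_real continuous_on_fst c)
         (use z in \<open>auto intro: continuous_intros\<close>)
    then have "continuous_on (UNIV \<times> T) (\<lambda>x. abs_cp2 (push (fst x) (y (snd x))))"
      by (rule continuous_on_abs_cp2) (use push_nonzero z in auto)
    then have "continuous_on (UNIV \<times> T) ?f"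
      by (rule continuous_on_eq) (use push_cp2_abs z in auto)
    moreover have "open ((UNIV :: real set) \<times> T)" "x \<in> UNIV \<times> T"
      using T(1) Ty(1) by (auto intro: open_Times simp: mem_Times_iff)
    ultimately show ?thesis using continuous_on_eq_continuous_at by blast
  qed
  then show ?thesis by (simp add: continuous_at_imp_continuous_on)
qed

text \<open>The velocity changes by \<open>s' v + s v'\<close>. The term \<open>s v'\<close> is
  small because the shift is at most \<open>\<rho>\<close>. In \<open>s'\<close> the leading term
  disappears because the velocity is tangent to the zero locus of \<open>a0\<close>, so only the
  difference of the gradients and \<open>s v'\<close> contribute. The ratio of the speeds is thus
  close to 1 for small \<open>E\<close> and \<open>\<rho>\<close>.\<close>

lemma push_speed:
  assumes \<gamma>: "smooth_curve \<gamma>" "range \<gamma> \<subseteq> zero_locus (hom_poly d a0)"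
    and \<rho>: "\<rho> \<le> 1"
    and \<delta>: "\<delta> > 0" "\<And>z. norm z = 1 \<Longrightarrow> hom_poly d a0 z = 0 \<Longrightarrow> norm (grad d a0 z) \<ge> \<delta>"
      "\<And>z. norm z = 1 \<Longrightarrow> hom_poly d a0 z = 0 \<Longrightarrow> norm (hermitian (direction d a0 z) (grad d a z)) \<ge> \<delta> / 2"
    and L: "sup_bound d a0 * 4 ^ d \<le> L" "sup_bound d a * 4 ^ d \<le> L"
    and E: "sup_bound d (\<lambda>\<alpha>. a \<alpha> - a0 \<alpha>) * 4 ^ d \<le> E"
  shows "fs_speed (\<lambda>t. push_cp2 1 (\<gamma> t)) t \<le>
    (1 + (4 / \<delta> * (E + L * \<rho> + L\<^sup>2 * \<rho> / \<delta>) + \<rho> * L / \<delta>)) * fs_speed \<gamma> t"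
proof -
  obtain z0 where z0: "norm z0 = 1" "\<gamma> t = abs_cp2 z0" by (rule cp2_unit_rep)
  define y where "y = (\<lambda>t. affine_at z0 (\<gamma> t))"
  define T where "T = {t. affine_at z0 (\<gamma> t) \<noteq> 0}"
  have l: "lift_on \<gamma> y T" unfolding y_def T_def by (rule lift_affine_at[OF \<gamma>(1)])
  have yt: "y t = z0" using affine_at_self z0 by (simp add: y_def)
  have z0nz: "z0 \<noteq> 0" using z0 by auto
  have tT: "t \<in> T" using yt z0nz by (simp add: T_def y_def)
  have f0: "hom_poly d a0 z0 = 0" using lift_zero(2)[OF l \<gamma>(2) tT] yt by simp
  obtain y' where y': "(y has_vector_derivative y') (at t)" "hermitian y' z0 = 0"
    using lift_affine_derivative[OF \<gamma>(1), of z0 t] tT unfolding y_def T_def by blast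
  have T: "open T" "C_infinity_on y T" using l by (auto simp: lift_on_def)
  define v where "v = (\<lambda>t. grad d a0 (y t))"
  obtain v' where v': "(v has_vector_derivative v') (at t)"
    using C_infinity_on_derivative[OF C_infinity_on_grad[OF T(2)]] tT unfolding v_def by blast
  define s where "s = (\<lambda>t. of_real (norm (y t)) * shift (y t) / of_real (norm (grad d a0 (y t))))"
  define Y where "Y = (\<lambda>t. y t + s t *s v t)"
  have lp: "C_infinity_on s T" "lift_on (\<lambda>t. push_cp2 1 (\<gamma> t)) Y T"
    unfolding Y_def s_def v_def by (rule lift_push(1,2)[OF l \<gamma>(2)])+
  have lp34: "hom_poly d a (y t + s t *s v t) = 0" "hermitian (v t) (grad d a (y t + s t *s v t)) \<noteq> 0"
    if "t \<in> T" for t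
    using lift_push(3,4)[OF l \<gamma>(2) that] by (simp_all add: s_def v_def)
  have Ly: "L \<ge> 0" using L(1) sup_bound_nonneg[of d a0] by (meson mult_nonneg_nonneg order_trans zero_le_numeral zero_le_power)
  have E0: "E \<ge> 0" using E sup_bound_nonneg[of d "\<lambda>\<alpha>. a \<alpha> - a0 \<alpha>"]
    by (meson mult_nonneg_nonneg order_trans zero_le_numeral zero_le_power)
  have \<rho>0: "\<rho> > 0" using adm[OF z0(1) f0] by (simp add: admissible_def)
  define g0 where "g0 = norm (grad d a0 z0)"
  have g0: "g0 \<ge> \<delta>" "g0 > 0" using \<delta>(2)[OF z0(1) f0] \<delta>(1) by (auto simp: g0_def)
  define n where "n = direction d a0 z0"
  have n: "norm n = 1" "hermitian n z0 = 0" "v t = of_real g0 *s n"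
    using adm[OF z0(1) f0] g0 unfolding n_def admissible_def
    by (auto simp: v_def yt direction_def zero_tangential_grad[OF f0] g0_def)
  define \<sigma> where "\<sigma> = shift z0"
  have \<sigma>: "norm \<sigma> \<le> \<rho>"
    using line_root(1)[OF adm[OF z0(1) f0]] sgn_unit[OF z0(1)] by (simp add: \<sigma>_def shift_def)
  have st: "s t = \<sigma> / of_real g0" using z0 by (simp add: s_def yt \<sigma>_def g0_def)
  have Yt: "Y t = z0 + \<sigma> *s n" using g0 by (simp add: Y_def yt st n(3))
  have Yz: "norm (Y t - z0) \<le> \<rho>" using \<sigma> n(1) by (simp add: Yt norm_vector_scale)
  have Y2: "norm (Y t) \<le> 2" using norm_triangle_sub[of "Y t" z0] Yz z0 \<rho> by simp
  have Y1: "norm (Y t) \<ge> 1"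
  proof -
    have "(norm (Y t))\<^sup>2 = 1 + (norm (\<sigma> *s n))\<^sup>2"
      unfolding Yt using norm_add_orthogonal[of "\<sigma> *s n" z0] n z0 by (simp add: hermitian_scale_left)
    then have "1\<^sup>2 \<le> (norm (Y t))\<^sup>2" by simp
    then show ?thesis by (rule power2_le_imp_le) simp
  qed
  define A where "A = norm y'"
  \<comment> \<open>The Lipschitz bound of the gradient passes to the derivative through difference
    quotients, which avoids a formula for second derivatives.\<close>
  have v'le: "norm v' \<le> L * A"
  proof -
    have "((\<lambda>r. norm ((v r - v t) /\<^sub>R (r - t))) \<longlongrightarrow> norm v') (at t)"
      by (intro tendsto_norm has_vector_derivative_quotientD v')
    moreover have "((\<lambda>r. L * norm ((y r - y t) /\<^sub>R (r - t))) \<longlongrightarrow> L * A) (at t)"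
      unfolding A_def by (intro tendsto_mult tendsto_const tendsto_norm has_vector_derivative_quotientD y')
    moreover have "\<forall>\<^sub>F r in at t. norm ((v r - v t) /\<^sub>R (r - t)) \<le> L * norm ((y r - y t) /\<^sub>R (r - t))"
    proof -
      have "(y \<longlongrightarrow> z0) (at t)"
        using has_vector_derivative_continuous[OF y'(1)] by (simp add: isCont_def yt)
      then have "\<forall>\<^sub>F r in at t. norm (y r) < 2"
        using order_tendstoD(2)[OF tendsto_norm, of y z0 "at t" 2] z0 by simp
      then show ?thesis
      proof eventually_elim
        case (elim r)
        have "norm (v r - v t) \<le> sup_bound d a0 * 4 ^ d * norm (y r - y t)"
          unfolding v_def using elim z0 by (intro grad_lipschitz) (auto simp: yt)
        also have "\<dots> \<le> L * norm (y r - y t)" using L by (intro mult_right_mono) auto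
        finally show ?case
          unfolding norm_scaleR mult.left_commute[of L] by (intro mult_left_mono) auto
      qed
    qed
    ultimately show ?thesis by (intro tendsto_le[OF trivial_limit_at]) auto
  qed
  \<comment> \<open>The polynomial \<open>a0\<close> vanishes identically along the lifted curve, so
    the derivative of the composition is 0.\<close>
  have tan: "hermitian y' (grad d a0 z0) = 0"
  proof -
    have "((hom_poly d a0 \<circ> y) has_derivative ((\<lambda>v. hermitian v (grad d a0 (y t))) \<circ> (\<lambda>h. h *\<^sub>R y'))) (at t)"
      using y'(1) unfolding has_vector_derivative_def
      by (intro diff_chain_at) (auto intro: hom_poly_has_derivative)
    then have "((hom_poly d a0 \<circ> y) has_vector_derivative hermitian y' (grad d a0 z0)) (at t)"
      by (simp add: has_vector_derivative_def o_def hermitian_scaleR_left yt scaleR_conv_of_real[where 'a = complex])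
    moreover have "((hom_poly d a0 \<circ> y) has_vector_derivative 0) (at t)"
      by (rule has_vector_derivative_transform_within_open[OF has_vector_derivative_const[of 0] T(1) tT])
         (simp add: lift_zero(2)[OF l \<gamma>(2)])
    ultimately show ?thesis by (rule vector_derivative_unique_at)
  qed
  define G where "G = grad d a (Y t)"
  have G: "norm G \<le> L" unfolding G_def using norm_grad_le[OF Y2, of d a] L(2) by linarith
  have Gd: "norm (G - grad d a0 z0) \<le> E + L * \<rho>"
  proof -
    have "G - grad d a0 z0 = grad d (\<lambda>\<alpha>. a \<alpha> - a0 \<alpha>) (Y t) + (grad d a0 (Y t) - grad d a0 z0)"
      by (simp add: G_def grad_diff)
    then have "norm (G - grad d a0 z0) \<le> norm (grad d (\<lambda>\<alpha>. a \<alpha> - a0 \<alpha>) (Y t)) + norm (grad d a0 (Y t) - grad d a0 z0)"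
      by (metis norm_triangle_ineq)
    also have "norm (grad d (\<lambda>\<alpha>. a \<alpha> - a0 \<alpha>) (Y t)) \<le> E"
      using norm_grad_le[OF Y2, of d "\<lambda>\<alpha>. a \<alpha> - a0 \<alpha>"] E by linarith
    also have "norm (grad d a0 (Y t) - grad d a0 z0) \<le> L * \<rho>"
    proof -
      have "norm (grad d a0 (Y t) - grad d a0 z0) \<le> sup_bound d a0 * 4 ^ d * norm (Y t - z0)"
        using Y2 z0 by (intro grad_lipschitz) auto
      also have "\<dots> \<le> L * \<rho>" using L(1) Yz Ly by (intro mult_mono) auto
      finally show ?thesis .
    qed
    finally show ?thesis by simp
  qed
  have den: "norm (hermitian (v t) G) \<ge> g0 * (\<delta> / 4)"
  proof -
    have "norm (hermitian n G) \<ge> \<delta> / 4"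
      using admissible_derivative[OF adm[OF z0(1) f0] \<sigma>] \<delta>(3)[OF z0(1) f0] by (simp add: n_def G_def Yt)
    then show ?thesis using g0 by (simp add: n(3) hermitian_scale_left norm_mult)
  qed
  define s' where "s' = - hermitian (y' + s t *s v') G / hermitian (v t) G"
  have s': "(s has_vector_derivative s') (at t)"
  proof -
    have "isCont s t" using C_infinity_on_continuous[OF lp(1)] T(1) tT by (simp add: continuous_on_eq_continuous_at)
    then show ?thesis
      unfolding s'_def G_def Y_def
      by (rule implicit_derivative[OF T(1) tT y'(1) v' _ lp34(1) lp34(2)[OF tT]])
  qed
  have A0: "A \<ge> 0" by (simp add: A_def)
  have stn: "norm (s t) \<le> \<rho> / \<delta>"
  proof -
    have "norm (s t) = norm \<sigma> / g0" using g0 by (simp add: st norm_divide)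
    also have "\<dots> \<le> \<rho> / \<delta>" using \<sigma> g0 \<delta>(1) \<rho>0 by (intro frac_le) auto
    finally show ?thesis .
  qed
  have sv': "norm (s t *s v') \<le> \<rho> * L / \<delta> * A"
  proof -
    have "norm (s t *s v') \<le> (\<rho> / \<delta>) * (L * A)"
      unfolding norm_vector_scale using stn v'le \<rho>0 \<delta>(1) by (intro mult_mono) auto
    then show ?thesis by simp
  qed
  have num: "norm (hermitian (y' + s t *s v') G) \<le> (E + L * \<rho> + L\<^sup>2 * \<rho> / \<delta>) * A"
  proof -
    have "hermitian (y' + s t *s v') G = hermitian y' (G - grad d a0 z0) + hermitian (s t *s v') G"
      by (simp add: hermitian_add_left hermitian_diff_right tan)
    then have "norm (hermitian (y' + s t *s v') G) \<le> norm (hermitian y' (G - grad d a0 z0)) + norm (hermitian (s t *s v') G)"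
      by (simp only: norm_triangle_ineq)
    also have "\<dots> \<le> A * (E + L * \<rho>) + (\<rho> * L / \<delta> * A) * L"
      using norm_hermitian_le[of y' "G - grad d a0 z0"] norm_hermitian_le[of "s t *s v'" G]
        mult_left_mono[OF Gd A0] mult_mono[OF sv' G _ norm_ge_zero] \<rho>0 \<delta>(1) Ly A0
      by (intro add_mono) (auto simp: A_def intro: order.trans)
    finally show ?thesis by (simp add: algebra_simps power2_eq_square)
  qed
  have s'v: "norm (s' *s v t) \<le> 4 / \<delta> * (E + L * \<rho> + L\<^sup>2 * \<rho> / \<delta>) * A"
  proof -
    have "norm s' \<le> ((E + L * \<rho> + L\<^sup>2 * \<rho> / \<delta>) * A) / (g0 * (\<delta> / 4))"
      unfolding s'_def norm_divide norm_minus_cancel using num den g0 \<delta>(1) by (intro frac_le) (auto intro: order.trans[OF norm_ge_zero])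
    then have "norm s' * g0 \<le> ((E + L * \<rho> + L\<^sup>2 * \<rho> / \<delta>) * A) / (g0 * (\<delta> / 4)) * g0"
      using g0 by (intro mult_right_mono) auto
    also have "\<dots> = 4 / \<delta> * (E + L * \<rho> + L\<^sup>2 * \<rho> / \<delta>) * A"
    proof -
      have "q / (g0 * (\<delta> / 4)) * g0 = 4 / \<delta> * q" for q using g0(2) by simp
      then show ?thesis by (simp only: mult.assoc)
    qed
    finally show ?thesis using g0 by (simp add: norm_vector_scale norm_mult n)
  qed
  define Y' where "Y' = y' + (s' *s v t + s t *s v')"
  have dY: "(Y has_vector_derivative Y') (at t)"
    unfolding Y_def Y'_def by (intro has_vector_derivative_add y' has_vector_derivative_scale s' v')
  have Y'le: "norm Y' \<le> (1 + (4 / \<delta> * (E + L * \<rho> + L\<^sup>2 * \<rho> / \<delta>) + \<rho> * L / \<delta>)) * A"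
  proof -
    have "norm Y' \<le> norm y' + (norm (s' *s v t) + norm (s t *s v'))"
      unfolding Y'_def by (intro order.trans[OF norm_triangle_ineq] add_left_mono norm_triangle_ineq)
    also have "\<dots> \<le> A + (4 / \<delta> * (E + L * \<rho> + L\<^sup>2 * \<rho> / \<delta>) * A + \<rho> * L / \<delta> * A)"
      using s'v sv' by (intro add_mono) (auto simp: A_def)
    finally show ?thesis by (simp add: distrib_right)
  qed
  have "fs_speed (\<lambda>t. push_cp2 1 (\<gamma> t)) t = sqrt (fubini_study (Y t) Y' Y')"
    by (rule fs_speed_lift[OF smooth_curve_push[OF \<gamma>] lp(2) tT dY])
  also have "\<dots> \<le> sqrt ((norm Y' / norm (Y t))\<^sup>2 / pi)"
    using Y1 by (intro real_sqrt_le_mono fubini_study_le) auto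
  also have "\<dots> = norm Y' / norm (Y t) / sqrt pi" by (simp add: real_sqrt_divide)
  also have "\<dots> \<le> norm Y' / 1 / sqrt pi" using Y1 by (intro divide_right_mono divide_left_mono) auto
  also have "\<dots> \<le> (1 + (4 / \<delta> * (E + L * \<rho> + L\<^sup>2 * \<rho> / \<delta>) + \<rho> * L / \<delta>)) * (A / sqrt pi)"
    using Y'le by (simp add: divide_right_mono)
  also have "A / sqrt pi = fs_speed \<gamma> t"
    using fs_speed_lift[OF \<gamma>(1) l tT y'(1)] fubini_study_orthogonal[of z0 y'] z0(1) y'(2)
    by (simp add: yt A_def real_sqrt_divide)
  finally show ?thesis .
qed

end

section \<open>Upper semicontinuity of the systole at a regular polynomial\<close>

lemma compact_positive_bound:
  fixes g :: "'a :: topological_space \<Rightarrow> real"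
  assumes "compact K" "continuous_on K g" "\<And>x. x \<in> K \<Longrightarrow> g x > 0"
  shows "\<exists>m>0. \<forall>x\<in>K. g x \<ge> m"
proof (cases "K = {}")
  case True
  then show ?thesis by (intro exI[of _ 1]) auto
next
  case False
  then obtain x where "x \<in> K" "\<forall>y\<in>K. g x \<le> g y"
    using continuous_attains_inf[OF assms(1) _ assms(2)] by blast
  then show ?thesis using assms(3) by (intro exI[of _ "g x"]) auto
qed

lemma regular_grad_bound:
  assumes "\<And>z. norm z = 1 \<Longrightarrow> hom_poly d a z = 0 \<Longrightarrow> grad d a z \<noteq> 0"
  obtains \<delta> where "\<delta> > 0" "\<And>z. norm z = 1 \<Longrightarrow> hom_poly d a z = 0 \<Longrightarrow> norm (grad d a z) \<ge> \<delta>"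
proof -
  let ?K = "{z \<in> sphere 0 1. hom_poly d a z = 0}"
  have "closed ?K"
    by (rule continuous_closed_preimage_constant) (auto intro: continuous_intros)
  then have 1: "compact ?K"
    using compact_Int_closed[OF compact_sphere, of ?K 0 1] by (simp add: Int_def conj_commute conj_left_commute cong: conj_cong)
  have 2: "continuous_on ?K (\<lambda>z. norm (grad d a z))" by (intro continuous_intros)
  have 3: "norm (grad d a z) > 0" if "z \<in> ?K" for z using assms that by auto
  obtain m where "m > 0" "\<And>z. z \<in> ?K \<Longrightarrow> norm (grad d a z) \<ge> m"
    using compact_positive_bound[OF 1 2 3] by blast
  then show thesis using that[of m] by auto
qed

lemma systole_persists:
  assumes d: "d \<ge> 1" and a0: "cnorm (exponents d) a0 = 1"
    and reg: "\<And>z. norm z = 1 \<Longrightarrow> hom_poly d a0 z = 0 \<Longrightarrow> grad d a0 z \<noteq> 0"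
    and sys: "systole (zero_locus (hom_poly d a0)) < ereal c"
  obtains r where "r > 0"
    "\<And>a. cnorm (exponents d) a = 1 \<Longrightarrow> cnorm (exponents d) (\<lambda>\<alpha>. a \<alpha> - a0 \<alpha>) < r \<Longrightarrow>
       systole (zero_locus (hom_poly d a)) < ereal c"
proof -
  let ?base = "zero_locus (hom_poly d a0)"
  obtain \<gamma> where \<gamma>: "smooth_closed_curve \<gamma>" "range \<gamma> \<subseteq> ?base" "\<not> contractible_loop ?base \<gamma>" "fs_length \<gamma> < c"
    using sys unfolding systole_def Inf_less_iff by auto
  have sm: "smooth_curve \<gamma>" using \<gamma>(1) by (simp add: smooth_closed_curve_def)
  obtain \<delta> where \<delta>: "\<delta> > 0" "\<And>z. norm z = 1 \<Longrightarrow> hom_poly d a0 z = 0 \<Longrightarrow> norm (grad d a0 z) \<ge> \<delta>"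
    using regular_grad_bound[OF reg] by blast
  define M where "M = curvature_bound d a0"
  define L where "L = sqrt (kernel_const d) * 4 ^ d"
  define \<beta> where "\<beta> = \<delta> / 4"
  have L: "L > 0" using kernel_const_pos[of d] by (simp add: L_def)
  have M: "M > 0" using kernel_const_pos[of d] d by (simp add: M_def curvature_bound_def sup_bound_def a0)
  define \<rho>0 where "\<rho>0 = min (chart_radius d) (\<beta> / (2 * M))"
  have \<rho>0: "\<rho>0 > 0" "\<rho>0 \<le> chart_radius d" "2 * M * \<rho>0 \<le> \<beta>"
    using chart_radius_pos[OF d] \<delta>(1) M by (auto simp: \<rho>0_def \<beta>_def min_def field_simps)
  have P: "retraction_params d a0 \<beta> \<rho>0"
    using d \<delta>(1) \<rho>0 by (simp add: retraction_params_def \<beta>_def M_def)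
  let ?near = "near_zeros d a0 \<beta> \<rho>0"
  have near: "z + u \<in> ?near" if "norm z = 1" "hom_poly d a0 z = 0" "hermitian u z = 0"
    "norm u \<le> \<rho>0 / 12" "norm u \<le> 1 / (16 * real d)" for z u
    using that \<delta>(2) by (intro near_zeros_tangent_ball[OF P]) (auto simp: \<beta>_def)
  \<comment> \<open>By compactness every point where \<open>a0\<close> is smaller than
    \<open>\<kappa>\<close> lies in the domain of the retraction; this will contain the zero locus
    of any nearby polynomial.\<close>
  obtain \<kappa> where \<kappa>: "\<kappa> > 0" "\<And>z. norm z = 1 \<Longrightarrow> z \<notin> ?near \<Longrightarrow> norm (hom_poly d a0 z) \<ge> \<kappa>"
  proof -
    have 1: "compact (sphere 0 1 \<inter> - ?near)"
      by (intro compact_Int_closed compact_sphere closed_Compl open_near_zeros)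
    have 2: "continuous_on (sphere 0 1 \<inter> - ?near) (\<lambda>z. norm (hom_poly d a0 z))"
      by (intro continuous_intros)
    have 3: "norm (hom_poly d a0 z) > 0" if "z \<in> sphere 0 1 \<inter> - ?near" for z
      using near[of z 0] that \<rho>0(1) by auto
    obtain m where "m > 0" "\<And>z. z \<in> sphere 0 1 \<inter> - ?near \<Longrightarrow> norm (hom_poly d a0 z) \<ge> m"
      using compact_positive_bound[OF 1 2 3] by blast
    then show thesis using that[of m] by auto
  qed
  have len0: "fs_length \<gamma> \<ge> 0"
    unfolding fs_length_def using fs_speed_nonneg by (simp add: integral_nonneg integrable_continuous_interval continuous_on_fs_speed sm)
  \<comment> \<open>The relative increase of length that uses up at most half of the gap between
    \<open>fs_length \<gamma>\<close> and \<open>c\<close>.\<close>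
  define \<epsilon> where "\<epsilon> = (c - fs_length \<gamma>) / (2 * (fs_length \<gamma> + 1))"
  have \<epsilon>: "\<epsilon> > 0" using \<gamma>(4) len0 by (simp add: \<epsilon>_def)
  have \<epsilon>c: "(1 + \<epsilon>) * fs_length \<gamma> < c"
  proof -
    have "\<epsilon> * fs_length \<gamma> \<le> \<epsilon> * (fs_length \<gamma> + 1)" using \<epsilon> by (intro mult_left_mono) auto
    also have "\<dots> = (c - fs_length \<gamma>) / 2"
    proof -
      define x where "x = fs_length \<gamma> + 1"
      have "x > 0" using len0 by (simp add: x_def)
      then show ?thesis unfolding \<epsilon>_def x_def[symmetric] by simp
    qed
    finally show ?thesis using \<gamma>(4) by (simp add: distrib_right)
  qed
  \<comment> \<open>The coefficient of \<open>\<rho>\<close> in the relative increase of speed in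
    \<open>push_speed\<close>; the remaining term is \<open>4 * E / \<delta>\<close>.\<close>
  define C where "C = 4 / \<delta> * (L + L\<^sup>2 / \<delta>) + L / \<delta>"
  have C: "C > 0"
    unfolding C_def by (intro add_pos_pos mult_pos_pos divide_pos_pos zero_less_power L \<delta>(1)) simp
  \<comment> \<open>The first two bounds keep the pushed points within the domain of the retraction,
    the third spends half of \<open>\<epsilon>\<close> on the term \<open>\<rho> * C\<close>, and
    the last is required by \<open>push_speed\<close>.\<close>
  define \<rho> where "\<rho> = min (min (\<rho>0 / 12) (1 / (16 * real d))) (min (\<epsilon> / (2 * C)) 1)"
  have \<rho>: "\<rho> > 0" "\<rho> \<le> \<rho>0 / 12" "\<rho> \<le> 1 / (16 * real d)" "\<rho> \<le> \<epsilon> / (2 * C)" "\<rho> \<le> 1"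
    using \<rho>0(1) d \<epsilon> C by (auto simp: \<rho>_def)
  have ex_min: "\<exists>E>0. E \<le> x1 \<and> E \<le> x2 \<and> E \<le> x3 \<and> E < x4" if "x1 > 0" "x2 > 0" "x3 > 0" "x4 > 0" for x1 x2 x3 x4 :: real
    using that by (intro exI[of _ "min (min x1 x2) (min x3 (x4 / 2))"]) auto
  \<comment> \<open>In this order: the slope stays above \<open>\<delta> / 2\<close>, the Newton
    iteration starts within its admissible range, the speed term \<open>4 * E / \<delta>\<close> is
    at most \<open>\<epsilon> / 2\<close>, and the new zero locus lies in the domain of the
    retraction.\<close>
  then obtain E where E: "E > 0" "E \<le> \<delta> / 2" "E \<le> \<delta> * \<rho> / 4" "E \<le> \<epsilon> * \<delta> / 8" "E < \<kappa>"
    using ex_min[of "\<delta> / 2" "\<delta> * \<rho> / 4" "\<epsilon> * \<delta> / 8" \<kappa>] \<delta>(1) \<rho>(1) \<epsilon> \<kappa>(1) by auto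
  show thesis
  proof (rule that)
    show "E / L > 0" using E(1) L by simp
    fix a assume a: "cnorm (exponents d) a = 1" and close: "cnorm (exponents d) (\<lambda>\<alpha>. a \<alpha> - a0 \<alpha>) < E / L"
    let ?pert = "zero_locus (hom_poly d a)"
    have SE: "sup_bound d (\<lambda>\<alpha>. a \<alpha> - a0 \<alpha>) * 4 ^ d \<le> E"
    proof -
      have "sup_bound d (\<lambda>\<alpha>. a \<alpha> - a0 \<alpha>) * 4 ^ d = L * cnorm (exponents d) (\<lambda>\<alpha>. a \<alpha> - a0 \<alpha>)"
        by (simp add: sup_bound_def L_def)
      also have "\<dots> \<le> L * (E / L)" using close L by (intro mult_left_mono) auto
      finally show ?thesis using L by simp
    qed
    have SE1: "sup_bound d (\<lambda>\<alpha>. a \<alpha> - a0 \<alpha>) \<le> E"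
    proof -
      have "sup_bound d (\<lambda>\<alpha>. a \<alpha> - a0 \<alpha>) * 1 \<le> sup_bound d (\<lambda>\<alpha>. a \<alpha> - a0 \<alpha>) * 4 ^ d"
        by (intro mult_left_mono sup_bound_nonneg) simp
      then show ?thesis using SE by simp
    qed
    have fdiff: "norm (hom_poly d a z - hom_poly d a0 z) \<le> E" if "norm z = 1" for z
      using norm_hom_poly_le[of d "\<lambda>\<alpha>. a \<alpha> - a0 \<alpha>" z] SE1 that by (simp add: hom_poly_diff)
    have dir: "norm (direction d a0 z) = 1" "hermitian (direction d a0 z) z = 0"
      "norm (hermitian (direction d a0 z) (grad d a z)) \<ge> \<delta> / 2" if z: "norm z = 1" "hom_poly d a0 z = 0" for z
    proof -
      have t: "tangential_grad d a0 z = grad d a0 z" "tangential_grad d a0 z \<noteq> 0"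
        using reg[OF z] by (simp_all add: zero_tangential_grad[OF z(2)])
      note D = direction[OF z(1) t(2)]
      show "norm (direction d a0 z) = 1" "hermitian (direction d a0 z) z = 0" by (rule D)+
      have "hermitian (direction d a0 z) (grad d a z) = of_real (norm (grad d a0 z))
          + hermitian (direction d a0 z) (grad d (\<lambda>\<alpha>. a \<alpha> - a0 \<alpha>) z)"
        using D(3) by (simp add: grad_diff hermitian_diff_right t(1))
      moreover have "norm (hermitian (direction d a0 z) (grad d (\<lambda>\<alpha>. a \<alpha> - a0 \<alpha>) z)) \<le> E"
        using norm_hermitian_le[of "direction d a0 z" "grad d (\<lambda>\<alpha>. a \<alpha> - a0 \<alpha>) z"] D(1)
          norm_grad_le[of z d "\<lambda>\<alpha>. a \<alpha> - a0 \<alpha>"] z(1) SE by simp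
      ultimately have "norm (hermitian (direction d a0 z) (grad d a z)) \<ge> norm (grad d a0 z) - E"
        using norm_diff_ineq[of "of_real (norm (grad d a0 z)) :: complex"
           "hermitian (direction d a0 z) (grad d (\<lambda>\<alpha>. a \<alpha> - a0 \<alpha>) z)"] by simp
      then show "norm (hermitian (direction d a0 z) (grad d a z)) \<ge> \<delta> / 2"
        using \<delta>(2)[OF z] E(2) by simp
    qed
    have Ma: "curvature_bound d a = M" by (simp add: M_def curvature_bound_def sup_bound_def a a0)
    interpret perturbation d a0 a \<rho>
    proof
      fix z assume z: "norm z = 1" "hom_poly d a0 z = 0"
      let ?b = "norm (hermitian (direction d a0 z) (grad d a z))"
      have "2 * M * \<rho> \<le> ?b"
      proof -
        have "2 * M * \<rho> \<le> 2 * M * \<rho>0" using \<rho>(2) \<rho>0(1) M by (intro mult_left_mono) auto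
        then show ?thesis using \<rho>0(3) dir(3)[OF z] \<delta>(1) by (simp add: \<beta>_def)
      qed
      moreover have "norm (hom_poly d a z) \<le> ?b * \<rho> / 2"
      proof -
        have "norm (hom_poly d a z) \<le> \<delta> / 2 * \<rho> / 2" using fdiff[OF z(1)] z(2) E(3) by simp
        also have "\<dots> \<le> ?b * \<rho> / 2" using dir(3)[OF z] \<rho>(1) by (intro divide_right_mono mult_right_mono) auto
        finally show ?thesis .
      qed
      moreover have "?b > 0" using dir(3)[OF z] \<delta>(1) by linarith
      ultimately show "admissible d a \<rho> z (direction d a0 z)"
        unfolding admissible_def Ma using z d dir(1,2)[OF z] \<rho> \<rho>0 by auto
    qed (use d reg in auto)
    define \<gamma>' where "\<gamma>' = (\<lambda>t. push_cp2 1 (\<gamma> t))"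
    have sm': "smooth_curve \<gamma>'" unfolding \<gamma>'_def by (rule smooth_curve_push[OF sm \<gamma>(2)])
    then have \<gamma>': "smooth_closed_curve \<gamma>'" using \<gamma>(1) by (simp add: smooth_closed_curve_def \<gamma>'_def)
    have Z': "range \<gamma>' \<subseteq> ?pert" using push_cp2_endpoints(1) \<gamma>(2) by (auto simp: \<gamma>'_def)
    have speed: "fs_speed \<gamma>' t \<le> (1 + \<epsilon>) * fs_speed \<gamma> t" for t
    proof -
      have "fs_speed \<gamma>' t \<le> (1 + (4 / \<delta> * (E + L * \<rho> + L\<^sup>2 * \<rho> / \<delta>) + \<rho> * L / \<delta>)) * fs_speed \<gamma> t"
        unfolding \<gamma>'_def
        by (rule push_speed[OF sm \<gamma>(2) \<rho>(5) \<delta> dir(3) _ _ SE]) (auto simp: sup_bound_def a a0 L_def)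
      also have "4 / \<delta> * (E + L * \<rho> + L\<^sup>2 * \<rho> / \<delta>) + \<rho> * L / \<delta> = 4 * E / \<delta> + \<rho> * C"
        using \<delta>(1) by (simp add: C_def field_simps)
      also have "(1 + (4 * E / \<delta> + \<rho> * C)) * fs_speed \<gamma> t \<le> (1 + \<epsilon>) * fs_speed \<gamma> t"
      proof (intro mult_right_mono fs_speed_nonneg add_left_mono)
        have "4 * E / \<delta> \<le> \<epsilon> / 2" "\<rho> * C \<le> \<epsilon> / 2" using E(4) \<rho>(4) \<delta>(1) C by (simp_all add: field_simps)
        then show "4 * E / \<delta> + \<rho> * C \<le> \<epsilon>" by simp
      qed
      finally show ?thesis .
    qed
    have len: "fs_length \<gamma>' < c"
    proof -
      have "fs_length \<gamma>' \<le> integral {0..1} (\<lambda>t. (1 + \<epsilon>) * fs_speed \<gamma> t)"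
        unfolding fs_length_def
        by (intro integral_le integrable_continuous_interval continuous_intros continuous_on_fs_speed sm sm' speed)
      also have "\<dots> = (1 + \<epsilon>) * fs_length \<gamma>" by (simp add: fs_length_def)
      finally show ?thesis using \<epsilon>c by linarith
    qed
    have "\<not> contractible_loop ?pert \<gamma>'"
    proof
      assume "contractible_loop ?pert \<gamma>'"
      then obtain p where p: "p \<in> ?pert" "homotopic_loops ?pert \<gamma>' (\<lambda>_. p)" by (auto simp: contractible_loop_def)
      obtain R where R: "continuous_on (abs_cp2 ` ?near) R" "\<And>z. z \<in> ?near \<Longrightarrow> R (abs_cp2 z) \<in> ?base"
        "\<And>z. z \<in> ?near \<Longrightarrow> hom_poly d a0 z = 0 \<Longrightarrow> R (abs_cp2 z) = abs_cp2 z"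
        using retraction_exists[OF P] by blast
      have Zn: "?pert \<subseteq> abs_cp2 ` ?near"
      proof
        fix q assume q: "q \<in> ?pert"
        obtain w where w: "norm w = 1" "q = abs_cp2 w" by (rule cp2_unit_rep)
        then have "w \<noteq> 0" by auto
        with q w have "hom_poly d a w = 0" by (simp add: zero_locus_abs)
        then have "norm (hom_poly d a0 w) \<le> E" using fdiff[OF w(1)] by simp
        then have "w \<in> ?near" using \<kappa>(2)[OF w(1)] E(5) by fastforce
        then show "q \<in> abs_cp2 ` ?near" using w by blast
      qed
      have h1: "homotopic_loops ?base (R \<circ> \<gamma>') (R \<circ> (\<lambda>_. p))"
        by (rule homotopic_loops_continuous_image[OF p(2) continuous_on_subset[OF R(1) Zn]])
           (use Zn R(2) in auto)
      have pn: "push_cp2 \<tau> q \<in> abs_cp2 ` ?near" if q: "q \<in> ?base" and \<tau>: "0 \<le> \<tau>" "\<tau> \<le> 1" for \<tau> q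
      proof -
        obtain w where w: "norm w = 1" "q = abs_cp2 w" by (rule cp2_unit_rep)
        then have w0: "w \<noteq> 0" by auto
        with q w have fw: "hom_poly d a0 w = 0" by (simp add: zero_locus_abs)
        have "norm (shift w) \<le> \<rho>"
          using line_root(1)[OF adm[OF w(1) fw]] by (simp add: shift_def sgn_unit[OF w(1)])
        then have "\<tau> * norm (shift w) \<le> 1 * \<rho>" using \<tau> \<rho>(1) by (intro mult_mono) auto
        then have "norm ((of_real \<tau> * shift w) *s direction d a0 w) \<le> \<rho>"
          using \<tau> dir(1)[OF w(1) fw] by (simp add: norm_vector_scale norm_mult)
        then have "push \<tau> w \<in> ?near"
          unfolding push_def sgn_unit[OF w(1)] using \<rho> w fw dir(2)[OF w(1) fw]
          by (intro near) (auto simp: hermitian_scale_left)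
        then show ?thesis unfolding w(2) push_cp2_abs[OF w0 fw] by blast
      qed
      have R0: "R q = q" if q: "q \<in> ?base" for q
      proof -
        obtain w where w: "norm w = 1" "q = abs_cp2 w" by (rule cp2_unit_rep)
        then have w0: "w \<noteq> 0" by auto
        with q w have fw: "hom_poly d a0 w = 0" by (simp add: zero_locus_abs)
        have "w + 0 \<in> ?near" using w(1) fw \<rho>0(1) by (intro near) auto
        then show ?thesis using R(3)[of w] fw by (simp add: w(2))
      qed
      \<comment> \<open>Retracting the partially pushed loops joins \<open>\<gamma>\<close> to
        \<open>R \<circ> \<gamma>'\<close> inside the old zero locus, while \<open>h1\<close>
        carries the assumed contraction of \<open>\<gamma>'\<close> there.\<close>
      define H where "H = (\<lambda>x. R (push_cp2 (fst x) (\<gamma> (snd x))))"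
      have \<gamma>Z: "\<gamma> t \<in> ?base" for t using \<gamma>(2) by blast
      have "continuous_on ({0..1} \<times> {0..1}) H"
        unfolding H_def
        by (intro continuous_on_compose2[OF R(1)] continuous_on_push[OF sm \<gamma>(2)])
           (use pn \<gamma>Z in auto)
      moreover have "H ` ({0..1} \<times> {0..1}) \<subseteq> ?base"
      proof clarify
        fix s t :: real assume "s \<in> {0..1}" "t \<in> {0..1}"
        then have "push_cp2 s (\<gamma> t) \<in> abs_cp2 ` ?near" using pn[OF \<gamma>Z] by auto
        then show "H (s, t) \<in> ?base" using R(2) by (auto simp: H_def)
      qed
      moreover have "H (0, t) = \<gamma> t" for t using push_cp2_endpoints(2)[OF \<gamma>Z] R0[OF \<gamma>Z] by (simp add: H_def)
      moreover have "\<gamma> 1 = \<gamma> 0" using \<gamma>(1) unfolding smooth_closed_curve_def by (auto dest: spec[of _ 0])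
      ultimately have h2: "homotopic_loops ?base \<gamma> (R \<circ> \<gamma>')"
        unfolding homotopic_loops
        by (intro exI[of _ H]) (auto simp: pathfinish_def pathstart_def \<gamma>'_def H_def)
      have "homotopic_loops ?base \<gamma> (\<lambda>_. R p)"
        using homotopic_loops_trans[OF h2 h1] by (simp add: o_def)
      moreover have "R p \<in> ?base" using p(1) Zn R(2) by auto
      ultimately show False using \<gamma>(3) unfolding contractible_loop_def by blast
    qed
    then have "systole ?pert \<le> ereal (fs_length \<gamma>')"
      unfolding systole_def using \<gamma>' Z' by (intro Inf_lower) blast
    then show "systole ?pert < ereal c" using len by (meson ereal_less(1) less_ereal.simps(1) order_le_less_trans)
  qed
qed

section \<open>Small ball estimates on the complex sphere\<close>

lemma emeasure_lborel_affine:
  fixes b :: complex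
  assumes "c > 0" "A \<in> sets borel"
  shows "ennreal (c\<^sup>2) * emeasure lborel ((\<lambda>x. of_real c * x + b) -` A) = emeasure lborel A"
proof -
  have eq: "(lborel :: complex measure) = density (distr lborel borel (\<lambda>x. b + c *\<^sub>R x)) (\<lambda>_. \<bar>c\<bar> ^ DIM(complex))"
    by (rule lborel_affine) (use assms in auto)
  have "emeasure lborel A = ennreal (c\<^sup>2) * emeasure (distr lborel borel (\<lambda>x. b + c *\<^sub>R x)) A"
    by (subst eq, subst emeasure_density_const) (use assms in auto)
  also have "emeasure (distr lborel borel (\<lambda>x. b + c *\<^sub>R x)) A = emeasure lborel ((\<lambda>x. b + c *\<^sub>R x) -` A)"
    using assms by (subst emeasure_distr) auto
  finally show ?thesis
    by (simp add: scaleR_conv_of_real add.commute)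
qed

abbreviation lborel_PiM :: "'i set \<Rightarrow> ('i \<Rightarrow> complex) measure" where
  "lborel_PiM I \<equiv> \<Pi>\<^sub>M i\<in>I. lborel"

definition cball_PiM :: "'i set \<Rightarrow> real \<Rightarrow> ('i \<Rightarrow> complex) set" where
  "cball_PiM I r = {a \<in> I \<rightarrow>\<^sub>E UNIV. cnorm I a \<le> r}"

definition cinner :: "'i set \<Rightarrow> ('i \<Rightarrow> complex) \<Rightarrow> ('i \<Rightarrow> complex) \<Rightarrow> complex" where
  "cinner I a b = (\<Sum>i\<in>I. a i * cnj (b i))"

lemma cnorm_nonneg: "cnorm I a \<ge> 0"
  by (simp add: cnorm_def)

lemma cinner_self: "cinner I a a = of_real ((cnorm I a)\<^sup>2)"
  by (simp add: cinner_def cnorm_def L2_set_def sum_nonneg complex_norm_square[symmetric] of_real_sum[symmetric] del: of_real_power of_real_sum)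

lemma cinner_add_left: "cinner I (\<lambda>i. a i + b i) c = cinner I a c + cinner I b c"
  and cinner_commute: "cinner I a b = cnj (cinner I b a)"
  by (simp_all add: cinner_def sum.distrib algebra_simps)

lemma cnorm_add_power2: "(cnorm I (\<lambda>i. a i + b i))\<^sup>2 = (cnorm I a)\<^sup>2 + 2 * Re (cinner I a b) + (cnorm I b)\<^sup>2"
proof -
  have "complex_of_real ((cnorm I (\<lambda>i. a i + b i))\<^sup>2) = cinner I (\<lambda>i. a i + b i) (\<lambda>i. a i + b i)"
    by (simp only: cinner_self)
  also have "\<dots> = cinner I a a + (cinner I a b + cnj (cinner I a b)) + cinner I b b"
    by (simp add: cinner_def sum.distrib algebra_simps)
  also have "cinner I a b + cnj (cinner I a b) = of_real (2 * Re (cinner I a b))"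
    by (rule complex_add_cnj)
  finally have "complex_of_real ((cnorm I (\<lambda>i. a i + b i))\<^sup>2) =
      of_real ((cnorm I a)\<^sup>2 + 2 * Re (cinner I a b) + (cnorm I b)\<^sup>2)"
    by (simp add: cinner_self)
  then show ?thesis by (simp only: of_real_eq_iff)
qed

context
  fixes I :: "'i set"
  assumes I: "finite I"
begin

interpretation product_sigma_finite "\<lambda>_ :: 'i. lborel :: complex measure"
  by (simp add: product_sigma_finite_def sigma_finite_lborel)

lemma space_PiM_lborel: "space (lborel_PiM I) = I \<rightarrow>\<^sub>E UNIV"
  by (simp add: space_PiM)

lemma sets_PiM_lborel: "sets (lborel_PiM I) = sets (\<Pi>\<^sub>M i\<in>I. borel)"
  by (intro sets_PiM_cong) auto

lemma measurable_affine_PiM: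
  "(\<lambda>a. \<lambda>i\<in>I. of_real c * a i + b i) \<in> measurable (lborel_PiM I) (\<Pi>\<^sub>M i\<in>I. lborel)"
  by (rule measurable_restrict) measurable

text \<open>Dilations and translations act coordinatewise and map boxes to boxes, so comparison on
  boxes suffices. No other transformation of the product measure is used.\<close>

lemma emeasure_PiM_affine:
  assumes "c > 0" "A \<in> sets (lborel_PiM I)"
  shows "ennreal (c ^ (2 * card I)) *
      emeasure (lborel_PiM I) {a \<in> I \<rightarrow>\<^sub>E UNIV. (\<lambda>i\<in>I. of_real c * a i + b i) \<in> A} =
    emeasure (lborel_PiM I) A"
proof -
  let ?\<phi> = "\<lambda>a. \<lambda>i\<in>I. of_real c * a i + b i"
  note m [measurable] = measurable_affine_PiM[of c b]
  have eq: "scale_measure (ennreal (c ^ (2 * card I))) (distr (lborel_PiM I) (lborel_PiM I) ?\<phi>) = (lborel_PiM I)"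
  proof (rule PiM_eqI[OF I])
    fix A :: "'i \<Rightarrow> complex set" assume A: "\<And>i. i \<in> I \<Longrightarrow> A i \<in> sets lborel"
    have sA: "Pi\<^sub>E I A \<in> sets (lborel_PiM I)" using A by (intro sets_PiM_I_finite I) auto
    have "?\<phi> -` Pi\<^sub>E I A \<inter> space (lborel_PiM I) = (\<Pi>\<^sub>E i\<in>I. (\<lambda>x. of_real c * x + b i) -` A i)"
      by (auto simp: space_PiM_lborel PiE_iff)
    then have "emeasure (distr (lborel_PiM I) (lborel_PiM I) ?\<phi>) (Pi\<^sub>E I A) = emeasure (lborel_PiM I) (\<Pi>\<^sub>E i\<in>I. (\<lambda>x. of_real c * x + b i) -` A i)"
      using sA by (subst emeasure_distr[OF m]) auto
    also have "\<dots> = (\<Prod>i\<in>I. emeasure lborel ((\<lambda>x. of_real c * x + b i) -` A i))"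
    proof (rule emeasure_PiM[OF I])
      fix i assume "i \<in> I"
      then have "(\<lambda>x. of_real c * x + b i) -` A i \<inter> space borel \<in> sets borel"
        using A by (intro measurable_sets[where M = borel and A = borel]) auto
      then show "(\<lambda>x. of_real c * x + b i) -` A i \<in> sets lborel" by simp
    qed
    finally have "emeasure (scale_measure (ennreal (c ^ (2 * card I))) (distr (lborel_PiM I) (lborel_PiM I) ?\<phi>)) (Pi\<^sub>E I A) =
      (\<Prod>i\<in>I. ennreal (c\<^sup>2) * emeasure lborel ((\<lambda>x. of_real c * x + b i) -` A i))"
      using assms(1) by (simp add: prod.distrib power_mult ennreal_power)
    also have "\<dots> = (\<Prod>i\<in>I. emeasure lborel (A i))"
      using A assms(1) by (intro prod.cong refl emeasure_lborel_affine) auto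
    finally show "emeasure (scale_measure (ennreal (c ^ (2 * card I))) (distr (lborel_PiM I) (lborel_PiM I) ?\<phi>)) (Pi\<^sub>E I A) =
      (\<Prod>i\<in>I. emeasure lborel (A i))" .
  qed simp
  have "emeasure (lborel_PiM I) A = ennreal (c ^ (2 * card I)) * emeasure (distr (lborel_PiM I) (lborel_PiM I) ?\<phi>) A"
    by (subst eq[symmetric]) (rule emeasure_scale_measure)
  also have "emeasure (distr (lborel_PiM I) (lborel_PiM I) ?\<phi>) A = emeasure (lborel_PiM I) {a \<in> I \<rightarrow>\<^sub>E UNIV. ?\<phi> a \<in> A}"
    using assms(2) by (subst emeasure_distr[OF m]) (auto simp: space_PiM_lborel vimage_def Int_def conj_commute)
  finally show ?thesis by simp
qed

lemma measurable_cnorm [measurable]: "cnorm I \<in> borel_measurable (\<Pi>\<^sub>M i\<in>I. borel)"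
  unfolding cnorm_def L2_set_def by measurable

lemma measurable_cnorm_lborel [measurable]: "cnorm I \<in> borel_measurable (\<Pi>\<^sub>M i\<in>I. lborel)"
  unfolding cnorm_def L2_set_def by measurable

lemma sets_cball_PiM [measurable]: "cball_PiM I r \<in> sets (lborel_PiM I)"
  using measurable_sets[OF measurable_cnorm_lborel, of "{..r}"]
  by (simp add: cball_PiM_def vimage_def Int_def space_PiM_lborel conj_commute)

lemma cnorm_scale:
  assumes "c \<ge> 0"
  shows "cnorm I (\<lambda>i\<in>I. of_real c * a i) = c * cnorm I a"
proof -
  have "cnorm I (\<lambda>i\<in>I. of_real c * a i) = L2_set (\<lambda>i. c * norm (a i)) I"
    unfolding cnorm_def using assms by (intro L2_set_cong) (auto simp: norm_mult)
  then show ?thesis using assms by (simp add: L2_set_right_distrib cnorm_def)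
qed

lemma emeasure_cball_PiM:
  assumes "r > 0"
  shows "emeasure (lborel_PiM I) (cball_PiM I r) = ennreal (r ^ (2 * card I)) * emeasure (lborel_PiM I) (cball_PiM I 1)"
proof -
  have "{a \<in> I \<rightarrow>\<^sub>E UNIV. (\<lambda>i\<in>I. of_real r * a i + 0) \<in> cball_PiM I r} = cball_PiM I 1"
    using assms cnorm_scale[of r] by (auto simp: cball_PiM_def)
  then show ?thesis
    using emeasure_PiM_affine[OF assms sets_cball_PiM[of r], where b = "\<lambda>_. 0"] by simp
qed

lemma emeasure_cball_PiM_finite: "emeasure (lborel_PiM I) (cball_PiM I 1) < \<infinity>"
proof -
  have "norm (a i) \<le> 1" if "cnorm I a \<le> 1" "i \<in> I" for a i
    using member_le_L2_set[OF I that(2), of "\<lambda>i. norm (a i)"] that(1) by (simp add: cnorm_def)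
  then have "cball_PiM I 1 \<subseteq> (\<Pi>\<^sub>E i\<in>I. cball 0 1)"
    unfolding cball_PiM_def by (auto simp only: PiE_iff mem_Collect_eq mem_cball_0 simp_thms subset_eq Ball_def)
  then have "emeasure (lborel_PiM I) (cball_PiM I 1) \<le> emeasure (lborel_PiM I) (\<Pi>\<^sub>E i\<in>I. cball 0 1)"
    by (rule emeasure_mono) (auto intro!: sets_PiM_I_finite I)
  also have "\<dots> = (\<Prod>i\<in>I. emeasure lborel (cball (0::complex) 1))"
    by (rule emeasure_PiM) (auto simp: I)
  also have "\<dots> < \<infinity>"
    by (simp add: ennreal_prod_eq_top power_less_top_ennreal emeasure_bounded_finite[unfolded infinity_ennreal_def])
  finally show ?thesis .
qed

lemma emeasure_cball_PiM_pos: "I \<noteq> {} \<Longrightarrow> emeasure (lborel_PiM I) (cball_PiM I 1) > 0"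
proof -
  assume ne: "I \<noteq> {}"
  define r where "r = 1 / real (card I)"
  have r: "r > 0" using I ne by (simp add: r_def card_gt_0_iff)
  have "a \<in> cball_PiM I 1" if "a \<in> (\<Pi>\<^sub>E i\<in>I. ball 0 r)" for a
  proof -
    have "cnorm I a \<le> (\<Sum>i\<in>I. norm (a i))" unfolding cnorm_def by (rule L2_set_le_sum) auto
    also have "\<dots> \<le> (\<Sum>i\<in>I. r)" using that by (intro sum_mono) (auto simp: PiE_iff less_imp_le)
    also have "\<dots> = 1" using I ne by (simp add: r_def)
    finally show ?thesis using that by (auto simp: PiE_iff cball_PiM_def)
  qed
  then have "emeasure (lborel_PiM I) (\<Pi>\<^sub>E i\<in>I. ball 0 r) \<le> emeasure (lborel_PiM I) (cball_PiM I 1)"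
    by (intro emeasure_mono sets_cball_PiM) auto
  moreover have "emeasure (lborel_PiM I) (\<Pi>\<^sub>E i\<in>I. ball 0 r) = (\<Prod>i\<in>I. emeasure lborel (ball (0::complex) r))"
    by (rule emeasure_PiM) (auto simp: I)
  moreover have "emeasure lborel (ball (0::complex) r) \<noteq> 0"
    using r by (simp add: emeasure_ball unit_ball_vol_2)
  ultimately have "emeasure (lborel_PiM I) (cball_PiM I 1) \<noteq> 0" using I by auto
  then show ?thesis by (simp add: zero_less_iff_neq_zero)
qed

text \<open>Packing: the translates of the thin set \<open>T\<close> by the points of a grid in the span of the \<open>e j\<close> are disjoint
  and contained in a slightly larger ball.  This replaces the unitary invariance of Lebesgue measure.\<close>

lemma small_ball_volume:
  fixes e :: "'j \<Rightarrow> 'i \<Rightarrow> complex" and t :: "'j \<Rightarrow> real"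
  assumes ne: "I \<noteq> {}" and J: "finite J"
    and e: "\<And>j k. j \<in> J \<Longrightarrow> k \<in> J \<Longrightarrow> cinner I (e j) (e k) = (if j = k then 1 else 0)"
    and t: "\<And>j. j \<in> J \<Longrightarrow> t j > 0"
  defines "T \<equiv> {a \<in> cball_PiM I 1. \<forall>j\<in>J. norm (cinner I a (e j)) \<le> t j}"
  shows "T \<in> sets (lborel_PiM I)"
    "emeasure (lborel_PiM I) T \<le>
      ennreal (exp (2 * real (card J)) * (\<Prod>j\<in>J. 36 * real (card I) * (t j)\<^sup>2)) * emeasure (lborel_PiM I) (cball_PiM I 1)"
proof -
  define N where "N = real (card I)"
  have N: "N \<ge> 1" using I ne by (simp add: N_def Suc_leI card_gt_0_iff)
  have cm [measurable]: "(\<lambda>a. cinner I a b) \<in> borel_measurable (lborel_PiM I)" for b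
    unfolding cinner_def by measurable
  have "T = cball_PiM I 1 \<inter> {a \<in> space (lborel_PiM I). \<forall>j\<in>J. norm (cinner I a (e j)) \<le> t j}"
    by (auto simp: T_def cball_PiM_def space_PiM_lborel)
  also have "\<dots> \<in> sets (lborel_PiM I)"
    using J by measurable
  finally show sT: "T \<in> sets (lborel_PiM I)" .
  \<comment> \<open>The range keeps the translation in each direction of order
    \<open>1 / sqrt N\<close>. If \<open>t j\<close> exceeds \<open>1 / (6 * sqrt N)\<close>, the
    range is 0 and the direction contributes only the origin.\<close>
  define n where "n = (\<lambda>j. nat \<lfloor>1 / (6 * t j * sqrt N)\<rfloor>)"
  define G where "G = (\<lambda>j. {- int (n j)..int (n j)} \<times> {- int (n j)..int (n j)})"
  \<comment> \<open>The spacing \<open>3 * t j\<close> beats the width of \<open>T\<close>: the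
    coordinates of two of its points differ by at most \<open>2 * t j\<close>, so distinct
    translates are disjoint.\<close>
  define \<beta> where "\<beta> = (\<lambda>m j. of_real (3 * t j) * Complex (of_int (fst (m j))) (of_int (snd (m j))))"
  define s where "s = (\<lambda>m i. \<Sum>j\<in>J. \<beta> m j * e j i)"
  define Tm where "Tm = (\<lambda>m. {a \<in> I \<rightarrow>\<^sub>E UNIV. (\<lambda>i\<in>I. of_real 1 * a i + (- s m i)) \<in> T})"
  have meas: "emeasure (lborel_PiM I) (Tm m) = emeasure (lborel_PiM I) T" for m
    using emeasure_PiM_affine[OF _ sT, of 1 "\<lambda>i. - s m i"] by (simp add: Tm_def)
  have sTm: "Tm m \<in> sets (lborel_PiM I)" for m
    using measurable_sets[OF measurable_affine_PiM[of 1 "\<lambda>i. - s m i"] sT]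
    by (simp add: Tm_def vimage_def Int_def space_PiM_lborel conj_commute)
  have cs: "cinner I (s m) (e k) = \<beta> m k" if "k \<in> J" for m k
  proof -
    have "cinner I (s m) (e k) = (\<Sum>j\<in>J. \<beta> m j * cinner I (e j) (e k))"
      unfolding s_def cinner_def by (simp add: sum_distrib_left sum_distrib_right mult.assoc) (rule sum.swap)
    also have "\<dots> = (\<Sum>j\<in>J. if j = k then \<beta> m k else 0)"
      using that e by (intro sum.cong) auto
    finally show ?thesis using that J by simp
  qed
  have cas: "cinner I a (s m) = (\<Sum>j\<in>J. cnj (\<beta> m j) * cinner I a (e j))" for a m
    unfolding s_def cinner_def by (simp add: sum_distrib_left mult_ac) (rule sum.swap)
  have decomp: "\<exists>x\<in>T. (\<forall>i\<in>I. a i = x i + s m i)" if "a \<in> Tm m" for a m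
    using that by (intro bexI[of _ "\<lambda>i\<in>I. of_real 1 * a i + (- s m i)"]) (auto simp: Tm_def)
  \<comment> \<open>The first bound comes from \<open>3 * t j\<close> times \<open>3 / 2\<close> of
    the range, with \<open>3 / 2\<close> covering \<open>sqrt 2\<close>. The second is the growth of
    the squared norm caused by this direction, cross term included.\<close>
  have \<beta>_le: "norm (\<beta> m j) \<le> 3 / 4 / sqrt N \<and> 2 * norm (\<beta> m j) * t j + (norm (\<beta> m j))\<^sup>2 \<le> 2 / N"
    if "m \<in> Pi\<^sub>E J G" "j \<in> J" for m j
  proof (cases "n j = 0")
    case True
    then have "m j = (0, 0)" using that by (force simp: PiE_iff G_def)
    then have "\<beta> m j = 0" by (simp add: \<beta>_def Complex_eq)
    then show ?thesis using N by simp
  next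
    case False
    define q where "q = 1 / (6 * t j * sqrt N)"
    have q0: "q > 0" using t[OF that(2)] N by (simp add: q_def)
    have nq: "real (n j) \<le> q" using q0 by (simp add: n_def q_def[symmetric])
    then have q1: "1 \<le> q" using False by linarith
    have tq: "t j * q = 1 / (6 * sqrt N)" using t[OF that(2)] N by (simp add: q_def)
    have mj: "m j \<in> G j" using that by auto
    then have "\<bar>of_int (fst (m j))\<bar> \<le> real (n j)" "\<bar>of_int (snd (m j))\<bar> \<le> real (n j)"
      by (auto simp: G_def abs_le_iff)
    then have "(of_int (fst (m j)))\<^sup>2 + (of_int (snd (m j)))\<^sup>2 \<le> (real (n j))\<^sup>2 + (real (n j))\<^sup>2"
      by (intro add_mono) (simp_all add: abs_le_square_iff[symmetric])
    also have "\<dots> \<le> (3 / 2 * q)\<^sup>2"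
    proof -
      have "(real (n j))\<^sup>2 \<le> q\<^sup>2" using nq by (intro power_mono) auto
      moreover have "(3 / 2 * q)\<^sup>2 = 9 / 4 * q\<^sup>2" by (simp add: power2_eq_square)
      ultimately show ?thesis using zero_le_power2[of q] by linarith
    qed
    finally have "norm (Complex (of_int (fst (m j))) (of_int (snd (m j)))) \<le> 3 / 2 * q"
      unfolding cmod_def complex.sel by (intro real_le_lsqrt) (use q0 in auto)
    then have "norm (\<beta> m j) \<le> 3 * t j * (3 / 2 * q)"
      using t[OF that(2)] unfolding \<beta>_def norm_mult by (intro mult_mono) auto
    also have "\<dots> = 3 / 4 / sqrt N" using tq by (simp add: field_simps)
    finally have b: "norm (\<beta> m j) \<le> 3 / 4 / sqrt N" .
    have "t j \<le> t j * q" using q1 t[OF that(2)] by simp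
    then have t1: "t j \<le> 1 / (6 * sqrt N)" using tq by simp
    have "2 * norm (\<beta> m j) * t j \<le> 2 * (3 / 4 / sqrt N) * (1 / (6 * sqrt N))"
      using b t1 t[OF that(2)] N by (intro mult_mono) auto
    moreover have "\<dots> = 1 / 4 / N" using N by (simp add: real_sqrt_mult_self field_simps)
    moreover have "(norm (\<beta> m j))\<^sup>2 \<le> (3 / 4 / sqrt N)\<^sup>2" using b by (intro power_mono) auto
    moreover have "\<dots> = 9 / 16 / N" using N by (simp add: power_divide)
    moreover have "1 / 4 / N + 9 / 16 / N \<le> 2 / N" using N by (simp add: field_simps)
    ultimately show ?thesis using b by linarith
  qed
  \<comment> \<open>Each direction adds at most \<open>2 / N\<close> to the squared norm. In real
    dimension \<open>2 * N\<close> the larger ball then has relative volume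
    \<open>(1 + 2 * card J / N) ^ N\<close>, which is at most \<open>exp (2 * card J)\<close>
    independently of \<open>N\<close>.\<close>
  define R where "R = sqrt (1 + 2 * real (card J) / N)"
  have R: "R > 0" "R\<^sup>2 = 1 + 2 * real (card J) / N" using N by (simp_all add: R_def add_pos_nonneg)
  have sub: "Tm m \<subseteq> cball_PiM I R" if m: "m \<in> Pi\<^sub>E J G" for m
  proof
    fix a assume a: "a \<in> Tm m"
    then obtain x where x: "x \<in> T" "\<And>i. i \<in> I \<Longrightarrow> a i = x i + s m i" using decomp by blast
    have "(cnorm I a)\<^sup>2 = (cnorm I (\<lambda>i. x i + s m i))\<^sup>2"
      unfolding cnorm_def using x by (simp cong: L2_set_cong)
    also have "\<dots> = (cnorm I x)\<^sup>2 + 2 * Re (cinner I x (s m)) + (cnorm I (s m))\<^sup>2"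
      by (rule cnorm_add_power2)
    also have "(cnorm I (s m))\<^sup>2 = (\<Sum>j\<in>J. (norm (\<beta> m j))\<^sup>2)"
    proof -
      have "complex_of_real ((cnorm I (s m))\<^sup>2) = (\<Sum>j\<in>J. cnj (\<beta> m j) * \<beta> m j)"
        unfolding cinner_self[symmetric] cas using cs by simp
      also have "\<dots> = complex_of_real (\<Sum>j\<in>J. (norm (\<beta> m j))\<^sup>2)"
        unfolding of_real_sum by (intro sum.cong refl) (simp only: complex_norm_square mult.commute)
      finally show ?thesis by (simp only: of_real_eq_iff)
    qed
    also have "Re (cinner I x (s m)) \<le> (\<Sum>j\<in>J. norm (\<beta> m j) * t j)"
    proof -
      have "Re (cinner I x (s m)) \<le> norm (cinner I x (s m))" by (rule complex_Re_le_cmod)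
      also have "\<dots> \<le> (\<Sum>j\<in>J. norm (\<beta> m j) * norm (cinner I x (e j)))"
        unfolding cas by (rule order.trans[OF norm_sum]) (simp add: norm_mult)
      also have "\<dots> \<le> (\<Sum>j\<in>J. norm (\<beta> m j) * t j)"
        using x(1) by (intro sum_mono mult_left_mono) (auto simp: T_def)
      finally show ?thesis .
    qed
    also have "(cnorm I x)\<^sup>2 \<le> 1"
      using x(1) cnorm_nonneg[of I x] by (simp add: T_def cball_PiM_def power_le_one)
    finally have "(cnorm I a)\<^sup>2 \<le> 1 + (\<Sum>j\<in>J. 2 * norm (\<beta> m j) * t j + (norm (\<beta> m j))\<^sup>2)"
      by (simp add: sum.distrib sum_distrib_left mult.assoc)
    also have "\<dots> \<le> 1 + (\<Sum>j\<in>J. 2 / N)"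
      using \<beta>_le[OF m] by (intro add_left_mono sum_mono) auto
    also have "\<dots> = R\<^sup>2" by (simp add: R)
    finally have "cnorm I a \<le> R" using R(1) by (rule_tac power2_le_imp_le) auto
    then show "a \<in> cball_PiM I R" using a by (simp add: cball_PiM_def Tm_def)
  qed
  have disj: "disjoint_family_on Tm (Pi\<^sub>E J G)"
    unfolding disjoint_family_on_def
  proof (intro ballI impI, rule ccontr)
    fix m m' assume m: "m \<in> Pi\<^sub>E J G" "m' \<in> Pi\<^sub>E J G" "m \<noteq> m'" and "Tm m \<inter> Tm m' \<noteq> {}"
    then obtain a where a: "a \<in> Tm m" "a \<in> Tm m'" by blast
    obtain j where j: "j \<in> J" "m j \<noteq> m' j" using m by (meson PiE_ext)
    obtain x where x: "x \<in> T" "\<And>i. i \<in> I \<Longrightarrow> a i = x i + s m i" using decomp[OF a(1)] by blast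
    obtain x' where x': "x' \<in> T" "\<And>i. i \<in> I \<Longrightarrow> a i = x' i + s m' i" using decomp[OF a(2)] by blast
    have "cinner I (\<lambda>i. x i + s m i) (e j) = cinner I (\<lambda>i. x' i + s m' i) (e j)"
      unfolding cinner_def using x(2) x'(2) by (intro sum.cong) auto
    then have "\<beta> m j - \<beta> m' j = cinner I x' (e j) - cinner I x (e j)"
      by (simp add: cinner_add_left cs[OF j(1)] algebra_simps)
    also have "norm \<dots> \<le> t j + t j"
      using x(1) x'(1) j(1) by (intro order.trans[OF norm_triangle_ineq4] add_mono) (auto simp: T_def)
    also have "\<beta> m j - \<beta> m' j = of_real (3 * t j) *
        Complex (of_int (fst (m j) - fst (m' j))) (of_int (snd (m j) - snd (m' j)))"
      by (simp add: \<beta>_def complex_eq_iff algebra_simps)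
    finally have le: "3 * t j * norm (Complex (of_int (fst (m j) - fst (m' j))) (of_int (snd (m j) - snd (m' j)))) \<le> 2 * t j"
      using t[OF j(1)] by (simp add: norm_mult)
    have ge: "norm (Complex (of_int (fst (m j) - fst (m' j))) (of_int (snd (m j) - snd (m' j)))) \<ge> 1"
    proof -
      have "fst (m j) - fst (m' j) \<noteq> 0 \<or> snd (m j) - snd (m' j) \<noteq> 0" using j(2) by (auto simp: prod_eq_iff)
      then have "1 \<le> \<bar>real_of_int (fst (m j) - fst (m' j))\<bar> \<or> 1 \<le> \<bar>real_of_int (snd (m j) - snd (m' j))\<bar>"
        by linarith
      then show ?thesis
        using abs_Re_le_cmod[of "Complex (of_int (fst (m j) - fst (m' j))) (of_int (snd (m j) - snd (m' j)))"]
          abs_Im_le_cmod[of "Complex (of_int (fst (m j) - fst (m' j))) (of_int (snd (m j) - snd (m' j)))"]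
        by auto
    qed
    have "3 * t j * 1 \<le> 3 * t j * norm (Complex (of_int (fst (m j) - fst (m' j))) (of_int (snd (m j) - snd (m' j))))"
      using ge t[OF j(1)] by (intro mult_left_mono) auto
    then show False using le t[OF j(1)] by simp
  qed
  have finG: "finite (Pi\<^sub>E J G)" using J by (intro finite_PiE) (auto simp: G_def)
  have cardG: "real (card (Pi\<^sub>E J G)) = (\<Prod>j\<in>J. (2 * real (n j) + 1)\<^sup>2)"
    using J by (simp add: card_PiE G_def power2_eq_square) (simp add: of_nat_prod add.commute)?
  have "of_nat (card (Pi\<^sub>E J G)) * emeasure (lborel_PiM I) T = (\<Sum>m\<in>Pi\<^sub>E J G. emeasure (lborel_PiM I) (Tm m))"
    by (simp add: meas)
  also have "\<dots> = emeasure (lborel_PiM I) (\<Union>m\<in>Pi\<^sub>E J G. Tm m)"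
    using disj finG sTm by (intro sum_emeasure) auto
  also have "\<dots> \<le> emeasure (lborel_PiM I) (cball_PiM I R)"
    using sub by (intro emeasure_mono) auto
  also have "\<dots> = ennreal (R ^ (2 * card I)) * emeasure (lborel_PiM I) (cball_PiM I 1)"
    by (rule emeasure_cball_PiM[OF R(1)])
  finally have 1: "of_nat (card (Pi\<^sub>E J G)) * emeasure (lborel_PiM I) T \<le> ennreal (R ^ (2 * card I)) * emeasure (lborel_PiM I) (cball_PiM I 1)" .
  have RI: "R ^ (2 * card I) \<le> exp (2 * real (card J))"
  proof -
    have "R ^ (2 * card I) = (1 + 2 * real (card J) / real (card I)) ^ card I"
      using R(2) by (simp add: power_mult N_def)
    also have "\<dots> \<le> exp (2 * real (card J))"
      by (rule exp_ge_one_plus_x_over_n_power_n) (use I ne in \<open>auto simp: card_gt_0_iff intro: order.trans[of _ 0]\<close>)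
    finally show ?thesis .
  qed
  \<comment> \<open>Rounding down costs less than 1, so \<open>2 * n j + 1\<close> still reaches
    \<open>1 / (6 * t j * sqrt N)\<close>; its square, the number of grid points in direction
    \<open>j\<close>, compensates \<open>36 * N * (t j)\<^sup>2\<close>.\<close>
  have Kge: "1 \<le> real (card (Pi\<^sub>E J G)) * (\<Prod>j\<in>J. 36 * N * (t j)\<^sup>2)"
  proof -
    have "1 \<le> (\<Prod>j\<in>J. (2 * real (n j) + 1)\<^sup>2 * (36 * N * (t j)\<^sup>2))"
    proof (rule prod_ge_1)
      fix j assume j: "j \<in> J"
      have "1 / (6 * t j * sqrt N) \<le> 2 * real (n j) + 1"
      proof -
        have "1 / (6 * t j * sqrt N) \<ge> 0" using t[OF j] N by simp
        then show ?thesis unfolding n_def by linarith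
      qed
      then have "1 \<le> (2 * real (n j) + 1) * (6 * t j * sqrt N)"
        using t[OF j] N by (simp add: divide_le_eq)
      then have "1 \<le> ((2 * real (n j) + 1) * (6 * t j * sqrt N))\<^sup>2" by (simp add: one_le_power)
      also have "\<dots> = (2 * real (n j) + 1)\<^sup>2 * (36 * N * (t j)\<^sup>2)"
        using N by (simp add: power_mult_distrib)
      finally show "1 \<le> (2 * real (n j) + 1)\<^sup>2 * (36 * N * (t j)\<^sup>2)" .
    qed
    then show ?thesis by (simp add: cardG prod.distrib)
  qed
  define K where "K = (\<Prod>j\<in>J. 36 * N * (t j)\<^sup>2)"
  have K0: "K \<ge> 0" using N by (auto simp: K_def intro!: prod_nonneg)
  have "emeasure (lborel_PiM I) T \<le> ennreal (real (card (Pi\<^sub>E J G)) * K) * emeasure (lborel_PiM I) T"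
    using mult_right_mono[of 1 "ennreal (real (card (Pi\<^sub>E J G)) * K)" "emeasure (lborel_PiM I) T"] Kge by (simp add: K_def)
  also have "\<dots> = ennreal K * (of_nat (card (Pi\<^sub>E J G)) * emeasure (lborel_PiM I) T)"
    using K0 by (simp add: ennreal_mult ennreal_of_nat_eq_real_of_nat mult_ac)
  also have "\<dots> \<le> ennreal K * (ennreal (R ^ (2 * card I)) * emeasure (lborel_PiM I) (cball_PiM I 1))"
    by (rule mult_left_mono[OF 1]) simp
  also have "\<dots> \<le> ennreal K * (ennreal (exp (2 * real (card J))) * emeasure (lborel_PiM I) (cball_PiM I 1))"
    using RI by (intro mult_left_mono mult_right_mono ennreal_leI) auto
  also have "\<dots> = ennreal (exp (2 * real (card J)) * K) * emeasure (lborel_PiM I) (cball_PiM I 1)"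
    using K0 by (simp add: ennreal_mult mult_ac)
  finally show "emeasure (lborel_PiM I) T \<le> ennreal (exp (2 * real (card J)) * (\<Prod>j\<in>J. 36 * real (card I) * (t j)\<^sup>2)) *
     emeasure (lborel_PiM I) (cball_PiM I 1)" by (simp add: K_def N_def)
qed

end

section \<open>The probability of an almost singular point\<close>

lemma hom_poly_deriv_unique:
  assumes "\<And>\<sigma>. hom_poly d a (z + \<sigma> *s v) = g \<sigma>" "(g has_field_derivative g') (at 0)"
  shows "(\<Sum>\<alpha>\<in>exponents d. a \<alpha> * monomials_deriv d z v \<alpha>) = g'"
proof -
  have "(g has_field_derivative hermitian v (grad d a (z + 0 *s v))) (at 0)"
    using hom_poly_line[of d a z v 0] assms(1) by simp
  then have "hermitian v (grad d a z) = g'" using assms(2) DERIV_unique by fastforce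
  then show ?thesis by (simp add: hermitian_grad)
qed

text \<open>The kernel in its first variable is itself a homogeneous polynomial, with coefficients
  \<open>cnj (monomials d y \<alpha>)\<close>; differentiate it along a line.\<close>

lemma monomials_deriv_kernel:
  "(\<Sum>\<alpha>\<in>exponents d. cnj (monomials d y \<alpha>) * monomials_deriv d z v \<alpha>) =
     of_real (kernel_const d) * (of_nat d * hermitian z y ^ (d - 1) * hermitian v y)"
proof (rule hom_poly_deriv_unique)
  show "hom_poly d (\<lambda>\<alpha>. cnj (monomials d y \<alpha>)) (z + \<sigma> *s v) =
      of_real (kernel_const d) * (hermitian z y + \<sigma> * hermitian v y) ^ d" for \<sigma>
    unfolding hom_poly_eq using monomials_kernel[of d "z + \<sigma> *s v" y]
    by (simp add: hermitian_add_left hermitian_scale_left mult.commute)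
  show "((\<lambda>\<sigma>. of_real (kernel_const d) * (hermitian z y + \<sigma> * hermitian v y) ^ d) has_field_derivative
      of_real (kernel_const d) * (of_nat d * hermitian z y ^ (d - 1) * hermitian v y)) (at 0)"
    by (auto intro!: derivative_eq_intros)
qed

text \<open>Differentiate the kernel once more in the other variable. Because \<open>w\<close> is
  orthogonal to \<open>z\<close>, the power of the product with \<open>z\<close> is constant along
  the line and only the linear factor contributes.\<close>

lemma monomials_deriv_deriv_kernel:
  assumes "hermitian w z = 0"
  shows "(\<Sum>\<alpha>\<in>exponents d. cnj (monomials_deriv d z v \<alpha>) * monomials_deriv d z w \<alpha>) =
     of_real (kernel_const d) * (of_nat d * hermitian z z ^ (d - 1) * hermitian w v)"
proof (rule hom_poly_deriv_unique)
  show "hom_poly d (\<lambda>\<alpha>. cnj (monomials_deriv d z v \<alpha>)) (z + \<sigma> *s w) =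
      of_real (kernel_const d) * (of_nat d * hermitian z z ^ (d - 1) * (hermitian z v + \<sigma> * hermitian w v))" for \<sigma>
  proof -
    have "hom_poly d (\<lambda>\<alpha>. cnj (monomials_deriv d z v \<alpha>)) y = cnj (\<Sum>\<alpha>\<in>exponents d. cnj (monomials d y \<alpha>) * monomials_deriv d z v \<alpha>)" for y
      by (simp add: hom_poly_eq mult.commute)
    also have "\<dots> y = of_real (kernel_const d) * (of_nat d * hermitian y z ^ (d - 1) * hermitian y v)" for y
      by (simp add: monomials_deriv_kernel hermitian_commute[of z y] hermitian_commute[of v y])
    finally show ?thesis
      using assms by (simp add: hermitian_add_left hermitian_scale_left)
  qed
  show "((\<lambda>\<sigma>. of_real (kernel_const d) * (of_nat d * hermitian z z ^ (d - 1) * (hermitian z v + \<sigma> * hermitian w v)))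
     has_field_derivative of_real (kernel_const d) * (of_nat d * hermitian z z ^ (d - 1) * hermitian w v)) (at 0)"
    by (auto intro!: derivative_eq_intros)
qed

section \<open>Orthonormal frames of the tangent plane\<close>

definition conj_cross :: "complex ^ 3 \<Rightarrow> complex ^ 3 \<Rightarrow> complex ^ 3" where
  "conj_cross x v = vector [cnj (x $ 2 * v $ 3 - x $ 3 * v $ 2), cnj (x $ 3 * v $ 1 - x $ 1 * v $ 3),
     cnj (x $ 1 * v $ 2 - x $ 2 * v $ 1)]"

lemma conj_cross_orthogonal: "hermitian (conj_cross x v) x = 0" "hermitian (conj_cross x v) v = 0"
  by (simp_all add: hermitian_3 conj_cross_def vector_3 algebra_simps)

text \<open>Lagrange's identity. It ensures that the cross product of two orthonormal vectors is not
  zero, so that it completes the frame.\<close>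

lemma hermitian_conj_cross: "hermitian (conj_cross x v) (conj_cross x v) = hermitian x x * hermitian v v - hermitian x v * hermitian v x"
  by (simp add: hermitian_3 conj_cross_def vector_3 algebra_simps)

lemma unit_multiple:
  assumes "w \<noteq> (0 :: complex ^ 3)"
  obtains c where "norm (c *s w) = 1"
proof -
  have "norm ((1 / of_real (norm w)) *s w) = 1" using assms by (simp add: norm_vector_scale norm_divide)
  then show thesis using that by blast
qed

lemma orthonormal_frame:
  assumes "norm x = 1"
  obtains v1 v2 where "norm v1 = 1" "norm v2 = 1" "hermitian v1 x = 0" "hermitian v2 x = 0" "hermitian v1 v2 = 0"
proof -
  have "\<exists>k. conj_cross x (axis k 1) \<noteq> 0"
  proof (rule ccontr)
    assume "\<not> ?thesis"
    then have "conj_cross x (axis 1 1) $ 2 = 0" "conj_cross x (axis 1 1) $ 3 = 0" "conj_cross x (axis 2 1) $ 3 = 0" by auto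
    then have "x = 0" by (simp add: conj_cross_def vector_3 axis_def vec_eq_iff forall_3)
    with assms show False by auto
  qed
  then obtain k c where v1: "norm (c *s conj_cross x (axis k 1)) = 1" using unit_multiple by metis
  define v1 where "v1 = c *s conj_cross x (axis k 1)"
  have 1: "norm v1 = 1" "hermitian v1 x = 0"
    using v1 by (simp_all add: v1_def hermitian_scale_left conj_cross_orthogonal)
  have "hermitian (conj_cross x v1) (conj_cross x v1) = 1"
    unfolding hermitian_conj_cross using 1 assms hermitian_commute[of x v1] by (simp add: hermitian_self)
  then have "conj_cross x v1 \<noteq> 0" by auto
  then obtain e where "norm (e *s conj_cross x v1) = 1" using unit_multiple by blast
  moreover have "hermitian (e *s conj_cross x v1) x = 0" "hermitian (e *s conj_cross x v1) v1 = 0"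
    by (simp_all add: hermitian_scale_left conj_cross_orthogonal)
  moreover from this have "hermitian v1 (e *s conj_cross x v1) = 0"
    by (metis complex_cnj_zero hermitian_commute)
  ultimately show thesis using 1 by (intro that[of v1 "e *s conj_cross x v1"]) auto
qed

section \<open>From volumes in the ball to probabilities on the sphere\<close>

lemma sets_restrict_csphere:
  assumes "finite I" "A \<in> sets (\<Pi>\<^sub>M i\<in>I. (borel :: complex measure))" "sets D = sets (\<Pi>\<^sub>M i\<in>I. (borel :: complex measure))"
  shows "{a \<in> I \<rightarrow>\<^sub>E UNIV. cnorm I a = 1} \<inter> space D \<in> sets D"
    "A \<inter> {a \<in> I \<rightarrow>\<^sub>E UNIV. cnorm I a = 1} \<in> sets (restrict_space D {a \<in> I \<rightarrow>\<^sub>E UNIV. cnorm I a = 1})"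
proof -
  let ?B = "\<Pi>\<^sub>M i\<in>I. (borel :: complex measure)"
  let ?sphere = "{a \<in> I \<rightarrow>\<^sub>E UNIV. cnorm I a = 1}"
  have sp: "space ?B = I \<rightarrow>\<^sub>E UNIV" by (auto simp: space_PiM)
  have "?sphere \<in> sets ?B"
    using measurable_sets[OF measurable_cnorm[OF assms(1)], of "{1}"] by (simp add: vimage_def Int_def sp conj_commute)
  moreover have "?sphere \<inter> space D = ?sphere" using sets_eq_imp_space_eq[OF assms(3)] sp by auto
  ultimately show 1: "?sphere \<inter> space D \<in> sets D" using assms(3) by simp
  show "A \<inter> ?sphere \<in> sets (restrict_space D ?sphere)"
    using assms(2,3) by (auto simp: sets_restrict_space)
qed

lemma sets_uniform_csphereI:
  assumes "finite I" "I \<noteq> {}" "A \<in> sets (\<Pi>\<^sub>M i\<in>I. (borel :: complex measure))"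
  shows "A \<inter> space (uniform_csphere I) \<in> sets (uniform_csphere I)"
  unfolding space_uniform_csphere[OF assms(1,2)] unfolding uniform_csphere_def
  by (intro sets_completionI_sets sets_restrict_csphere(2) assms) simp

text \<open>By the cone construction the probability is a ratio of volumes in the ball. A point of
  the ball is its normalisation times a number at most 1, so its inner products only get smaller and
  the cone over \<open>W\<close> lies in the thin set of \<open>small_ball_volume\<close>.\<close>

lemma csphere_small_ball:
  fixes e :: "'j \<Rightarrow> 'i \<Rightarrow> complex" and t :: "'j \<Rightarrow> real"
  assumes I: "finite I" "I \<noteq> {}" and J: "finite J"
    and e: "\<And>j k. j \<in> J \<Longrightarrow> k \<in> J \<Longrightarrow> cinner I (e j) (e k) = (if j = k then 1 else 0)"
    and t: "\<And>j. j \<in> J \<Longrightarrow> t j > 0"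
  defines "W \<equiv> {a \<in> space (uniform_csphere I). \<forall>j\<in>J. norm (cinner I a (e j)) \<le> t j}"
  shows "W \<in> sets (uniform_csphere I)"
    "measure (uniform_csphere I) W \<le> exp (2 * real (card J)) * (\<Prod>j\<in>J. 36 * real (card I) * (t j)\<^sup>2)"
proof -
  let ?L = "\<Pi>\<^sub>M i\<in>I. (lborel :: complex measure)"
  let ?B = "\<Pi>\<^sub>M i\<in>I. (borel :: complex measure)"
  let ?ball = "{a \<in> I \<rightarrow>\<^sub>E UNIV. cnorm I a \<le> 1}"
  let ?sphere = "{a \<in> I \<rightarrow>\<^sub>E UNIV. cnorm I a = 1}"
  let ?f = "\<lambda>a. \<lambda>i\<in>I. a i / complex_of_real (cnorm I a)"
  let ?U = "uniform_measure ?L ?ball"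
  let ?D = "distr ?U ?B ?f"
  define K where "K = exp (2 * real (card J)) * (\<Prod>j\<in>J. 36 * real (card I) * (t j)\<^sup>2)"
  have K: "K \<ge> 0" by (auto simp: K_def intro!: prod_nonneg mult_nonneg_nonneg)
  have ball: "?ball = cball_PiM I 1" by (simp add: cball_PiM_def)
  have sets_eq: "sets ?L = sets ?B" by (rule sets_PiM_lborel[OF I(1)])
  have space_L: "space ?L = I \<rightarrow>\<^sub>E UNIV" "space ?B = I \<rightarrow>\<^sub>E UNIV" by (auto simp: space_PiM)
  note [measurable] = measurable_cnorm[OF I(1)] measurable_cnorm_lborel[OF I(1)]
  have cm [measurable]: "(\<lambda>a. cinner I a b) \<in> borel_measurable ?B" for b
    unfolding cinner_def by measurable
  have f: "?f \<in> measurable ?B ?B"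
    by (rule measurable_restrict) measurable
  then have fU: "?f \<in> measurable ?U ?B" using sets_eq by (simp cong: measurable_cong_sets)
  have sphere: "?sphere \<in> sets ?B"
    using measurable_sets[OF measurable_cnorm[OF I(1)], of "{1}"] by (simp add: vimage_def Int_def space_L conj_commute)
  have W: "W = ?sphere \<inter> {a \<in> space ?B. \<forall>j\<in>J. norm (cinner I a (e j)) \<le> t j}"
    unfolding W_def space_uniform_csphere[OF I] space_L by auto
  have WB: "W \<in> sets ?B"
    unfolding W using J by (intro sets.Int sphere) measurable
  have sphereD: "?sphere \<inter> space ?D \<in> sets ?D"
    by (rule sets_restrict_csphere(1)[OF I(1) WB]) simp
  have Wsub: "W \<subseteq> ?sphere" unfolding W by blast
  have WR: "W \<in> sets (restrict_space ?D ?sphere)"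
    using sets_restrict_csphere(2)[OF I(1) WB, of ?D] Wsub by (simp add: Int_absorb2)
  then show "W \<in> sets (uniform_csphere I)"
    unfolding uniform_csphere_def by (rule sets_completionI_sets)
  have "emeasure (uniform_csphere I) W = emeasure (restrict_space ?D ?sphere) W"
    unfolding uniform_csphere_def using WR by (simp add: emeasure_completion sets_completionI_sets)
  also have "\<dots> = emeasure ?D W"
    by (rule emeasure_restrict_space[OF sphereD Wsub])
  also have "\<dots> = emeasure ?U (?f -` W \<inter> space ?U)"
    by (rule emeasure_distr[OF fU WB])
  also have "\<dots> = emeasure ?L (?ball \<inter> (?f -` W \<inter> space ?U)) / emeasure ?L ?ball"
  proof (rule emeasure_uniform_measure)
    show "?f -` W \<inter> space ?U \<in> sets ?L" using measurable_sets[OF fU WB] by simp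
    show "?ball \<in> sets ?L" unfolding ball by (rule sets_cball_PiM[OF I(1)])
  qed
  also have "\<dots> \<le> ennreal K"
  proof -
    let ?T = "{a \<in> cball_PiM I 1. \<forall>j\<in>J. norm (cinner I a (e j)) \<le> t j}"
    note sb = small_ball_volume[where e = e and t = t, OF I J e t, folded K_def]
    have "?ball \<inter> (?f -` W \<inter> space ?U) \<subseteq> ?T"
    proof
      fix a assume a: "a \<in> ?ball \<inter> (?f -` W \<inter> space ?U)"
      then have ab: "a \<in> cball_PiM I 1" "cnorm I a \<le> 1" and aW: "?f a \<in> W" by (auto simp: cball_PiM_def)
      have "norm (cinner I a (e j)) \<le> t j" if j: "j \<in> J" for j
      proof (cases "cnorm I a = 0")
        case True
        then have "cinner I a (e j) = 0" using cnorm_eq_0_iff[OF I(1)] by (simp add: cinner_def)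
        then show ?thesis using t[OF j] by simp
      next
        case False
        then have pos: "cnorm I a > 0" using cnorm_nonneg[of I a] by simp
        have "cinner I (?f a) (e j) = cinner I a (e j) / of_real (cnorm I a)"
          by (simp add: cinner_def sum_divide_distrib)
        moreover have "norm (cinner I (?f a) (e j)) \<le> t j" using aW j unfolding W by auto
        ultimately have "norm (cinner I a (e j)) \<le> t j * cnorm I a"
          using pos by (simp add: norm_divide divide_le_eq)
        also have "\<dots> \<le> t j" using ab(2) t[OF j] by simp
        finally show ?thesis .
      qed
      then show "a \<in> ?T" using ab(1) by blast
    qed
    then have "emeasure ?L (?ball \<inter> (?f -` W \<inter> space ?U)) \<le> emeasure ?L ?T"
      using sb(1) by (rule emeasure_mono)
    also have "\<dots> \<le> ennreal K * emeasure ?L ?ball" unfolding ball by (rule sb(2))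
    finally have "emeasure ?L (?ball \<inter> (?f -` W \<inter> space ?U)) / emeasure ?L ?ball \<le> ennreal K * emeasure ?L ?ball / emeasure ?L ?ball"
      by (rule divide_right_mono_ennreal)
    also have "\<dots> = ennreal K"
      unfolding ball using emeasure_cball_PiM_pos[OF I] emeasure_cball_PiM_finite[OF I(1)]
      by (intro ennreal_mult_divide_eq) (auto simp: less_top[symmetric])
    finally show ?thesis .
  qed
  finally show "measure (uniform_csphere I) W \<le> K"
    using K by (simp add: measure_def enn2real_leI)
qed

lemma card_exponents: "real (card (exponents d)) \<le> 2 * kernel_const d"
proof -
  have "exponents d \<subseteq> (\<lambda>(i, j). (i, j, d - i - j)) ` ({..d} \<times> {..d})"
    by (force simp: exponents_def)
  then have "card (exponents d) \<le> card ({..d} \<times> {..d})"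
    by (intro order.trans[OF card_mono card_image_le]) auto
  then have "card (exponents d) \<le> (d + 1) * (d + 1)" by simp
  then have "real (card (exponents d)) \<le> real ((d + 1) * (d + 1))" by (simp only: of_nat_le_iff)
  also have "\<dots> \<le> 2 * kernel_const d" by (simp add: kernel_const_def algebra_simps)
  finally show ?thesis .
qed

text \<open>By the kernel identities, evaluation divided by \<open>sqrt N\<close> and the two
  tangential derivatives divided by \<open>sqrt (N * d)\<close> are inner products with an
  orthonormal triple. Each contributes \<open>36 * card I\<close> times the square of its threshold;
  \<open>card I \<le> 2 * N\<close> produces the factors 72, and \<open>exp 6\<close> is
  \<open>exp (2 * 3)\<close>.\<close>

lemma almost_singular_at_point:
  assumes d: "d \<ge> 1" and x: "norm x = 1" and s: "s0 > 0" "s1 > 0"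
  obtains W where "W \<in> sets (mu d)"
    "\<And>a. a \<in> space (mu d) \<Longrightarrow> norm (hom_poly d a x) \<le> s0 \<Longrightarrow>
       (\<And>v. norm v = 1 \<Longrightarrow> hermitian v x = 0 \<Longrightarrow> norm (hermitian v (grad d a x)) \<le> s1) \<Longrightarrow> a \<in> W"
    "measure (mu d) W \<le> exp 6 * 72 ^ 3 * s0\<^sup>2 * s1 ^ 4 / (real d)\<^sup>2"
proof -
  obtain v1 v2 where v: "norm v1 = 1" "norm v2 = 1" "hermitian v1 x = 0" "hermitian v2 x = 0" "hermitian v1 v2 = 0"
    using orthonormal_frame[OF x] .
  have v21: "hermitian v2 v1 = 0" using v(5) hermitian_commute[of v2 v1] by simp
  define I where "I = exponents d"
  have I: "finite I" "I \<noteq> {}" by (simp_all add: I_def finite_exponents exponents_nonempty)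
  define N where "N = kernel_const d"
  have N: "N > 0" unfolding N_def by (rule kernel_const_pos)
  define q where "q = sqrt (N * real d)"
  have q: "q > 0" "q * q = N * real d" using N d by (simp_all add: q_def)
  have qq: "complex_of_real q * complex_of_real q = of_real N * of_nat d" using q(2) by (metis of_real_mult of_real_of_nat_eq)
  have NN: "complex_of_real (sqrt N) * complex_of_real (sqrt N) = of_real N" using N by (metis of_real_mult real_sqrt_mult_self abs_of_pos)
  \<comment> \<open>The conjugates compensate for the antilinearity of \<open>cinner\<close> in its
    second argument.\<close>
  define e :: "nat \<Rightarrow> nat \<times> nat \<times> nat \<Rightarrow> complex" where
    "e = (\<lambda>j \<alpha>. if j = 0 then cnj (monomials d x \<alpha>) / of_real (sqrt N)
       else if j = 1 then cnj (monomials_deriv d x v1 \<alpha>) / of_real q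
       else cnj (monomials_deriv d x v2 \<alpha>) / of_real q)"
  define J where "J = {0, 1, 2 :: nat}"
  have xx: "hermitian x x = 1" "hermitian v1 v1 = 1" "hermitian v2 v2 = 1" using x v by (simp_all add: hermitian_self)
  have c00: "cinner I (e 0) (e 0) = 1"
  proof -
    have "cinner I (e 0) (e 0) = (\<Sum>\<alpha>\<in>I. monomials d x \<alpha> * cnj (monomials d x \<alpha>)) / of_real N"
      by (simp add: cinner_def e_def sum_divide_distrib NN mult.commute[of "cnj _"])
    then show ?thesis using N by (simp add: I_def monomials_kernel xx N_def)
  qed
  have c0j: "cinner I (\<lambda>\<alpha>. cnj (monomials d x \<alpha>) / of_real (sqrt N)) (\<lambda>\<alpha>. cnj (monomials_deriv d x v \<alpha>) / of_real q) = 0"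
    if "hermitian v x = 0" for v
  proof -
    have "cinner I (\<lambda>\<alpha>. cnj (monomials d x \<alpha>) / of_real (sqrt N)) (\<lambda>\<alpha>. cnj (monomials_deriv d x v \<alpha>) / of_real q) =
       (\<Sum>\<alpha>\<in>I. cnj (monomials d x \<alpha>) * monomials_deriv d x v \<alpha>) / (of_real (sqrt N) * of_real q)"
      by (simp add: cinner_def sum_divide_distrib)
    then show ?thesis by (simp add: I_def monomials_deriv_kernel that)
  qed
  have cjj: "cinner I (\<lambda>\<alpha>. cnj (monomials_deriv d x v \<alpha>) / of_real q) (\<lambda>\<alpha>. cnj (monomials_deriv d x w \<alpha>) / of_real q) = hermitian w v"
    if "hermitian w x = 0" for v w
  proof -
    have "cinner I (\<lambda>\<alpha>. cnj (monomials_deriv d x v \<alpha>) / of_real q) (\<lambda>\<alpha>. cnj (monomials_deriv d x w \<alpha>) / of_real q) =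
       (\<Sum>\<alpha>\<in>I. cnj (monomials_deriv d x v \<alpha>) * monomials_deriv d x w \<alpha>) / (of_real q * of_real q)"
      by (simp add: cinner_def sum_divide_distrib)
    then show ?thesis using N d by (simp add: I_def monomials_deriv_deriv_kernel[OF that] qq xx N_def)
  qed
  have comm: "cinner I a b = cnj (cinner I b a)" for a b by (rule cinner_commute)
  have e: "cinner I (e j) (e k) = (if j = k then 1 else 0)" if "j \<in> J" "k \<in> J" for j k
  proof -
    have e0: "e 0 = (\<lambda>\<alpha>. cnj (monomials d x \<alpha>) / of_real (sqrt N))"
      and e1: "e 1 = (\<lambda>\<alpha>. cnj (monomials_deriv d x v1 \<alpha>) / of_real q)"
      and e2: "e 2 = (\<lambda>\<alpha>. cnj (monomials_deriv d x v2 \<alpha>) / of_real q)"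
      by (simp_all add: e_def)
    have "cinner I (e 0) (e 1) = 0" "cinner I (e 0) (e 2) = 0" "cinner I (e 1) (e 2) = 0"
      "cinner I (e 1) (e 1) = 1" "cinner I (e 2) (e 2) = 1"
      unfolding e0 e1 e2 using c0j[OF v(3)] c0j[OF v(4)] cjj[OF v(4), of v1] cjj[OF v(3), of v1] cjj[OF v(4), of v2] v21 xx
      by simp_all
    moreover from this have "cinner I (e 1) (e 0) = 0" "cinner I (e 2) (e 0) = 0" "cinner I (e 2) (e 1) = 0"
      using comm[of "e 1" "e 0"] comm[of "e 2" "e 0"] comm[of "e 2" "e 1"] by simp_all
    ultimately show ?thesis using c00 that by (auto simp: J_def)
  qed
  define t :: "nat \<Rightarrow> real" where "t = (\<lambda>j. if j = 0 then s0 / sqrt N else s1 / q)"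
  have t: "t j > 0" if "j \<in> J" for j using s N q by (simp add: t_def)
  have J: "finite J" by (simp add: J_def)
  define W where "W = {a \<in> space (uniform_csphere I). \<forall>j\<in>J. norm (cinner I a (e j)) \<le> t j}"
  note sb = csphere_small_ball[where e = e and t = t, OF I J e t, folded W_def]
  show thesis
  proof (rule that)
    show "W \<in> sets (mu d)" using sb(1) by (simp add: mu_def I_def)
    have cN: "real (card I) \<le> 2 * N" unfolding I_def N_def by (rule card_exponents)
    have p: "36 * real (card I) * (s0 / sqrt N)\<^sup>2 \<le> 72 * s0\<^sup>2"
    proof -
      have "36 * real (card I) * (s0 / sqrt N)\<^sup>2 \<le> 36 * (2 * N) * (s0 / sqrt N)\<^sup>2"
        using cN by (intro mult_right_mono mult_left_mono) auto
      then show ?thesis using N by (simp add: power_divide)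
    qed
    have p1: "36 * real (card I) * (s1 / q)\<^sup>2 \<le> 72 * s1\<^sup>2 / real d"
    proof -
      have "36 * real (card I) * (s1 / q)\<^sup>2 \<le> 36 * (2 * N) * (s1 / q)\<^sup>2"
        using cN by (intro mult_right_mono mult_left_mono) auto
      also have "\<dots> = 72 * s1\<^sup>2 / real d"
        using N d by (simp add: power_divide power2_eq_square[of q] q(2))
      finally show ?thesis .
    qed
    have "(\<Prod>j\<in>J. 36 * real (card I) * (t j)\<^sup>2) =
        (36 * real (card I) * (s0 / sqrt N)\<^sup>2) * ((36 * real (card I) * (s1 / q)\<^sup>2) * (36 * real (card I) * (s1 / q)\<^sup>2))"
      by (simp add: J_def t_def)
    also have "\<dots> \<le> (72 * s0\<^sup>2) * ((72 * s1\<^sup>2 / real d) * (72 * s1\<^sup>2 / real d))"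
      by (intro mult_mono p p1 mult_nonneg_nonneg) auto
    also have "\<dots> = 72 ^ 3 * s0\<^sup>2 * s1 ^ 4 / (real d)\<^sup>2"
      by (simp add: power2_eq_square power4_eq_xxxx)
    finally have "exp (2 * real (card J)) * (\<Prod>j\<in>J. 36 * real (card I) * (t j)\<^sup>2) \<le> exp 6 * (72 ^ 3 * s0\<^sup>2 * s1 ^ 4 / (real d)\<^sup>2)"
      by (intro mult_mono) (auto simp: J_def intro!: prod_nonneg)
    then show "measure (mu d) W \<le> exp 6 * 72 ^ 3 * s0\<^sup>2 * s1 ^ 4 / (real d)\<^sup>2"
      using sb(2) by (simp add: mu_def I_def mult.assoc)
    fix a assume a: "a \<in> space (mu d)" and f: "norm (hom_poly d a x) \<le> s0"
      and g: "\<And>v. norm v = 1 \<Longrightarrow> hermitian v x = 0 \<Longrightarrow> norm (hermitian v (grad d a x)) \<le> s1"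
    have "cinner I a (e 0) = hom_poly d a x / of_real (sqrt N)"
      by (simp add: cinner_def e_def I_def hom_poly_eq sum_divide_distrib)
    moreover have "cinner I a (e 1) = hermitian v1 (grad d a x) / of_real q"
       "cinner I a (e 2) = hermitian v2 (grad d a x) / of_real q"
      by (simp_all add: cinner_def e_def I_def hermitian_grad sum_divide_distrib)
    ultimately show "a \<in> W"
      using a f g[OF v(1,3)] g[OF v(2,4)] N q(1) by (simp add: W_def J_def t_def mu_def I_def norm_divide divide_right_mono)
  qed
qed

section \<open>A net in the projective plane\<close>

lemma floor_grid:
  fixes r h :: real
  assumes "h > 0" "\<bar>r\<bar> \<le> 1"
  obtains p :: int where "\<bar>r - of_int p * h\<bar> \<le> h" "p \<in> {- \<lceil>1 / h\<rceil>..\<lceil>1 / h\<rceil>}"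
proof -
  define p where "p = \<lfloor>r / h\<rfloor>"
  have rh: "- (1 / h) \<le> r / h" "r / h \<le> 1 / h" using assms by (simp_all add: field_simps abs_le_iff)
  have "of_int p \<le> r / h" "r / h < of_int p + 1" by (simp_all add: p_def)
  then have "of_int p * h \<le> r" "r < (of_int p + 1) * h" using assms(1) by (simp_all add: field_simps)
  then have "\<bar>r - of_int p * h\<bar> \<le> h" by (simp add: algebra_simps)
  moreover have "- \<lceil>1 / h\<rceil> \<le> p" "p \<le> \<lceil>1 / h\<rceil>" using rh unfolding p_def by linarith+
  ultimately show thesis using that by simp
qed

text \<open>Dividing by a largest coordinate puts the two others in the unit disc, where they are
  rounded to a grid. Four real coordinates with at most \<open>5 / h = 60 / \<epsilon>\<close>
  values each, and nine pairs \<open>(l, m)\<close>, give the constant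
  \<open>9 * 60 ^ 4\<close>.\<close>

lemma projective_net:
  fixes \<epsilon> :: real
  assumes \<epsilon>: "0 < \<epsilon>" "\<epsilon> \<le> 1"
  obtains X :: "(complex ^ 3) set" where "finite X" "\<And>x. x \<in> X \<Longrightarrow> norm x = 1" "real (card X) \<le> 116640000 / \<epsilon> ^ 4"
    "\<And>z. norm z = 1 \<Longrightarrow> \<exists>x\<in>X. \<exists>c u. c \<noteq> 0 \<and> z = c *s (x + u) \<and> hermitian u x = 0 \<and> norm u \<le> \<epsilon>"
proof -
  \<comment> \<open>Rounding moves each coordinate by at most \<open>2 * h\<close>, hence the vector
    by at most \<open>6 * h = \<epsilon> / 2\<close>; rescaling by \<open>1 / b\<close> with
    \<open>norm b \<ge> 1 / 2\<close> doubles this.\<close>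
  define h where "h = \<epsilon> / 12"
  have h: "h > 0" "h \<le> 1" using \<epsilon> by (simp_all add: h_def)
  define G where "G = {- \<lceil>1 / h\<rceil>..\<lceil>1 / h\<rceil>}"
  define w :: "3 \<Rightarrow> 3 \<Rightarrow> int \<Rightarrow> int \<Rightarrow> int \<Rightarrow> int \<Rightarrow> complex ^ 3" where
    "w = (\<lambda>l m p q p' q'. \<chi> i. if i = l then Complex (of_int p * h) (of_int q * h)
       else if i = m then Complex (of_int p' * h) (of_int q' * h) else 1)"
  define X where "X = (\<lambda>(l, m, p, q, p', q'). sgn (w l m p q p' q')) ` (UNIV \<times> UNIV \<times> G \<times> G \<times> G \<times> G) - {0}"
  show thesis
  proof (rule that)
    show "finite X" by (simp add: X_def G_def)
    show "norm x = 1" if "x \<in> X" for x using that by (auto simp: X_def norm_sgn sgn_zero_iff)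
    show "real (card X) \<le> 116640000 / \<epsilon> ^ 4"
    proof -
      have cG: "real (card G) \<le> 5 / h"
      proof -
        have "\<lceil>1 / h\<rceil> \<ge> 0" using h ceiling_mono[of 0 "1 / h"] by simp
        then have "real (card G) = 2 * of_int \<lceil>1 / h\<rceil> + 1"
          by (simp add: G_def)
        also have "\<dots> \<le> 2 * (1 / h + 1) + 1"
          by (intro add_right_mono mult_left_mono of_int_ceiling_le_add_one) simp
        also have "\<dots> \<le> 5 / h" using h by (simp add: field_simps)
        finally show ?thesis .
      qed
      define Y :: "(3 \<times> 3 \<times> int \<times> int \<times> int \<times> int) set" where "Y = UNIV \<times> UNIV \<times> G \<times> G \<times> G \<times> G"
      have Y: "finite Y" by (simp add: Y_def G_def)
      have "card X \<le> card ((\<lambda>(l, m, p, q, p', q'). sgn (w l m p q p' q')) ` Y)"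
        unfolding X_def Y_def[symmetric] by (rule card_mono[OF finite_imageI[OF Y] Diff_subset])
      also have "\<dots> \<le> card Y" by (rule card_image_le[OF Y])
      also have "\<dots> = 9 * card G ^ 4" by (simp add: Y_def card_cartesian_product power4_eq_xxxx)
      finally have "real (card X) \<le> real (9 * card G ^ 4)" by (simp only: of_nat_le_iff)
      also have "\<dots> = 9 * real (card G) ^ 4" by simp
      also have "\<dots> \<le> 9 * (5 / h) ^ 4" using cG by (intro mult_left_mono power_mono) auto
      also have "\<dots> = 116640000 / \<epsilon> ^ 4" by (simp add: h_def power_divide)
      finally show ?thesis .
    qed
    fix z :: "complex ^ 3" assume z: "norm z = 1"
    obtain k where k: "\<And>i. norm (z $ i) \<le> norm (z $ k)"
    proof -
      have "Max (range (\<lambda>i. norm (z $ i))) \<in> range (\<lambda>i. norm (z $ i))" by (intro Max_in) auto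
      then obtain k where k: "Max (range (\<lambda>i. norm (z $ i))) = norm (z $ k)" by (rule rangeE)
      have "norm (z $ i) \<le> norm (z $ k)" for i unfolding k[symmetric] by (intro Max_ge) auto
      then show thesis by (rule that)
    qed
    have zk: "z $ k \<noteq> 0"
    proof
      assume "z $ k = 0"
      then have "z $ i = 0" for i using k[of i] by simp
      then have "z = 0" by (simp add: vec_eq_iff)
      with z show False by simp
    qed
    obtain l m where lm: "l \<noteq> k" "m \<noteq> k" "l \<noteq> m" "\<And>i. i = l \<or> i = m \<or> i = k"
    proof -
      have 12: "(1 :: 3) \<noteq> 2" "(1 :: 3) \<noteq> 3" "(2 :: 3) \<noteq> 3" by simp_all
      consider "k = 1" | "k = 2" | "k = 3" using exhaust_3 by blast
      then show thesis
      proof cases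
        case 1 then show thesis using that[of 2 3] 12 exhaust_3 by metis
      next
        case 2 then show thesis using that[of 1 3] 12 exhaust_3 by metis
      next
        case 3 then show thesis using that[of 1 2] 12 exhaust_3 by metis
      qed
    qed
    define y where "y = (1 / z $ k) *s z"
    have y1: "norm (y $ i) \<le> 1" for i using k[of i] zk by (simp add: y_def norm_divide divide_le_eq)
    have re: "\<bar>Re (y $ i)\<bar> \<le> 1" "\<bar>Im (y $ i)\<bar> \<le> 1" for i
      using y1[of i] abs_Re_le_cmod[of "y $ i"] abs_Im_le_cmod[of "y $ i"] by linarith+
    obtain p where p: "\<bar>Re (y $ l) - of_int p * h\<bar> \<le> h" "p \<in> G" using floor_grid[OF h(1) re(1)] unfolding G_def by blast
    obtain q where q: "\<bar>Im (y $ l) - of_int q * h\<bar> \<le> h" "q \<in> G" using floor_grid[OF h(1) re(2)] unfolding G_def by blast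
    obtain p' where p': "\<bar>Re (y $ m) - of_int p' * h\<bar> \<le> h" "p' \<in> G" using floor_grid[OF h(1) re(1)] unfolding G_def by blast
    obtain q' where q': "\<bar>Im (y $ m) - of_int q' * h\<bar> \<le> h" "q' \<in> G" using floor_grid[OF h(1) re(2)] unfolding G_def by blast
    define w0 where "w0 = w l m p q p' q'"
    define e where "e = y - w0"
    have "norm (e $ i) \<le> 2 * h" for i
    proof -
      have "norm (e $ i) \<le> \<bar>Re (e $ i)\<bar> + \<bar>Im (e $ i)\<bar>" by (rule cmod_le)
      moreover have "i = l \<or> i = m \<or> i = k" by (rule lm)
      ultimately show ?thesis
        using p(1) q(1) p'(1) q'(1) lm(1-3) h(1) zk by (auto simp: e_def w0_def w_def y_def)
    qed
    then have "(\<Sum>i\<in>UNIV. norm (e $ i)) \<le> (\<Sum>i\<in>(UNIV :: 3 set). 2 * h)" by (intro sum_mono)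
    moreover have "norm e \<le> (\<Sum>i\<in>UNIV. norm (e $ i))" unfolding norm_vec_def by (rule L2_set_le_sum) simp
    ultimately have e: "norm e \<le> \<epsilon> / 2" by (simp add: h_def)
    have "w0 $ k = 1" using lm(1,2) by (simp add: w0_def w_def)
    moreover have "norm (w0 $ k) \<le> norm w0" by (rule Finite_Cartesian_Product.norm_nth_le)
    ultimately have w1: "norm w0 \<ge> 1" by simp
    then have w0nz: "w0 \<noteq> 0" by auto
    define x where "x = sgn w0"
    have x1: "norm x = 1" unfolding x_def using w0nz by (rule norm_sgn_vec)
    have xX: "x \<in> X"
    proof -
      have "(l, m, p, q, p', q') \<in> UNIV \<times> UNIV \<times> G \<times> G \<times> G \<times> G" using p q p' q' by simp
      then have "x \<in> (\<lambda>(l, m, p, q, p', q'). sgn (w l m p q p' q')) ` (UNIV \<times> UNIV \<times> G \<times> G \<times> G \<times> G)"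
        by (rule rev_image_eqI) (simp add: x_def w0_def)
      moreover have "x \<noteq> 0" using x1 by auto
      ultimately show ?thesis by (simp add: X_def)
    qed
    have w0x: "w0 = of_real (norm w0) *s x" using w0nz by (simp add: x_def sgn_eq_scale)
    have hx: "hermitian x x = 1" using x1 by (simp add: hermitian_self)
    define b where "b = hermitian y x"
    define b' where "b' = hermitian e x"
    have yw: "y = e + of_real (norm w0) *s x" using w0x by (simp add: e_def)
    have bb: "b = of_real (norm w0) + b'"
      unfolding b_def b'_def by (subst yw) (simp add: hermitian_add_left hermitian_scale_left hx)
    have "norm b' \<le> 1 / 2" using norm_hermitian_le[of e x] x1 e \<epsilon>(2) by (simp add: b'_def)
    moreover have "norm b \<ge> norm w0 - norm b'" unfolding bb using norm_diff_ineq[of "of_real (norm w0) :: complex" b'] by simp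
    ultimately have b: "norm b \<ge> 1 / 2" using w1 by linarith
    then have b0: "b \<noteq> 0" by auto
    define u where "u = y - b *s x"
    have ux: "hermitian u x = 0" by (simp add: u_def hermitian_diff_left hermitian_scale_left hx b_def)
    have "e = b' *s x + u" unfolding u_def bb by (subst yw) (simp add: algebra_simps)
    then have "(norm e)\<^sup>2 = (norm (b' *s x))\<^sup>2 + (norm u)\<^sup>2"
      using norm_add_orthogonal[of u "b' *s x"] ux by (simp add: hermitian_scale_right)
    then have "(norm u)\<^sup>2 \<le> (norm e)\<^sup>2" by simp
    then have ue: "norm u \<le> \<epsilon> / 2" using e power2_le_imp_le[of "norm u" "norm e"] by simp
    have "norm ((1 / b) *s u) \<le> \<epsilon>"
    proof -
      have "norm ((1 / b) *s u) = norm u / norm b" by (simp add: norm_vector_scale norm_divide)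
      also have "\<dots> \<le> (\<epsilon> / 2) / (1 / 2)" using ue b \<epsilon>(1) by (intro frac_le) auto
      finally show ?thesis by simp
    qed
    moreover have "z = (z $ k * b) *s (x + (1 / b) *s u)"
      using b0 zk by (simp add: u_def y_def vec_eq_iff field_simps)
    moreover have "hermitian ((1 / b) *s u) x = 0" using ux by (simp add: hermitian_scale_left)
    moreover have "z $ k * b \<noteq> 0" using zk b0 by simp
    ultimately show "\<exists>x\<in>X. \<exists>c u. c \<noteq> 0 \<and> z = c *s (x + u) \<and> hermitian u x = 0 \<and> norm u \<le> \<epsilon>"
      using xX by blast
  qed
qed

text \<open>Rescaling the zero to \<open>x + u\<close> at most doubles its gradient; then expand
  from \<open>x + u\<close> back to \<open>x\<close>. The value gains an additional factor
  \<open>\<epsilon>\<close> over the derivative because it vanishes at \<open>x + u\<close>.\<close>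

lemma almost_singular_at_zero:
  assumes d: "d \<ge> 1" and M: "curvature_bound d a \<le> M" and x: "norm x = 1"
    and z: "hom_poly d a z = 0" "norm (grad d a z) \<le> \<delta>" "norm z = 1"
    and c: "c \<noteq> 0" "z = c *s (x + u)" and u: "hermitian u x = 0" "norm u \<le> \<epsilon>" and \<epsilon>: "\<epsilon> \<le> chart_radius d"
  shows "norm (hom_poly d a x) \<le> \<epsilon> * (2 * \<delta> + M * \<epsilon>)"
    "norm v = 1 \<Longrightarrow> hermitian v x = 0 \<Longrightarrow> norm (hermitian v (grad d a x)) \<le> 2 * \<delta> + M * \<epsilon>"
proof -
  have M0: "M \<ge> 0" using M curvature_bound_nonneg[of d a] by linarith
  have \<epsilon>0: "\<epsilon> \<ge> 0" using u(2) norm_ge_zero order_trans by blast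
  have ur: "norm u \<le> chart_radius d" using u(2) \<epsilon> by linarith
  have r0: "chart_radius d > 0" by (rule chart_radius_pos[OF d])
  have f0: "hom_poly d a (x + u) = 0"
    using z(1) c by (simp add: hom_poly_scale del: vector_add_ldistrib)
  have g: "norm (grad d a (x + u)) \<le> 2 * \<delta>"
  proof -
    define \<nu> where "\<nu> = norm (x + u)"
    have c\<nu>: "norm c * \<nu> = 1" using z(3) c(2) by (simp add: \<nu>_def norm_vector_scale del: vector_add_ldistrib)
    then have \<nu>0: "\<nu> > 0" using c(1) by (metis mult_zero_right norm_ge_zero order_le_less zero_neq_one \<nu>_def)
    have "1 \<le> \<nu>\<^sup>2" using norm_add_orthogonal[OF u(1)] x by (simp add: \<nu>_def)
    then have \<nu>1: "1 \<le> \<nu>" using \<nu>0 by (metis one_power2 power2_le_imp_le less_imp_le)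
    have \<nu>d: "\<nu> ^ d \<le> 2" unfolding \<nu>_def using x u ur d r0 by (intro tangential_bound(2)) auto
    have gz: "norm (grad d a z) = norm c ^ (d - 1) * norm (grad d a (x + u))"
      unfolding c(2) grad_scale[OF c(1) d] by (simp add: norm_vector_scale norm_power)
    have c\<nu>d: "\<nu> ^ (d - 1) * norm c ^ (d - 1) = 1"
      using c\<nu> by (simp add: power_mult_distrib[symmetric] mult.commute)
    have "norm (grad d a (x + u)) = \<nu> ^ (d - 1) * norm (grad d a z)"
      unfolding gz mult.assoc[symmetric] c\<nu>d by simp
    also have "\<dots> \<le> 2 * \<delta>"
      using power_increasing[of "d - 1" d \<nu>] \<nu>1 \<nu>d z(2) by (intro mult_mono) auto
    finally show ?thesis .
  qed
  have "norm (hom_poly d a (x + 0) - hom_poly d a (x + u) - hermitian (0 - u) (grad d a (x + u)))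
     \<le> curvature_bound d a * norm u * norm (0 - u)"
    using x u ur d r0 by (intro taylor_tangential) auto
  also have "\<dots> \<le> M * \<epsilon> * \<epsilon>"
    using M u(2) M0 \<epsilon>0 by (intro mult_mono) auto
  finally have 1: "norm (hom_poly d a x + hermitian u (grad d a (x + u))) \<le> M * \<epsilon> * \<epsilon>"
    by (simp add: f0 hermitian_minus_left)
  have "norm (hermitian u (grad d a (x + u))) \<le> norm u * norm (grad d a (x + u))" by (rule norm_hermitian_le)
  also have "\<dots> \<le> \<epsilon> * (2 * \<delta>)" using u(2) g \<epsilon>0 by (intro mult_mono) auto
  finally have 2: "norm (hermitian u (grad d a (x + u))) \<le> \<epsilon> * (2 * \<delta>)" .
  have "norm (hom_poly d a x) \<le> norm (hom_poly d a x + hermitian u (grad d a (x + u))) + norm (hermitian u (grad d a (x + u)))"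
    by (metis add_diff_cancel_right' norm_triangle_ineq4)
  then show "norm (hom_poly d a x) \<le> \<epsilon> * (2 * \<delta> + M * \<epsilon>)" using 1 2 by (simp add: distrib_left mult_ac)
  assume v: "norm v = 1" "hermitian v x = 0"
  have "norm (hermitian v (grad d a (x + 0)) - hermitian v (grad d a (x + u))) \<le> curvature_bound d a * norm v * norm (0 - u)"
    using x u ur d r0 v by (intro grad_tangential_lipschitz) auto
  also have "\<dots> \<le> M * 1 * \<epsilon>" using M u(2) M0 v by (intro mult_mono) auto
  finally have 3: "norm (hermitian v (grad d a x) - hermitian v (grad d a (x + u))) \<le> M * \<epsilon>" by simp
  have "norm (hermitian v (grad d a (x + u))) \<le> norm v * norm (grad d a (x + u))" by (rule norm_hermitian_le)
  then have 4: "norm (hermitian v (grad d a (x + u))) \<le> 2 * \<delta>" using v g by simp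
  show "norm (hermitian v (grad d a x)) \<le> 2 * \<delta> + M * \<epsilon>"
    using 3 4 norm_triangle_sub[of "hermitian v (grad d a x)" "hermitian v (grad d a (x + u))"] by linarith
qed

lemma space_mu: "a \<in> space (mu d) \<Longrightarrow> cnorm (exponents d) a = 1"
  by (simp add: mu_def space_uniform_csphere finite_exponents exponents_nonempty)

lemma prob_space_mu: "prob_space (mu d)"
  by (simp add: mu_def prob_space_uniform_csphere finite_exponents exponents_nonempty)

lemma kernel_const_le: "d \<ge> 1 \<Longrightarrow> kernel_const d \<le> 3 * (real d)\<^sup>2"
proof -
  assume "d \<ge> 1"
  then have d: "real d \<ge> 1" by simp
  then have "(real d + 2) * (real d + 1) \<le> (3 * real d) * (2 * real d)" by (intro mult_mono) auto
  then show ?thesis by (simp add: kernel_const_def power2_eq_square)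
qed

text \<open>The factors come from the size of the net, the estimate at one point, the six factors 3
  in \<open>s0\<^sup>2 * s1 ^ 4\<close>, and \<open>M\<^sup>2 \<le> 3072 * d ^ 4\<close>.\<close>

definition singular_const :: real where
  "singular_const = 116640000 * exp 6 * 72 ^ 3 * 3 ^ 6 * 3072"

lemma almost_singular_measure:
  assumes d: "d \<ge> 1" and \<delta>: "0 < \<delta>" "\<delta> \<le> 1"
  obtains W where "W \<in> sets (mu d)" "measure (mu d) W \<le> singular_const * \<delta> ^ 4 * (real d)\<^sup>2"
    "\<And>a z. a \<in> space (mu d) \<Longrightarrow> norm z = 1 \<Longrightarrow> hom_poly d a z = 0 \<Longrightarrow> norm (grad d a z) \<le> \<delta> \<Longrightarrow> a \<in> W"
proof -
  interpret prob_space "mu d" by (rule prob_space_mu)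
  define M where "M = 32 * real d * sqrt (kernel_const d)"
  have d1: "real d \<ge> 1" using d by simp
  have N1: "sqrt (kernel_const d) \<ge> 1"
  proof -
    have "2 * 1 \<le> (real d + 2) * (real d + 1)" using d1 by (intro mult_mono) auto
    then show ?thesis by (simp add: kernel_const_def)
  qed
  have M32: "M \<ge> 32 * real d"
    using mult_left_mono[OF N1, of "32 * real d"] by (simp add: M_def)
  then have M: "M > 0" "M \<ge> 1" using d1 by linarith+
  have Ma: "curvature_bound d a = M" if "a \<in> space (mu d)" for a
    using space_mu[OF that] by (simp add: curvature_bound_def sup_bound_def M_def)
  have M2: "M\<^sup>2 \<le> 3072 * (real d) ^ 4"
  proof -
    have "M\<^sup>2 = 1024 * (real d)\<^sup>2 * kernel_const d"
      using kernel_const_pos[of d] by (simp add: M_def power_mult_distrib)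
    also have "\<dots> \<le> 1024 * (real d)\<^sup>2 * (3 * (real d)\<^sup>2)"
      using kernel_const_le[OF d] by (intro mult_left_mono) auto
    finally show ?thesis by (simp add: power4_eq_xxxx power2_eq_square)
  qed
  define \<epsilon> where "\<epsilon> = \<delta> / M"
  have \<epsilon>: "\<epsilon> > 0" "M * \<epsilon> = \<delta>" using \<delta> M by (simp_all add: \<epsilon>_def)
  have \<epsilon>1: "\<epsilon> \<le> 1" using \<delta> M by (simp add: \<epsilon>_def divide_le_eq)
  have \<epsilon>r: "\<epsilon> \<le> chart_radius d"
  proof -
    have "\<epsilon> \<le> 1 / (32 * real d)" unfolding \<epsilon>_def using \<delta> M32 d1 by (intro frac_le) auto
    also have "\<dots> \<le> 1 / (4 * sqrt (real d))"
    proof (intro divide_left_mono)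
      have "sqrt (real d) \<le> real d" using d1 by (simp add: real_le_lsqrt power2_eq_square)
      then show "4 * sqrt (real d) \<le> 32 * real d" using d1 by linarith
    qed (use d1 in auto)
    finally show ?thesis by (simp add: chart_radius_def)
  qed
  obtain X where X: "finite X" "\<And>x. x \<in> X \<Longrightarrow> norm x = 1" "real (card X) \<le> 116640000 / \<epsilon> ^ 4"
    "\<And>z. norm z = 1 \<Longrightarrow> \<exists>x\<in>X. \<exists>c u. c \<noteq> 0 \<and> z = c *s (x + u) \<and> hermitian u x = 0 \<and> norm u \<le> \<epsilon>"
    using projective_net[OF \<epsilon>(1) \<epsilon>1] by blast
  \<comment> \<open>Equal to \<open>2 * \<delta> + M * \<epsilon>\<close>, as
    \<open>\<epsilon>\<close> is chosen to make the Taylor error \<open>M * \<epsilon>\<close> equal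
    to \<open>\<delta>\<close>.\<close>
  define s1 where "s1 = 3 * \<delta>"
  define s0 where "s0 = \<epsilon> * s1"
  have s: "s0 > 0" "s1 > 0" using \<delta> \<epsilon> by (simp_all add: s0_def s1_def)
  define K where "K = exp 6 * 72 ^ 3 * s0\<^sup>2 * s1 ^ 4 / (real d)\<^sup>2"
  have K: "K \<ge> 0" by (simp add: K_def)
  have "\<forall>x\<in>X. \<exists>W. W \<in> sets (mu d) \<and> (\<forall>a. a \<in> space (mu d) \<longrightarrow> norm (hom_poly d a x) \<le> s0 \<longrightarrow>
       (\<forall>v. norm v = 1 \<longrightarrow> hermitian v x = 0 \<longrightarrow> norm (hermitian v (grad d a x)) \<le> s1) \<longrightarrow> a \<in> W) \<and> measure (mu d) W \<le> K"
  proof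
    fix x assume "x \<in> X"
    then have "norm x = 1" by (rule X)
    from almost_singular_at_point[OF d this s] show "\<exists>W. W \<in> sets (mu d) \<and> (\<forall>a. a \<in> space (mu d) \<longrightarrow> norm (hom_poly d a x) \<le> s0 \<longrightarrow>
       (\<forall>v. norm v = 1 \<longrightarrow> hermitian v x = 0 \<longrightarrow> norm (hermitian v (grad d a x)) \<le> s1) \<longrightarrow> a \<in> W) \<and> measure (mu d) W \<le> K"
      unfolding K_def by metis
  qed
  then obtain W where W: "\<And>x. x \<in> X \<Longrightarrow> W x \<in> sets (mu d)" "\<And>x. x \<in> X \<Longrightarrow> measure (mu d) (W x) \<le> K"
    "\<And>x a. x \<in> X \<Longrightarrow> a \<in> space (mu d) \<Longrightarrow> norm (hom_poly d a x) \<le> s0 \<Longrightarrow>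
       (\<And>v. norm v = 1 \<Longrightarrow> hermitian v x = 0 \<Longrightarrow> norm (hermitian v (grad d a x)) \<le> s1) \<Longrightarrow> a \<in> W x"
    by (auto dest!: bchoice)
  show thesis
  proof (rule that)
    show "(\<Union>x\<in>X. W x) \<in> sets (mu d)" using X(1) W(1) by auto
    have "measure (mu d) (\<Union>x\<in>X. W x) \<le> (\<Sum>x\<in>X. measure (mu d) (W x))"
      using X(1) W(1) by (intro measure_UNION_le) auto
    also have "\<dots> \<le> (\<Sum>x\<in>X. K)" by (intro sum_mono W(2))
    also have "\<dots> \<le> 116640000 / \<epsilon> ^ 4 * K" using mult_right_mono[OF X(3) K] by simp
    also have "\<dots> = 116640000 * exp 6 * 72 ^ 3 * 3 ^ 6 * \<delta> ^ 4 * (M\<^sup>2 / (real d)\<^sup>2)"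
    proof -
      have A1: "s0\<^sup>2 * s1 ^ 4 = 3 ^ 6 * (\<epsilon>\<^sup>2 * \<delta> ^ 6)"
        by (simp add: s0_def s1_def power_mult_distrib power2_eq_square power4_eq_xxxx eval_nat_numeral)
      have A2: "\<epsilon>\<^sup>2 * \<delta> ^ 6 / \<epsilon> ^ 4 = \<delta> ^ 4 * M\<^sup>2"
      proof -
        have "\<delta> ^ 6 = \<delta> ^ 4 * (M * \<epsilon>)\<^sup>2" unfolding \<epsilon>(2) by (simp add: power_add[symmetric])
        then show ?thesis using \<epsilon>(1) by (simp add: power_mult_distrib field_simps power4_eq_xxxx power2_eq_square)
      qed
      have "s0\<^sup>2 * s1 ^ 4 / \<epsilon> ^ 4 = 3 ^ 6 * (\<epsilon>\<^sup>2 * \<delta> ^ 6 / \<epsilon> ^ 4)" unfolding A1 by simp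
      then have A3: "s0\<^sup>2 * s1 ^ 4 / \<epsilon> ^ 4 = 3 ^ 6 * \<delta> ^ 4 * M\<^sup>2" unfolding A2 by simp
      have "116640000 / \<epsilon> ^ 4 * K = 116640000 * exp 6 * 72 ^ 3 * (s0\<^sup>2 * s1 ^ 4 / \<epsilon> ^ 4) / (real d)\<^sup>2"
        by (simp add: K_def mult_ac)
      then show ?thesis unfolding A3 by simp
    qed
    also have "\<dots> \<le> 116640000 * exp 6 * 72 ^ 3 * 3 ^ 6 * \<delta> ^ 4 * (3072 * (real d)\<^sup>2)"
    proof (intro mult_left_mono)
      have "M\<^sup>2 / (real d)\<^sup>2 \<le> 3072 * (real d) ^ 4 / (real d)\<^sup>2" using M2 by (intro divide_right_mono) auto
      also have "\<dots> = 3072 * (real d)\<^sup>2" using d1 by (simp add: field_simps power4_eq_xxxx power2_eq_square)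
      finally show "M\<^sup>2 / (real d)\<^sup>2 \<le> 3072 * (real d)\<^sup>2" .
    qed simp
    finally show "measure (mu d) (\<Union>x\<in>X. W x) \<le> singular_const * \<delta> ^ 4 * (real d)\<^sup>2"
      by (simp add: singular_const_def mult_ac)
    fix a z assume a: "a \<in> space (mu d)" and z: "norm z = 1" "hom_poly d a z = 0" "norm (grad d a z) \<le> \<delta>"
    obtain x c u where x: "x \<in> X" "c \<noteq> 0" "z = c *s (x + u)" "hermitian u x = 0" "norm u \<le> \<epsilon>"
      using X(4)[OF z(1)] by blast
    have "2 * \<delta> + M * \<epsilon> = s1" by (simp add: \<epsilon>(2) s1_def)
    then have "a \<in> W x"
      using almost_singular_at_zero[OF d _ X(2)[OF x(1)] z(2,3,1) x(2-5) \<epsilon>r, of M] Ma[OF a]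
      by (intro W(3)[OF x(1) a]) (auto simp: s0_def)
    then show "a \<in> (\<Union>x\<in>X. W x)" using x(1) by blast
  qed
qed

section \<open>Measurability of the systole\<close>

lemma cnorm_triangle: "cnorm I (\<lambda>i. a i + b i) \<le> cnorm I a + cnorm I b"
  unfolding cnorm_def
  by (rule order.trans[OF L2_set_mono L2_set_triangle_ineq]) (auto simp: norm_triangle_ineq)

text \<open>Separability connects the norm with the product sigma-algebra: a relatively open set is
  the union of the countably many balls inside it whose centres have coordinates in \<open>D\<close>
  and whose radii are \<open>1 / Suc n\<close>.\<close>

lemma sets_uniform_csphere_open:
  assumes I: "finite (I :: 'i set)" "I \<noteq> {}" and sub: "S \<subseteq> space (uniform_csphere I)"
    and op: "\<And>a. a \<in> S \<Longrightarrow> \<exists>r>0. \<forall>b\<in>space (uniform_csphere I). cnorm I (\<lambda>i. b i - a i) < r \<longrightarrow> b \<in> S"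
  shows "S \<in> sets (uniform_csphere I)"
proof -
  let ?B = "\<Pi>\<^sub>M i\<in>I. (borel :: complex measure)"
  obtain D :: "complex set" where D: "countable D" "\<And>X. open X \<Longrightarrow> X \<noteq> {} \<Longrightarrow> \<exists>d\<in>D. d \<in> X"
    using countable_dense_setE by blast
  define Q where "Q = (\<Pi>\<^sub>E i\<in>I. D)"
  have Q: "countable Q" unfolding Q_def using I(1) D(1) by (intro countable_PiE)
  define U where "U = (\<lambda>(q, n). {b \<in> space ?B. cnorm I (\<lambda>i. b i - q i) < 1 / real (Suc n)} \<inter> space (uniform_csphere I))"
  have U: "U x \<in> sets (uniform_csphere I)" for x
  proof -
    have "(\<lambda>b. cnorm I (\<lambda>i. b i - fst x i)) \<in> borel_measurable ?B"
      unfolding cnorm_def L2_set_def by measurable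
    then have "{b \<in> space ?B. cnorm I (\<lambda>i. b i - fst x i) < 1 / real (Suc (snd x))} \<in> sets ?B"
      by measurable
    from sets_uniform_csphereI[OF I this] show ?thesis by (simp add: U_def case_prod_unfold)
  qed
  define J where "J = {x \<in> Q \<times> UNIV. U x \<subseteq> S}"
  have J: "countable J" unfolding J_def using Q by (intro countable_subset[OF _ countable_SIGMA[OF Q, of "\<lambda>_. UNIV"]]) auto
  have "S \<subseteq> (\<Union>x\<in>J. U x)"
  proof
    fix a assume a: "a \<in> S"
    obtain r where r: "r > 0" "\<And>b. b \<in> space (uniform_csphere I) \<Longrightarrow> cnorm I (\<lambda>i. b i - a i) < r \<Longrightarrow> b \<in> S"
      using op[OF a] by blast
    obtain n where n: "1 / real (Suc n) < r / 2"
      using reals_Archimedean[of "r / 2"] r(1) by (auto simp: inverse_eq_divide)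
    \<comment> \<open>Dividing by \<open>card I\<close> keeps the sum of the coordinate errors below
      the radius \<open>1 / Suc n\<close>; two such radii fit into \<open>r\<close>.\<close>
    define \<eta> where "\<eta> = 1 / real (Suc n) / real (card I)"
    have \<eta>: "\<eta> > 0" using I by (simp add: \<eta>_def card_gt_0_iff)
    have "\<exists>p\<in>D. p \<in> ball (a i) \<eta>" for i using \<eta> by (intro D(2)) auto
    then obtain p where p: "\<And>i. p i \<in> D" "\<And>i. p i \<in> ball (a i) \<eta>" by metis
    define q where "q = (\<lambda>i\<in>I. p i)"
    have qQ: "q \<in> Q" using p by (simp add: q_def Q_def)
    have aq: "cnorm I (\<lambda>i. a i - q i) < 1 / real (Suc n)"
    proof -
      have "cnorm I (\<lambda>i. a i - q i) \<le> (\<Sum>i\<in>I. norm (a i - q i))" unfolding cnorm_def by (rule L2_set_le_sum) auto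
      also have "\<dots> < (\<Sum>i\<in>I. \<eta>)" using I p(2) by (intro sum_strict_mono) (auto simp: q_def dist_norm)
      also have "\<dots> = 1 / real (Suc n)" using I by (simp add: \<eta>_def)
      finally show ?thesis .
    qed
    have "U (q, n) \<subseteq> S"
    proof
      fix b assume b: "b \<in> U (q, n)"
      have "cnorm I (\<lambda>i. b i - a i) = cnorm I (\<lambda>i. (b i - q i) + (q i - a i))" by simp
      also have "\<dots> \<le> cnorm I (\<lambda>i. b i - q i) + cnorm I (\<lambda>i. q i - a i)" by (rule cnorm_triangle)
      also have "cnorm I (\<lambda>i. q i - a i) = cnorm I (\<lambda>i. a i - q i)" by (simp add: cnorm_def norm_minus_commute)
      also have "cnorm I (\<lambda>i. b i - q i) + cnorm I (\<lambda>i. a i - q i) < r" using b aq n by (simp add: U_def)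
      finally show "b \<in> S" using r(2) b by (simp add: U_def)
    qed
    moreover have "a \<in> U (q, n)"
      using aq a sub space_uniform_csphere[OF I] by (auto simp: U_def space_PiM)
    ultimately show "a \<in> (\<Union>x\<in>J. U x)" using qQ by (auto simp: J_def)
  qed
  moreover have "(\<Union>x\<in>J. U x) \<subseteq> S" by (auto simp: J_def)
  ultimately have "S = (\<Union>x\<in>J. U x)" by blast
  also have "\<dots> \<in> sets (uniform_csphere I)" using J U by (intro sets.countable_UN') auto
  finally show ?thesis .
qed

text \<open>The singular polynomials lie in almost singular sets of arbitrarily small probability.
  They are only covered by a measurable null set; that is enough because the measure is
  completed.\<close>

lemma singular_null_set:
  assumes d: "d \<ge> 1"
  shows "{a \<in> space (mu d). \<exists>z. norm z = 1 \<and> hom_poly d a z = 0 \<and> grad d a z = 0} \<in> null_sets (mu d)"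
    (is "?S \<in> _")
proof -
  interpret prob_space "mu d" by (rule prob_space_mu)
  have "\<exists>W. W \<in> sets (mu d) \<and> measure (mu d) W \<le> singular_const * (1 / real (Suc n)) ^ 4 * (real d)\<^sup>2 \<and> ?S \<subseteq> W" for n
  proof -
    obtain W where W: "W \<in> sets (mu d)" "measure (mu d) W \<le> singular_const * (1 / real (Suc n)) ^ 4 * (real d)\<^sup>2"
      "\<And>a z. a \<in> space (mu d) \<Longrightarrow> norm z = 1 \<Longrightarrow> hom_poly d a z = 0 \<Longrightarrow> norm (grad d a z) \<le> 1 / real (Suc n) \<Longrightarrow> a \<in> W"
      by (rule almost_singular_measure[OF d, of "1 / real (Suc n)"]) auto
    have "?S \<subseteq> W" using W(3) by force
    then show ?thesis using W(1,2) by blast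
  qed
  then have "\<forall>n. \<exists>W. W \<in> sets (mu d) \<and> measure (mu d) W \<le> singular_const * (1 / real (Suc n)) ^ 4 * (real d)\<^sup>2 \<and> ?S \<subseteq> W"
    by (rule allI)
  from choice[OF this] obtain W where W: "\<And>n. W n \<in> sets (mu d)" "\<And>n. measure (mu d) (W n) \<le> singular_const * (1 / real (Suc n)) ^ 4 * (real d)\<^sup>2"
    "\<And>n. ?S \<subseteq> W n"
    by blast
  have sW: "(\<Inter>n. W n) \<in> sets (mu d)" using W(1) by auto
  have "(\<lambda>n. singular_const * (1 / real (Suc n)) ^ 4 * (real d)\<^sup>2) \<longlonglongrightarrow> singular_const * 0 ^ 4 * (real d)\<^sup>2"
    by (intro tendsto_intros LIMSEQ_Suc[OF lim_1_over_n])
  moreover have "measure (mu d) (\<Inter>n. W n) \<le> singular_const * (1 / real (Suc n)) ^ 4 * (real d)\<^sup>2" for n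
    using finite_measure_mono[of "\<Inter>n. W n" "W n"] W(1,2) by (meson INT_lower UNIV_I order_trans)
  ultimately have "measure (mu d) (\<Inter>n. W n) \<le> 0"
    by (intro LIMSEQ_le_const[where X = "\<lambda>n. singular_const * (1 / real (Suc n)) ^ 4 * (real d)\<^sup>2"]) auto
  then have "emeasure (mu d) (\<Inter>n. W n) = 0"
    by (simp add: emeasure_eq_measure measure_le_0_iff)
  then have "(\<Inter>n. W n) \<in> null_sets (mu d)" using sW by auto
  moreover have "?S \<subseteq> (\<Inter>n. W n)" using W(3) by blast
  ultimately show ?thesis
    unfolding mu_def uniform_csphere_def by (rule null_sets_completion_subset[rotated])
qed

text \<open>On the complement of the null set of singular polynomials the systole is upper semicontinuous.\<close>

lemma sets_systole_ge:
  assumes d: "d \<ge> 1"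
  shows "{a \<in> space (mu d). systole (zero_locus (hom_poly d a)) \<ge> ereal c} \<in> sets (mu d)" (is "?A \<in> _")
proof -
  let ?I = "exponents d"
  let ?S = "{a \<in> space (mu d). \<exists>z. norm z = 1 \<and> hom_poly d a z = 0 \<and> grad d a z = 0}"
  note null = singular_null_set[OF d]
  define V where "V = {a \<in> space (mu d). a \<notin> ?S \<and> systole (zero_locus (hom_poly d a)) < ereal c}"
  have "\<exists>r>0. \<forall>b. cnorm ?I b = 1 \<longrightarrow> cnorm ?I (\<lambda>\<alpha>. b \<alpha> - a \<alpha>) < r \<longrightarrow> systole (zero_locus (hom_poly d b)) < ereal c"
    if a: "a \<in> V" for a
  proof -
    have "\<And>z. norm z = 1 \<Longrightarrow> hom_poly d a z = 0 \<Longrightarrow> grad d a z \<noteq> 0"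
      and "systole (zero_locus (hom_poly d a)) < ereal c" and "cnorm ?I a = 1"
      using a space_mu by (auto simp: V_def)
    from systole_persists[OF d this(3,1,2)] show ?thesis by metis
  qed
  then obtain r where r: "\<And>a. a \<in> V \<Longrightarrow> r a > 0"
    "\<And>a b. a \<in> V \<Longrightarrow> cnorm ?I b = 1 \<Longrightarrow> cnorm ?I (\<lambda>\<alpha>. b \<alpha> - a \<alpha>) < r a \<Longrightarrow> systole (zero_locus (hom_poly d b)) < ereal c"
    by metis
  \<comment> \<open>The balls around points of \<open>V\<close> may contain singular polynomials,
    but the systole is below \<open>c\<close> there as well. So \<open>V'\<close> is open and agrees
    with \<open>V\<close> off the singular set.\<close>
  define V' where "V' = {b \<in> space (mu d). \<exists>a\<in>V. cnorm ?I (\<lambda>\<alpha>. b \<alpha> - a \<alpha>) < r a}"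
  have SV: "V' \<in> sets (mu d)"
    unfolding mu_def
  proof (rule sets_uniform_csphere_open[OF finite_exponents exponents_nonempty])
    show "V' \<subseteq> space (uniform_csphere ?I)" by (auto simp: V'_def mu_def)
    fix b assume "b \<in> V'"
    then obtain a where a: "a \<in> V" "cnorm ?I (\<lambda>\<alpha>. b \<alpha> - a \<alpha>) < r a" by (auto simp: V'_def)
    show "\<exists>s>0. \<forall>b'\<in>space (uniform_csphere ?I). cnorm ?I (\<lambda>\<alpha>. b' \<alpha> - b \<alpha>) < s \<longrightarrow> b' \<in> V'"
    proof (intro exI[of _ "r a - cnorm ?I (\<lambda>\<alpha>. b \<alpha> - a \<alpha>)"] conjI ballI impI)
      show "0 < r a - cnorm ?I (\<lambda>\<alpha>. b \<alpha> - a \<alpha>)" using a(2) by simp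
      fix b' assume b': "b' \<in> space (uniform_csphere ?I)" "cnorm ?I (\<lambda>\<alpha>. b' \<alpha> - b \<alpha>) < r a - cnorm ?I (\<lambda>\<alpha>. b \<alpha> - a \<alpha>)"
      have "cnorm ?I (\<lambda>\<alpha>. b' \<alpha> - a \<alpha>) \<le> cnorm ?I (\<lambda>\<alpha>. b' \<alpha> - b \<alpha>) + cnorm ?I (\<lambda>\<alpha>. b \<alpha> - a \<alpha>)"
        using cnorm_triangle[of ?I "\<lambda>\<alpha>. b' \<alpha> - b \<alpha>" "\<lambda>\<alpha>. b \<alpha> - a \<alpha>"] by simp
      then have "cnorm ?I (\<lambda>\<alpha>. b' \<alpha> - a \<alpha>) < r a" using b'(2) by linarith
      then show "b' \<in> V'" using a(1) b'(1) by (auto simp: V'_def mu_def)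
    qed
  qed
  have SA: "?S \<in> sets (mu d)" using null by auto
  have A: "?A = (space (mu d) - ?S - V') \<union> (?A \<inter> ?S)"
  proof (rule set_eqI)
    fix a
    show "a \<in> ?A \<longleftrightarrow> a \<in> (space (mu d) - ?S - V') \<union> (?A \<inter> ?S)"
    proof (cases "a \<in> space (mu d) \<and> a \<notin> ?S")
      case True
      have "a \<in> V' \<longleftrightarrow> systole (zero_locus (hom_poly d a)) < ereal c"
      proof
        assume "a \<in> V'"
        then show "systole (zero_locus (hom_poly d a)) < ereal c"
          using r(2) space_mu by (auto simp: V'_def)
      next
        assume "systole (zero_locus (hom_poly d a)) < ereal c"
        then have "a \<in> V" using True by (simp add: V_def)
        moreover have "cnorm ?I (\<lambda>\<alpha>. a \<alpha> - a \<alpha>) = 0" by (simp add: cnorm_def L2_set_def)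
        ultimately show "a \<in> V'"
          unfolding V'_def mem_Collect_eq using r(1)[of a] True by (intro conjI bexI[of _ a]) simp_all
      qed
      then show ?thesis using True by (auto simp: not_less)
    qed auto
  qed
  \<comment> \<open>Completeness of the measure makes every subset of the singular null set
    measurable, whatever the systole is there.\<close>
  have AS: "?A \<inter> ?S \<in> sets (mu d)"
  proof -
    have "?A \<inter> ?S \<in> null_sets (mu d)"
      using null unfolding mu_def uniform_csphere_def by (rule null_sets_completion_subset[rotated]) auto
    then show ?thesis by auto
  qed
  show ?thesis
    by (subst A) (intro sets.Un sets.Diff sets.top SA SV AS)
qed

section \<open>The systole of random curves\<close>

text \<open>The constants are found backwards from the length \<open>d^-4\<close>. The condition
  \<open>4 * length \<le> \<rho> / 12\<close> asks for \<open>\<rho> = 48 / d ^ 4\<close>; with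
  \<open>M \<le> 64 * d\<^sup>2\<close> this makes \<open>2 * M * \<rho>\<close> at most
  \<open>6144 / d\<^sup>2 = \<beta>\<close>, and \<open>4 * \<beta>\<close> is the gradient bound.
  From \<open>d \<ge> 6\<close> follows \<open>d ^ 3 \<ge> 192\<close>, hence
  \<open>\<rho> \<le> chart_radius d\<close>.\<close>

lemma systole_ge:
  assumes d: "d \<ge> 6" and a: "cnorm (exponents d) a = 1"
    and reg: "\<And>z. norm z = 1 \<Longrightarrow> hom_poly d a z = 0 \<Longrightarrow> norm (grad d a z) \<ge> 24576 / (real d)\<^sup>2"
  shows "systole (zero_locus (hom_poly d a)) \<ge> ereal (1 / real d ^ 4)"
proof -
  have d1: "d \<ge> 1" "real d \<ge> 6" using d by auto
  define \<delta> where "\<delta> = 24576 / (real d)\<^sup>2"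
  define \<beta> where "\<beta> = \<delta> / 4"
  define M where "M = curvature_bound d a"
  have \<delta>: "\<delta> > 0" using d1 by (simp add: \<delta>_def)
  have M0: "M > 0" using kernel_const_pos[of d] d1 by (simp add: M_def curvature_bound_def sup_bound_def a)
  have Mle: "M \<le> 64 * (real d)\<^sup>2"
  proof -
    have "kernel_const d \<le> (2 * real d)\<^sup>2" using kernel_const_le[OF d1(1)] zero_le_power2[of "real d"]
      unfolding power2_eq_square by linarith
    then have "sqrt (kernel_const d) \<le> 2 * real d" by (intro real_le_lsqrt) (auto simp: kernel_const_def)
    then have "32 * real d * sqrt (kernel_const d) \<le> 32 * real d * (2 * real d)" by (intro mult_left_mono) auto
    then show ?thesis by (simp add: M_def curvature_bound_def sup_bound_def a power2_eq_square)
  qed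
  define \<rho> where "\<rho> = 48 / real d ^ 4"
  have d3: "real d ^ 3 \<ge> 6 ^ 3" using d1 by (intro power_mono) auto
  have "\<rho> \<le> chart_radius d"
  proof -
    have "48 / real d ^ 4 \<le> 1 / (4 * real d)"
      using d1 d3 by (simp add: divide_simps power4_eq_xxxx power3_eq_cube)
    also have "\<dots> \<le> 1 / (4 * sqrt (real d))"
    proof (intro divide_left_mono)
      show "4 * sqrt (real d) \<le> 4 * real d" using d1 by (simp add: real_le_lsqrt power2_eq_square)
    qed (use d1 in auto)
    finally show ?thesis by (simp add: \<rho>_def chart_radius_def)
  qed
  moreover have "2 * M * \<rho> \<le> \<beta>"
  proof -
    have "2 * M * \<rho> \<le> 2 * (64 * (real d)\<^sup>2) * \<rho>" using Mle by (intro mult_right_mono) (auto simp: \<rho>_def)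
    also have "\<dots> = \<beta>" using d1 by (simp add: \<rho>_def \<beta>_def \<delta>_def field_simps power4_eq_xxxx power2_eq_square)
    finally show ?thesis .
  qed
  ultimately have P: "retraction_params d a \<beta> \<rho>"
    using d1 \<delta> by (simp add: retraction_params_def M_def \<beta>_def \<rho>_def)
  have "ereal (1 / real d ^ 4) \<le> ereal (fs_length \<gamma>)"
    if \<gamma>: "smooth_closed_curve \<gamma>" "range \<gamma> \<subseteq> zero_locus (hom_poly d a)" "\<not> contractible_loop (zero_locus (hom_poly d a)) \<gamma>" for \<gamma>
  proof (rule ccontr)
    assume "\<not> ?thesis"
    then have l: "fs_length \<gamma> < 1 / real d ^ 4" by simp
    have "contractible_loop (zero_locus (hom_poly d a)) \<gamma>"
    proof (rule short_loop_contractible[OF P _ \<gamma>(1,2)])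
      show "norm (grad d a z) \<ge> 4 * \<beta>" if "norm z = 1" "hom_poly d a z = 0" for z
        using reg[OF that] by (simp add: \<beta>_def \<delta>_def)
      show "4 * fs_length \<gamma> \<le> \<rho> / 12" using l by (simp add: \<rho>_def)
      have "4 / real d ^ 4 \<le> 1 / (16 * real d)"
        using d1 d3 by (simp add: divide_simps power4_eq_xxxx power3_eq_cube)
      then show "4 * fs_length \<gamma> \<le> 1 / (16 * real d)" using l by simp
    qed
    then show False using \<gamma>(3) by simp
  qed
  then show ?thesis unfolding systole_def by (intro Inf_greatest) auto
qed

theorem theorem1p1:
  shows "(\<lambda>d. measure (mu d)
            {a \<in> space (mu d). systole (zero_locus (hom_poly d a)) \<ge> ereal (1 / real d ^ 4)})
         \<longlonglongrightarrow> 1"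
proof (rule tendsto_sandwich)
  define K where "K = singular_const * 24576 ^ 4"
  have K: "K \<ge> 0" by (simp add: K_def singular_const_def)
  show "(\<lambda>d. 1 - K / real d) \<longlonglongrightarrow> 1"
    using tendsto_diff[OF tendsto_const lim_const_over_n[of K], of 1] by simp
  show "(\<lambda>_. 1 :: real) \<longlonglongrightarrow> 1" by simp
  show "\<forall>\<^sub>F d in sequentially. measure (mu d)
      {a \<in> space (mu d). systole (zero_locus (hom_poly d a)) \<ge> ereal (1 / real d ^ 4)} \<le> 1"
    using prob_space.prob_le_1[OF prob_space_mu] by simp
  show "\<forall>\<^sub>F d in sequentially. 1 - K / real d \<le> measure (mu d)
      {a \<in> space (mu d). systole (zero_locus (hom_poly d a)) \<ge> ereal (1 / real d ^ 4)}"
  \<comment> \<open>Any bound with square at least 24576 would do; it ensures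
    \<open>\<delta> \<le> 1\<close>.\<close>
  proof (rule eventually_sequentiallyI[of 200])
    fix d :: nat assume d: "200 \<le> d"
    interpret prob_space "mu d" by (rule prob_space_mu)
    let ?A = "{a \<in> space (mu d). systole (zero_locus (hom_poly d a)) \<ge> ereal (1 / real d ^ 4)}"
    define \<delta> where "\<delta> = 24576 / (real d)\<^sup>2"
    have d200: "real d \<ge> 200" using d by simp
    have "(real d)\<^sup>2 \<ge> 200\<^sup>2" using d200 by (intro power_mono) auto
    then have \<delta>: "0 < \<delta>" "\<delta> \<le> 1" using d200 by (simp_all add: \<delta>_def divide_le_eq)
    have d1: "d \<ge> 1" "d \<ge> 6" using d by auto
    obtain W where W: "W \<in> sets (mu d)" "measure (mu d) W \<le> singular_const * \<delta> ^ 4 * (real d)\<^sup>2"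
      "\<And>a z. a \<in> space (mu d) \<Longrightarrow> norm z = 1 \<Longrightarrow> hom_poly d a z = 0 \<Longrightarrow> norm (grad d a z) \<le> \<delta> \<Longrightarrow> a \<in> W"
      using almost_singular_measure[OF d1(1) \<delta>] by blast
    \<comment> \<open>The decay \<open>d^-6\<close> is weakened to \<open>1 / d\<close>, which
      already suffices for the limit.\<close>
    have "singular_const * \<delta> ^ 4 * (real d)\<^sup>2 = K / real d ^ 6"
      using d200 by (simp add: K_def \<delta>_def power_divide field_simps power_mult[symmetric] power_add[symmetric])
    also have "\<dots> \<le> K / real d"
      using d200 K power_increasing[of 1 6 "real d"] by (intro divide_left_mono) auto
    finally have WK: "measure (mu d) W \<le> K / real d" using W(2) by linarith
    have sub: "space (mu d) - W \<subseteq> ?A"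
    proof
      fix a assume a: "a \<in> space (mu d) - W"
      have "norm (grad d a z) \<ge> 24576 / (real d)\<^sup>2" if "norm z = 1" "hom_poly d a z = 0" for z
        using W(3)[of a z] a that by (force simp: \<delta>_def)
      then show "a \<in> ?A" using systole_ge[OF d1(2) space_mu] a by blast
    qed
    have "1 - K / real d \<le> 1 - measure (mu d) W" using WK by simp
    also have "\<dots> = measure (mu d) (space (mu d) - W)" using prob_compl[OF W(1)] by simp
    also have "\<dots> \<le> measure (mu d) ?A"
      using sub sets_systole_ge[OF d1(1)] by (intro finite_measure_mono) auto
    finally show "1 - K / real d \<le> measure (mu d) ?A" .
  qed
qed

end
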